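(* Let $X,Y$ be complex finite-dimensional Banach spaces. Let $\phi\in\mathcal{H}L_0(B_Y,X)$ be such that $\phi(B_Y)\subseteq B_X$. Then the following assertions are equivalent. (1) $C_\phi^L\colon\mathcal{H}L_0(B_X)\to\mathcal{H}L_0(B_Y)$ is compact. (2) $C_\phi^L\colon\mathcal{H}L_0(B_X)\to\mathcal{H}L_0(B_Y)$ does not fix any copy of $\ell_\infty$. (3) $C_\phi^\infty\colon\mathcal{H}^\infty(B_X)\to\mathcal{H}^\infty(B_Y)$ is weakly compact. (4) $C_\phi^\infty\colon\mathcal{H}^\infty(B_X)\to\mathcal{H}^\infty(B_Y)$ is compact. (5) $\|\phi\|_\infty<1$.
   Context: $B_X$ denotes the open unit ball of $X$. $\mathcal{H}L_0(B_Y,X)$ is the Banach space of all holomorphic Lipschitz maps $f\colon B_Y\to X$ with $f(0)=0$, normed by the Lipschitz constant $L(f)$; $\mathcal{H}L_0(B_X)=\mathcal{H}L_0(B_X,\mathbb C)$. $\mathcal{H}^\infty(B_X)$ is the Banach space of bounded holomorphic functions $B_X\to\mathbb C$ with the supremum norm. $\|\phi\|_\infty=\sup_{y\in B_Y}\|\phi(y)\|$. $C_\phi^L$ and $C_\phi^\infty$ both denote the operator $f\mapsto f\circ\phi$, acting respectively $\mathcal{H}L_0(B_X)\to\mathcal{H}L_0(B_Y)$ and $\mathcal{H}^\infty(B_X)\to\mathcal{H}^\infty(B_Y)$. A bounded operator $T\colon E\to F$ between Banach spaces fixes a copy of $\ell_\infty$ if there is a subspace $G\subseteq E$ isomorphic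 to $\ell_\infty$ such that $T|_G$ is an isomorphism onto its image. *)

theory Defs
  imports "HOL-Analysis.Analysis"
begin

section \<open>Complex normed spaces\<close>

text \<open>
  The distribution only has real normed spaces.  A complex normed space is a real one with a
  compatible complex scalar multiplication for which the norm is homogeneous.
\<close>

class complex_normed_vector = real_normed_vector +
  fixes scaleC :: "complex \<Rightarrow> 'a \<Rightarrow> 'a" (infixr "*\<^sub>C" 75)
  assumes scaleC_add_right: "a *\<^sub>C (x + y) = a *\<^sub>C x + a *\<^sub>C y"
    and scaleC_add_left: "(a + b) *\<^sub>C x = a *\<^sub>C x + b *\<^sub>C x"
    and scaleC_scaleC: "a *\<^sub>C b *\<^sub>C x = (a * b) *\<^sub>C x"
    and scaleC_one: "1 *\<^sub>C x = x"
    and scaleC_of_real: "complex_of_real r *\<^sub>C x = r *\<^sub>R x"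
    and norm_scaleC: "norm (a *\<^sub>C x) = cmod a * norm x"

class complex_banach = complex_normed_vector + banach

global_interpretation complex_vector:
  vector_space "scaleC :: complex \<Rightarrow> 'a \<Rightarrow> 'a::complex_normed_vector"
  by unfold_locales
    (simp_all add: scaleC_add_right scaleC_add_left scaleC_scaleC scaleC_one)

instantiation complex :: complex_banach
begin

definition scaleC_complex :: "complex \<Rightarrow> complex \<Rightarrow> complex"
  where "scaleC_complex a x = a * x"

instance
  by standard (simp_all add: scaleC_complex_def algebra_simps norm_mult scaleR_conv_of_real)

end

definition bounded_clinear :: "('a::complex_normed_vector \<Rightarrow> 'b::complex_normed_vector) \<Rightarrow> bool"
  where "bounded_clinear f \<longleftrightarrow> bounded_linear f \<and> (\<forall>c x. f (c *\<^sub>C x) = c *\<^sub>C f x)"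

lemma bounded_clinear_scaleC: "bounded_clinear (\<lambda>x::'a::complex_normed_vector. c *\<^sub>C x)"
proof -
  have "c *\<^sub>C (r *\<^sub>R x) = r *\<^sub>R (c *\<^sub>C x)" for r and x :: 'a
    by (metis scaleC_of_real scaleC_scaleC mult.commute)
  then have "bounded_linear (\<lambda>x::'a. c *\<^sub>C x)"
    by (intro bounded_linear_intro[where K = "cmod c"])
      (simp_all add: scaleC_add_right norm_scaleC mult.commute)
  then show ?thesis
    by (simp add: bounded_clinear_def scaleC_scaleC mult.commute)
qed

lemma bounded_clinear_add:
  "bounded_clinear f \<Longrightarrow> bounded_clinear g \<Longrightarrow> bounded_clinear (\<lambda>x. f x + g x)"
  by (simp add: bounded_clinear_def bounded_linear_add scaleC_add_right)

lemma bounded_clinear_compose: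
  "bounded_clinear f \<Longrightarrow> bounded_clinear g \<Longrightarrow> bounded_clinear (\<lambda>x. f (g x))"
  by (simp add: bounded_clinear_def bounded_linear_compose)

section \<open>Compact operators, weakly compact operators, copies of \<open>\<ell>\<^sub>\<infinity>\<close>\<close>

definition compact_operator ::
    "('a::complex_normed_vector \<Rightarrow> 'b::complex_normed_vector) \<Rightarrow> bool"
  where "compact_operator T \<longleftrightarrow> bounded_clinear T \<and> compact (closure (T ` cball 0 1))"

text \<open>The coarsest topology for which all bounded complex-linear functionals are continuous.\<close>

definition weak_topology :: "'a::complex_normed_vector topology"
  where "weak_topology =
    topology_generated_by {u -` U | (u :: 'a \<Rightarrow> complex) U. bounded_clinear u \<and> open U}"

definition weakly_compact_operator ::
    "('a::complex_normed_vector \<Rightarrow> 'b::complex_normed_vector) \<Rightarrow> bool"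
  where "weakly_compact_operator T \<longleftrightarrow>
    bounded_clinear T \<and> compactin weak_topology (weak_topology closure_of (T ` cball 0 1))"

definition isomorphism_on ::
    "'a::complex_normed_vector set \<Rightarrow> 'b::complex_normed_vector set \<Rightarrow> ('a \<Rightarrow> 'b) \<Rightarrow> bool"
  where "isomorphism_on G H f \<longleftrightarrow>
    complex_vector.subspace G \<and> complex_vector.subspace H \<and>
    (\<forall>x\<in>G. \<forall>y\<in>G. f (x + y) = f x + f y) \<and> (\<forall>c. \<forall>x\<in>G. f (c *\<^sub>C x) = c *\<^sub>C f x) \<and>
    (\<exists>g. homeomorphism G H f g)"

instantiation bcontfun :: (topological_space, complex_normed_vector) complex_normed_vector
begin

definition scaleC_bcontfun :: "complex \<Rightarrow> ('a \<Rightarrow>\<^sub>C 'b) \<Rightarrow> 'a \<Rightarrow>\<^sub>C 'b"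
  where "scaleC_bcontfun c f = Bcontfun (\<lambda>x. c *\<^sub>C apply_bcontfun f x)"

lemma apply_bcontfun_scaleC: "apply_bcontfun (c *\<^sub>C f) x = c *\<^sub>C apply_bcontfun f x"
  for f :: "'a \<Rightarrow>\<^sub>C 'b"
proof -
  have bl: "bounded_linear (\<lambda>x::'b. c *\<^sub>C x)"
    using bounded_clinear_scaleC bounded_clinear_def by blast
  have "continuous_on UNIV (\<lambda>x. c *\<^sub>C apply_bcontfun f x)"
    by (rule bounded_linear.continuous_on[OF bl]) simp
  moreover have "norm (c *\<^sub>C apply_bcontfun f x) \<le> cmod c * norm f" for x
    by (simp add: norm_scaleC norm_bounded mult_left_mono)
  ultimately have "(\<lambda>x. c *\<^sub>C apply_bcontfun f x) \<in> bcontfun"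
    by (rule bcontfun_normI)
  then show ?thesis
    by (simp add: scaleC_bcontfun_def Bcontfun_inverse)
qed

instance
proof
  fix a b :: complex and r :: real and x y :: "'a \<Rightarrow>\<^sub>C 'b"
  show "a *\<^sub>C (x + y) = a *\<^sub>C x + a *\<^sub>C y" "(a + b) *\<^sub>C x = a *\<^sub>C x + b *\<^sub>C x"
    "a *\<^sub>C b *\<^sub>C x = (a * b) *\<^sub>C x" "1 *\<^sub>C x = x" "complex_of_real r *\<^sub>C x = r *\<^sub>R x"
    by (auto intro!: bcontfun_eqI simp: apply_bcontfun_scaleC plus_bcontfun.rep_eq
        scaleR_bcontfun.rep_eq scaleC_add_right scaleC_add_left scaleC_scaleC scaleC_one
        scaleC_of_real)
  have le: "norm (c *\<^sub>C z) \<le> cmod c * norm z" for c and z :: "'a \<Rightarrow>\<^sub>C 'b"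
    by (rule norm_bound) (simp add: apply_bcontfun_scaleC norm_scaleC norm_bounded mult_left_mono)
  show "norm (a *\<^sub>C x) = cmod a * norm x"
  proof (cases "a = 0")
    case True
    then show ?thesis using le[of a x] by simp
  next
    case False
    have "inverse a *\<^sub>C a *\<^sub>C x = x"
      using False
      by (auto intro!: bcontfun_eqI simp: apply_bcontfun_scaleC scaleC_scaleC scaleC_one)
    then have "norm x \<le> cmod (inverse a) * norm (a *\<^sub>C x)"
      using le[of "inverse a" "a *\<^sub>C x"] by simp
    then have "norm x \<le> norm (a *\<^sub>C x) / cmod a"
      by (simp only: norm_inverse divide_inverse mult.commute)
    then have "cmod a * norm x \<le> norm (a *\<^sub>C x)"
      using False by (simp add: pos_le_divide_eq mult.commute)
    then show ?thesis using le[of a x] by simp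
  qed
qed

end

text \<open>Since \<^typ>\<open>nat\<close> is discrete, this is the space of all bounded complex sequences.\<close>

type_synonym ell_infinity = "nat \<Rightarrow>\<^sub>C complex"

definition fixes_copy_of_ell_infinity ::
    "('a::complex_normed_vector \<Rightarrow> 'b::complex_normed_vector) \<Rightarrow> bool"
  where "fixes_copy_of_ell_infinity T \<longleftrightarrow>
    (\<exists>G. (\<exists>J. isomorphism_on (UNIV :: ell_infinity set) G J) \<and> isomorphism_on G (T ` G) T)"

section \<open>Holomorphic maps between complex normed spaces\<close>

definition cfrechet_holomorphic_on ::
    "('a::complex_normed_vector \<Rightarrow> 'b::complex_normed_vector) \<Rightarrow> 'a set \<Rightarrow> bool"
    (infixl "cfrechet'_holomorphic'_on" 50)
  where "f cfrechet_holomorphic_on U \<longleftrightarrow>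
    (\<forall>x\<in>U. \<exists>D. bounded_clinear D \<and> (f has_derivative D) (at x within U))"

lemma cfrechet_holomorphic_on_complex_iff:
  fixes f :: "complex \<Rightarrow> complex"
  shows "f cfrechet_holomorphic_on U \<longleftrightarrow> f holomorphic_on U"
proof -
  have "bounded_clinear D \<longleftrightarrow> (\<exists>d. D = (*) d)" for D :: "complex \<Rightarrow> complex"
  proof
    assume "bounded_clinear D"
    then have "D (c * 1) = c * D 1" for c
      unfolding bounded_clinear_def scaleC_complex_def by blast
    then show "\<exists>d. D = (*) d"
      by (intro exI[of _ "D 1"] ext) (metis mult.commute mult_1_right)
  qed (auto simp: bounded_clinear_def scaleC_complex_def bounded_linear_mult_right)
  then show ?thesis
    by (auto simp: cfrechet_holomorphic_on_def holomorphic_on_def field_differentiable_def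
        has_field_derivative_def) blast
qed

lemma cfrechet_holomorphic_on_const: "(\<lambda>_. c) cfrechet_holomorphic_on U"
proof -
  have "bounded_clinear (\<lambda>_::'a. 0::'b)" by (simp add: bounded_clinear_def)
  then show ?thesis unfolding cfrechet_holomorphic_on_def by (metis has_derivative_const)
qed

lemma cfrechet_holomorphic_on_add:
  assumes "f cfrechet_holomorphic_on U" "g cfrechet_holomorphic_on U"
  shows "(\<lambda>x. f x + g x) cfrechet_holomorphic_on U"
  unfolding cfrechet_holomorphic_on_def
proof
  fix x assume "x \<in> U"
  with assms obtain D E where "bounded_clinear D" "(f has_derivative D) (at x within U)"
    "bounded_clinear E" "(g has_derivative E) (at x within U)"
    unfolding cfrechet_holomorphic_on_def by blast
  then show "\<exists>D. bounded_clinear D \<and> ((\<lambda>x. f x + g x) has_derivative D) (at x within U)"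
    by (intro exI[of _ "\<lambda>h. D h + E h"] conjI bounded_clinear_add has_derivative_add)
qed

lemma cfrechet_holomorphic_on_scaleC:
  assumes "f cfrechet_holomorphic_on U"
  shows "(\<lambda>x. c *\<^sub>C f x) cfrechet_holomorphic_on U"
  unfolding cfrechet_holomorphic_on_def
proof
  fix x assume "x \<in> U"
  with assms obtain D where D: "bounded_clinear D" "(f has_derivative D) (at x within U)"
    unfolding cfrechet_holomorphic_on_def by blast
  have "bounded_linear (\<lambda>x::'b. c *\<^sub>C x)"
    using bounded_clinear_scaleC bounded_clinear_def by blast
  then have "((\<lambda>x. c *\<^sub>C f x) has_derivative (\<lambda>h. c *\<^sub>C D h)) (at x within U)"
    using D(2) by (rule bounded_linear.has_derivative)
  then show "\<exists>D. bounded_clinear D \<and> ((\<lambda>x. c *\<^sub>C f x) has_derivative D) (at x within U)"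
    using bounded_clinear_compose[OF bounded_clinear_scaleC D(1)] by blast
qed

lemma cfrechet_holomorphic_on_compose:
  assumes "g cfrechet_holomorphic_on V" "f cfrechet_holomorphic_on U" "f ` U \<subseteq> V"
  shows "(\<lambda>x. g (f x)) cfrechet_holomorphic_on U"
  unfolding cfrechet_holomorphic_on_def
proof
  fix x assume x: "x \<in> U"
  with assms(2) obtain D where D: "bounded_clinear D" "(f has_derivative D) (at x within U)"
    unfolding cfrechet_holomorphic_on_def by blast
  from x assms(1,3) obtain E where
    E: "bounded_clinear E" "(g has_derivative E) (at (f x) within V)"
    unfolding cfrechet_holomorphic_on_def by blast
  have "(g has_derivative E) (at (f x) within f ` U)"
    using E(2) assms(3) by (rule has_derivative_subset)
  then have "((\<lambda>x. g (f x)) has_derivative (\<lambda>h. E (D h))) (at x within U)"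
    using has_derivative_in_compose[OF D(2)] by blast
  then show "\<exists>D. bounded_clinear D \<and> ((\<lambda>x. g (f x)) has_derivative D) (at x within U)"
    using bounded_clinear_compose[OF E(1) D(1)] by blast
qed

lemma cfrechet_holomorphic_on_cong:
  assumes "f cfrechet_holomorphic_on U" "\<And>x. x \<in> U \<Longrightarrow> g x = f x"
  shows "g cfrechet_holomorphic_on U"
  unfolding cfrechet_holomorphic_on_def
proof
  fix x assume x: "x \<in> U"
  with assms(1) obtain D where D: "bounded_clinear D" "(f has_derivative D) (at x within U)"
    unfolding cfrechet_holomorphic_on_def by blast
  have "(g has_derivative D) (at x within U)"
    by (rule has_derivative_transform[OF x _ D(2)]) (rule assms(2))
  with D(1) show "\<exists>D. bounded_clinear D \<and> (g has_derivative D) (at x within U)" by blast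
qed

section \<open>The spaces of holomorphic Lipschitz maps and of bounded holomorphic functions\<close>

text \<open>
  A map on the open unit ball is represented by its extension by 0 to the whole space, so that
  two elements are equal iff they agree on the ball.
\<close>

typedef (overloaded) ('a, 'b) hl0 =
  "{f :: 'a::complex_normed_vector \<Rightarrow> 'b::complex_normed_vector.
      f cfrechet_holomorphic_on ball 0 1 \<and> (\<exists>L. L-lipschitz_on (ball 0 1) f) \<and> f 0 = 0 \<and>
      (\<forall>x. x \<notin> ball 0 1 \<longrightarrow> f x = 0)}"
  morphisms apply_hl0 Abs_hl0
  by (rule exI[of _ "\<lambda>_. 0"])
    (auto intro: cfrechet_holomorphic_on_const lipschitz_on_constant)

typedef (overloaded) 'a hinf =
  "{f :: 'a::complex_normed_vector \<Rightarrow> complex.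
      f cfrechet_holomorphic_on ball 0 1 \<and> bounded (f ` ball 0 1) \<and>
      (\<forall>x. x \<notin> ball 0 1 \<longrightarrow> f x = 0)}"
  morphisms apply_hinf Abs_hinf
  by (rule exI[of _ "\<lambda>_. 0"])
    (auto intro: cfrechet_holomorphic_on_const simp: image_constant_conv)

setup_lifting type_definition_hl0
setup_lifting type_definition_hinf

lemma hl0_eqI: "(\<And>x. x \<in> ball 0 1 \<Longrightarrow> apply_hl0 f x = apply_hl0 g x) \<Longrightarrow> f = g"
  by transfer (metis ext)

lemma hinf_eqI: "(\<And>x. x \<in> ball 0 1 \<Longrightarrow> apply_hinf f x = apply_hinf g x) \<Longrightarrow> f = g"
  by transfer (metis ext)

lemma apply_hl0_holomorphic: "apply_hl0 f cfrechet_holomorphic_on ball 0 1"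
  and apply_hl0_lipschitz: "\<exists>L. L-lipschitz_on (ball 0 1) (apply_hl0 f)"
  and apply_hl0_0: "apply_hl0 f 0 = 0"
  using apply_hl0[of f] by simp_all

lemma apply_hinf_holomorphic: "apply_hinf f cfrechet_holomorphic_on ball 0 1"
  and apply_hinf_bounded: "bounded (apply_hinf f ` ball 0 1)"
  using apply_hinf[of f] by simp_all

lemma lipschitz_on_scaleC:
  fixes f :: "'a::metric_space \<Rightarrow> 'b::complex_normed_vector"
  assumes "L-lipschitz_on U f"
  shows "(cmod c * L)-lipschitz_on U (\<lambda>x. c *\<^sub>C f x)"
proof (rule lipschitz_onI)
  fix x y assume "x \<in> U" "y \<in> U"
  then have "cmod c * dist (f x) (f y) \<le> cmod c * (L * dist x y)"
    using lipschitz_onD[OF assms] by (intro mult_left_mono) auto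
  then show "dist (c *\<^sub>C f x) (c *\<^sub>C f y) \<le> cmod c * L * dist x y"
    by (simp add: dist_norm norm_scaleC mult.assoc flip: complex_vector.scale_right_diff_distrib)
qed (use lipschitz_on_nonneg[OF assms] in simp)

lemma bounded_scaleC_comp:
  fixes f :: "'a \<Rightarrow> 'b::complex_normed_vector"
  assumes "bounded (f ` U)"
  shows "bounded ((\<lambda>x. c *\<^sub>C f x) ` U)"
proof -
  have "bounded_linear (\<lambda>x::'b. c *\<^sub>C x)"
    using bounded_clinear_scaleC bounded_clinear_def by blast
  from bounded_linear_image[OF assms this] show ?thesis by (simp add: image_image)
qed

instantiation hl0 :: (complex_normed_vector, complex_normed_vector) complex_normed_vector
begin

lift_definition zero_hl0 :: "('a, 'b) hl0" is "\<lambda>_. 0"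
  by (auto intro: cfrechet_holomorphic_on_const lipschitz_on_constant)

lift_definition plus_hl0 :: "('a, 'b) hl0 \<Rightarrow> ('a, 'b) hl0 \<Rightarrow> ('a, 'b) hl0"
  is "\<lambda>f g x. f x + g x"
  by (auto intro: cfrechet_holomorphic_on_add lipschitz_on_add)

lift_definition scaleC_hl0 :: "complex \<Rightarrow> ('a, 'b) hl0 \<Rightarrow> ('a, 'b) hl0"
  is "\<lambda>c f x. c *\<^sub>C f x"
  by (auto intro: cfrechet_holomorphic_on_scaleC lipschitz_on_scaleC)

definition scaleR_hl0 :: "real \<Rightarrow> ('a, 'b) hl0 \<Rightarrow> ('a, 'b) hl0"
  where "scaleR_hl0 r f = complex_of_real r *\<^sub>C f"

definition uminus_hl0 :: "('a, 'b) hl0 \<Rightarrow> ('a, 'b) hl0"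
  where "uminus_hl0 f = (-1) *\<^sub>C f"

definition minus_hl0 :: "('a, 'b) hl0 \<Rightarrow> ('a, 'b) hl0 \<Rightarrow> ('a, 'b) hl0"
  where "minus_hl0 f g = f + (- g)"

text \<open>
  The best Lipschitz constant on the ball; the pairs with \<open>x = y\<close> contribute \<open>0 / 0 = 0\<close>,
  so the supremum is never over the empty set.
\<close>

definition norm_hl0 :: "('a, 'b) hl0 \<Rightarrow> real"
  where "norm_hl0 f =
    (SUP (x, y) \<in> ball 0 1 \<times> ball 0 1. norm (apply_hl0 f x - apply_hl0 f y) / norm (x - y))"

definition sgn_hl0 :: "('a, 'b) hl0 \<Rightarrow> ('a, 'b) hl0"
  where "sgn_hl0 f = inverse (norm f) *\<^sub>R f"

definition dist_hl0 :: "('a, 'b) hl0 \<Rightarrow> ('a, 'b) hl0 \<Rightarrow> real"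
  where "dist_hl0 f g = norm (f - g)"

definition uniformity_hl0 :: "(('a, 'b) hl0 \<times> ('a, 'b) hl0) filter"
  where "uniformity_hl0 = (INF e\<in>{0<..}. principal {(f, g). dist f g < e})"

definition open_hl0 :: "('a, 'b) hl0 set \<Rightarrow> bool"
  where "open_hl0 S \<longleftrightarrow> (\<forall>f\<in>S. \<forall>\<^sub>F (f', g) in uniformity. f' = f \<longrightarrow> g \<in> S)"

lemma apply_hl0_scaleR: "apply_hl0 (r *\<^sub>R f) x = r *\<^sub>R apply_hl0 f x" for f :: "('a, 'b) hl0"
  by (simp add: scaleR_hl0_def scaleC_hl0.rep_eq scaleC_of_real)

lemma apply_hl0_uminus: "apply_hl0 (- f) x = - apply_hl0 f x" for f :: "('a, 'b) hl0"
  by (simp add: uminus_hl0_def scaleC_hl0.rep_eq)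

lemma apply_hl0_minus: "apply_hl0 (f - g) x = apply_hl0 f x - apply_hl0 g x"
  for f :: "('a, 'b) hl0"
  by (simp add: minus_hl0_def plus_hl0.rep_eq apply_hl0_uminus)

lemmas apply_hl0_simps = zero_hl0.rep_eq plus_hl0.rep_eq scaleC_hl0.rep_eq apply_hl0_scaleR
  apply_hl0_uminus apply_hl0_minus

lemma bdd_above_difference_quotients:
  fixes f :: "('a, 'b) hl0"
  shows "bdd_above ((\<lambda>(x, y). norm (apply_hl0 f x - apply_hl0 f y) / norm (x - y)) `
    (ball 0 1 \<times> ball 0 1))"
proof -
  obtain L where L: "L-lipschitz_on (ball 0 1) (apply_hl0 f)"
    using apply_hl0_lipschitz by blast
  show ?thesis
  proof (rule bdd_aboveI2[where M = L], clarify)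
    fix x y :: 'a assume "x \<in> ball 0 1" "y \<in> ball 0 1"
    then have "norm (apply_hl0 f x - apply_hl0 f y) \<le> L * norm (x - y)"
      using lipschitz_onD[OF L] by (simp add: dist_norm)
    then show "norm (apply_hl0 f x - apply_hl0 f y) / norm (x - y) \<le> L"
      using lipschitz_on_nonneg[OF L] by (cases "x = y") (auto simp: field_simps)
  qed
qed

lemma norm_hl0_bound:
  fixes f :: "('a, 'b) hl0"
  assumes "x \<in> ball 0 1" "y \<in> ball 0 1"
  shows "norm (apply_hl0 f x - apply_hl0 f y) \<le> norm f * norm (x - y)"
proof -
  have "norm (apply_hl0 f x - apply_hl0 f y) / norm (x - y) \<le> norm f"
    unfolding norm_hl0_def
    using assms cSUP_upper[OF _ bdd_above_difference_quotients, of "(x, y)" f] by simp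
  then show ?thesis by (cases "x = y") (auto simp: field_simps)
qed

lemma norm_hl0_nonneg: "0 \<le> norm f" for f :: "('a, 'b) hl0"
  unfolding norm_hl0_def
  using cSUP_upper[OF _ bdd_above_difference_quotients, of "(0, 0)" f] by simp

lemma norm_hl0_le:
  fixes f :: "('a, 'b) hl0"
  assumes "0 \<le> K"
    "\<And>x y. x \<in> ball 0 1 \<Longrightarrow> y \<in> ball 0 1 \<Longrightarrow>
      norm (apply_hl0 f x - apply_hl0 f y) \<le> K * norm (x - y)"
  shows "norm f \<le> K"
  unfolding norm_hl0_def
proof (rule cSUP_least, goal_cases)
  case 1
  have "(0, 0) \<in> ball (0::'a) 1 \<times> ball (0::'a) 1" by simp
  then show ?case by blast
next
  case (2 p)
  obtain x y where p: "p = (x, y)" by fastforce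
  show ?case
  proof (cases "x = y")
    case False
    then show ?thesis using assms(2)[of x y] 2 by (simp add: p field_simps)
  qed (use assms(1) p in simp)
qed

instance
proof
  fix a b :: complex and r s :: real and f g h :: "('a, 'b) hl0"
  show "f + g + h = f + (g + h)" "f + g = g + f" "0 + f = f" "- f + f = 0" "f - g = f + - g"
    "r *\<^sub>R (f + g) = r *\<^sub>R f + r *\<^sub>R g" "(r + s) *\<^sub>R f = r *\<^sub>R f + s *\<^sub>R f"
    "r *\<^sub>R s *\<^sub>R f = (r * s) *\<^sub>R f" "1 *\<^sub>R f = f"
    "a *\<^sub>C (f + g) = a *\<^sub>C f + a *\<^sub>C g" "(a + b) *\<^sub>C f = a *\<^sub>C f + b *\<^sub>C f"
    "a *\<^sub>C b *\<^sub>C f = (a * b) *\<^sub>C f" "1 *\<^sub>C f = f" "complex_of_real r *\<^sub>C f = r *\<^sub>R f"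
    by (auto intro!: hl0_eqI simp: apply_hl0_simps algebra_simps scaleC_add_right
        scaleC_add_left scaleC_scaleC scaleC_one scaleC_of_real)
  show "sgn f = inverse (norm f) *\<^sub>R f" by (rule sgn_hl0_def)
  show "dist f g = norm (f - g)" by (rule dist_hl0_def)
  show "(uniformity :: (('a, 'b) hl0 \<times> ('a, 'b) hl0) filter) =
      (INF e\<in>{0<..}. principal {(x, y). dist x y < e})"
    by (rule uniformity_hl0_def)
  show "open S \<longleftrightarrow> (\<forall>x\<in>S. \<forall>\<^sub>F (x', y) in uniformity. x' = x \<longrightarrow> y \<in> S)"
    for S :: "('a, 'b) hl0 set"
    by (rule open_hl0_def)
  show "norm f = 0 \<longleftrightarrow> f = 0"
  proof
    assume "norm f = 0"
    then have "apply_hl0 f x = 0" if "x \<in> ball 0 1" for x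
      using norm_hl0_bound[OF that, of 0 f] apply_hl0[of f] by simp
    then show "f = 0" by (intro hl0_eqI) (simp add: apply_hl0_simps)
  next
    assume "f = 0"
    then have "norm f \<le> 0" by (intro norm_hl0_le) (simp_all add: apply_hl0_simps)
    then show "norm f = 0" using norm_hl0_nonneg[of f] by simp
  qed
  show "norm (f + g) \<le> norm f + norm g"
  proof (rule norm_hl0_le)
    fix x y :: 'a assume xy: "x \<in> ball 0 1" "y \<in> ball 0 1"
    have "apply_hl0 (f + g) x - apply_hl0 (f + g) y =
        (apply_hl0 f x - apply_hl0 f y) + (apply_hl0 g x - apply_hl0 g y)"
      by (simp add: apply_hl0_simps)
    also have "norm \<dots> \<le> norm f * norm (x - y) + norm g * norm (x - y)"
      by (intro norm_triangle_le add_mono norm_hl0_bound xy)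
    finally show "norm (apply_hl0 (f + g) x - apply_hl0 (f + g) y) \<le>
        (norm f + norm g) * norm (x - y)"
      by (simp add: algebra_simps)
  qed (simp add: norm_hl0_nonneg)
  have le: "norm (c *\<^sub>C k) \<le> cmod c * norm k" for c and k :: "('a, 'b) hl0"
  proof (rule norm_hl0_le)
    fix x y :: 'a assume xy: "x \<in> ball 0 1" "y \<in> ball 0 1"
    show "norm (apply_hl0 (c *\<^sub>C k) x - apply_hl0 (c *\<^sub>C k) y) \<le>
        cmod c * norm k * norm (x - y)"
      using mult_left_mono[OF norm_hl0_bound[OF xy, of k], of "cmod c"]
      by (simp add: apply_hl0_simps norm_scaleC mult.assoc
          flip: complex_vector.scale_right_diff_distrib)
  qed (simp add: norm_hl0_nonneg)
  have eq: "norm (c *\<^sub>C k) = cmod c * norm k" for c and k :: "('a, 'b) hl0"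
  proof (cases "c = 0")
    case True
    then show ?thesis using le[of c k] norm_hl0_nonneg[of "c *\<^sub>C k"] by simp
  next
    case False
    then have "inverse c *\<^sub>C c *\<^sub>C k = k"
      by (auto intro!: hl0_eqI simp: apply_hl0_simps scaleC_scaleC scaleC_one)
    then have "norm k \<le> cmod (inverse c) * norm (c *\<^sub>C k)"
      using le[of "inverse c" "c *\<^sub>C k"] by simp
    then have "norm k \<le> norm (c *\<^sub>C k) / cmod c"
      by (simp only: norm_inverse divide_inverse mult.commute)
    then have "cmod c * norm k \<le> norm (c *\<^sub>C k)"
      using False by (simp add: pos_le_divide_eq mult.commute)
    then show ?thesis using le[of c k] by simp
  qed
  show "norm (a *\<^sub>C f) = cmod a * norm f" by (rule eq)
  show "norm (r *\<^sub>R f) = \<bar>r\<bar> * norm f" by (simp add: scaleR_hl0_def eq)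
qed

end

instantiation hinf :: (complex_normed_vector) complex_normed_vector
begin

lift_definition zero_hinf :: "'a hinf" is "\<lambda>_. 0"
  by (auto intro: cfrechet_holomorphic_on_const simp: image_constant_conv)

lift_definition plus_hinf :: "'a hinf \<Rightarrow> 'a hinf \<Rightarrow> 'a hinf" is "\<lambda>f g x. f x + g x"
  by (auto intro: cfrechet_holomorphic_on_add bounded_plus_comp)

lift_definition scaleC_hinf :: "complex \<Rightarrow> 'a hinf \<Rightarrow> 'a hinf" is "\<lambda>c f x. c *\<^sub>C f x"
  by (auto intro: cfrechet_holomorphic_on_scaleC bounded_scaleC_comp)

definition scaleR_hinf :: "real \<Rightarrow> 'a hinf \<Rightarrow> 'a hinf"
  where "scaleR_hinf r f = complex_of_real r *\<^sub>C f"

definition uminus_hinf :: "'a hinf \<Rightarrow> 'a hinf"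
  where "uminus_hinf f = (-1) *\<^sub>C f"

definition minus_hinf :: "'a hinf \<Rightarrow> 'a hinf \<Rightarrow> 'a hinf"
  where "minus_hinf f g = f + (- g)"

definition norm_hinf :: "'a hinf \<Rightarrow> real"
  where "norm_hinf f = (SUP x \<in> ball 0 1. cmod (apply_hinf f x))"

definition sgn_hinf :: "'a hinf \<Rightarrow> 'a hinf"
  where "sgn_hinf f = inverse (norm f) *\<^sub>R f"

definition dist_hinf :: "'a hinf \<Rightarrow> 'a hinf \<Rightarrow> real"
  where "dist_hinf f g = norm (f - g)"

definition uniformity_hinf :: "('a hinf \<times> 'a hinf) filter"
  where "uniformity_hinf = (INF e\<in>{0<..}. principal {(f, g). dist f g < e})"

definition open_hinf :: "'a hinf set \<Rightarrow> bool"
  where "open_hinf S \<longleftrightarrow> (\<forall>f\<in>S. \<forall>\<^sub>F (f', g) in uniformity. f' = f \<longrightarrow> g \<in> S)"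

lemma apply_hinf_scaleR: "apply_hinf (r *\<^sub>R f) x = r *\<^sub>R apply_hinf f x" for f :: "'a hinf"
  by (simp add: scaleR_hinf_def scaleC_hinf.rep_eq scaleC_of_real)

lemma apply_hinf_uminus: "apply_hinf (- f) x = - apply_hinf f x" for f :: "'a hinf"
  by (simp add: uminus_hinf_def scaleC_hinf.rep_eq scaleC_complex_def)

lemma apply_hinf_minus: "apply_hinf (f - g) x = apply_hinf f x - apply_hinf g x"
  for f :: "'a hinf"
  by (simp add: minus_hinf_def plus_hinf.rep_eq apply_hinf_uminus)

lemmas apply_hinf_simps = zero_hinf.rep_eq plus_hinf.rep_eq scaleC_hinf.rep_eq
  apply_hinf_scaleR apply_hinf_uminus apply_hinf_minus

lemma norm_hinf_bound:
  fixes f :: "'a hinf"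
  assumes "x \<in> ball 0 1"
  shows "cmod (apply_hinf f x) \<le> norm f"
proof -
  have "bdd_above ((\<lambda>x. cmod (apply_hinf f x)) ` ball 0 1)"
    by (intro bounded_imp_bdd_above) (simp add: bounded_norm_comp apply_hinf_bounded)
  with assms show ?thesis unfolding norm_hinf_def by (rule cSUP_upper)
qed

lemma norm_hinf_nonneg: "0 \<le> norm f" for f :: "'a hinf"
  using norm_hinf_bound[of 0 f] norm_ge_zero[of "apply_hinf f 0"] by (simp del: norm_ge_zero)

lemma norm_hinf_le:
  fixes f :: "'a hinf"
  assumes "\<And>x. x \<in> ball 0 1 \<Longrightarrow> cmod (apply_hinf f x) \<le> K"
  shows "norm f \<le> K"
  unfolding norm_hinf_def using assms by (intro cSUP_least) auto

instance
proof
  fix a b :: complex and r s :: real and f g h :: "'a hinf"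
  show "f + g + h = f + (g + h)" "f + g = g + f" "0 + f = f" "- f + f = 0" "f - g = f + - g"
    "r *\<^sub>R (f + g) = r *\<^sub>R f + r *\<^sub>R g" "(r + s) *\<^sub>R f = r *\<^sub>R f + s *\<^sub>R f"
    "r *\<^sub>R s *\<^sub>R f = (r * s) *\<^sub>R f" "1 *\<^sub>R f = f"
    "a *\<^sub>C (f + g) = a *\<^sub>C f + a *\<^sub>C g" "(a + b) *\<^sub>C f = a *\<^sub>C f + b *\<^sub>C f"
    "a *\<^sub>C b *\<^sub>C f = (a * b) *\<^sub>C f" "1 *\<^sub>C f = f" "complex_of_real r *\<^sub>C f = r *\<^sub>R f"
    by (auto intro!: hinf_eqI simp: apply_hinf_simps algebra_simps scaleC_add_right
        scaleC_add_left scaleC_scaleC scaleC_one scaleC_of_real)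
  show "sgn f = inverse (norm f) *\<^sub>R f" by (rule sgn_hinf_def)
  show "dist f g = norm (f - g)" by (rule dist_hinf_def)
  show "(uniformity :: ('a hinf \<times> 'a hinf) filter) =
      (INF e\<in>{0<..}. principal {(x, y). dist x y < e})"
    by (rule uniformity_hinf_def)
  show "open S \<longleftrightarrow> (\<forall>x\<in>S. \<forall>\<^sub>F (x', y) in uniformity. x' = x \<longrightarrow> y \<in> S)" for S :: "'a hinf set"
    by (rule open_hinf_def)
  show "norm f = 0 \<longleftrightarrow> f = 0"
  proof
    assume "norm f = 0"
    then have "apply_hinf f x = 0" if "x \<in> ball 0 1" for x
      using norm_hinf_bound[OF that, of f] by simp
    then show "f = 0" by (intro hinf_eqI) (simp add: apply_hinf_simps)
  next
    assume "f = 0"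
    then have "norm f \<le> 0" by (intro norm_hinf_le) (simp add: apply_hinf_simps)
    then show "norm f = 0" using norm_hinf_nonneg[of f] by simp
  qed
  show "norm (f + g) \<le> norm f + norm g"
    by (rule norm_hinf_le)
      (auto simp: apply_hinf_simps intro!: norm_triangle_le add_mono norm_hinf_bound)
  have le: "norm (c *\<^sub>C k) \<le> cmod c * norm k" for c and k :: "'a hinf"
    by (rule norm_hinf_le)
      (auto simp: apply_hinf_simps norm_scaleC intro!: mult_left_mono norm_hinf_bound)
  have eq: "norm (c *\<^sub>C k) = cmod c * norm k" for c and k :: "'a hinf"
  proof (cases "c = 0")
    case True
    then show ?thesis using le[of c k] norm_hinf_nonneg[of "c *\<^sub>C k"] by simp
  next
    case False
    then have "inverse c *\<^sub>C c *\<^sub>C k = k"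
      by (auto intro!: hinf_eqI simp: apply_hinf_simps scaleC_scaleC scaleC_one)
    then have "norm k \<le> cmod (inverse c) * norm (c *\<^sub>C k)"
      using le[of "inverse c" "c *\<^sub>C k"] by simp
    then have "norm k \<le> norm (c *\<^sub>C k) / cmod c"
      by (simp only: norm_inverse divide_inverse mult.commute)
    then have "cmod c * norm k \<le> norm (c *\<^sub>C k)"
      using False by (simp add: pos_le_divide_eq mult.commute)
    then show ?thesis using le[of c k] by simp
  qed
  show "norm (a *\<^sub>C f) = cmod a * norm f" by (rule eq)
  show "norm (r *\<^sub>R f) = \<bar>r\<bar> * norm f" by (simp add: scaleR_hinf_def eq)
qed

end

section \<open>The composition operators\<close>

text \<open>
  Both are meaningful only if \<open>\<phi>\<close> maps the unit ball into the unit ball;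
  \<open>apply_comp_L\<close> and \<open>apply_comp_inf\<close> below show that they are then the maps
  \<open>f \<mapsto> f \<circ> \<phi>\<close> (the case distinction is the extension by 0).
\<close>

definition comp_L ::
    "('y::complex_normed_vector, 'x::complex_normed_vector) hl0 \<Rightarrow>
      ('x, complex) hl0 \<Rightarrow> ('y, complex) hl0"
  where "comp_L \<phi> f = Abs_hl0 (\<lambda>y. if y \<in> ball 0 1 then apply_hl0 f (apply_hl0 \<phi> y) else 0)"

definition comp_inf ::
    "('y::complex_normed_vector, 'x::complex_normed_vector) hl0 \<Rightarrow> 'x hinf \<Rightarrow> 'y hinf"
  where "comp_inf \<phi> f = Abs_hinf (\<lambda>y. if y \<in> ball 0 1 then apply_hinf f (apply_hl0 \<phi> y) else 0)"

definition sup_norm ::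
    "('y::complex_normed_vector, 'x::complex_normed_vector) hl0 \<Rightarrow> real"
  where "sup_norm \<phi> = (SUP y \<in> ball 0 1. norm (apply_hl0 \<phi> y))"

lemma apply_comp_L:
  assumes "apply_hl0 \<phi> ` ball 0 1 \<subseteq> ball 0 1" "y \<in> ball 0 1"
  shows "apply_hl0 (comp_L \<phi> f) y = apply_hl0 f (apply_hl0 \<phi> y)"
proof -
  let ?g = "\<lambda>y. if y \<in> ball 0 1 then apply_hl0 f (apply_hl0 \<phi> y) else 0"
  have "(\<lambda>y. apply_hl0 f (apply_hl0 \<phi> y)) cfrechet_holomorphic_on ball 0 1"
    by (rule cfrechet_holomorphic_on_compose[OF apply_hl0_holomorphic apply_hl0_holomorphic
          assms(1)])
  then have 1: "?g cfrechet_holomorphic_on ball 0 1"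
    by (rule cfrechet_holomorphic_on_cong) simp
  obtain K L where K: "K-lipschitz_on (ball 0 1) (apply_hl0 \<phi>)"
    and L: "L-lipschitz_on (ball 0 1) (apply_hl0 f)"
    using apply_hl0_lipschitz by metis
  have "(L * K)-lipschitz_on (ball 0 1) (\<lambda>y. apply_hl0 f (apply_hl0 \<phi> y))"
    by (rule lipschitz_on_compose2[OF K lipschitz_on_subset[OF L assms(1)]])
  then have 2: "(L * K)-lipschitz_on (ball 0 1) ?g"
    by (rule lipschitz_on_transform) simp
  have "?g 0 = 0" by (simp add: apply_hl0_0)
  with 1 2 have "apply_hl0 (Abs_hl0 ?g) = ?g"
    by (intro Abs_hl0_inverse) auto
  with assms(2) show ?thesis by (simp add: comp_L_def)
qed

lemma apply_comp_inf:
  assumes "apply_hl0 \<phi> ` ball 0 1 \<subseteq> ball 0 1" "y \<in> ball 0 1"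
  shows "apply_hinf (comp_inf \<phi> f) y = apply_hinf f (apply_hl0 \<phi> y)"
proof -
  let ?g = "\<lambda>y. if y \<in> ball 0 1 then apply_hinf f (apply_hl0 \<phi> y) else 0"
  have "(\<lambda>y. apply_hinf f (apply_hl0 \<phi> y)) cfrechet_holomorphic_on ball 0 1"
    by (rule cfrechet_holomorphic_on_compose[OF apply_hinf_holomorphic apply_hl0_holomorphic
          assms(1)])
  then have 1: "?g cfrechet_holomorphic_on ball 0 1"
    by (rule cfrechet_holomorphic_on_cong) simp
  note apply_hinf_bounded[of f]
  moreover have "?g ` ball 0 1 \<subseteq> apply_hinf f ` ball 0 1" using assms(1) by auto
  ultimately have "bounded (?g ` ball 0 1)" by (rule bounded_subset)
  with 1 have "apply_hinf (Abs_hinf ?g) = ?g"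
    by (intro Abs_hinf_inverse) auto
  with assms(2) show ?thesis by (simp add: comp_inf_def)
qed

lemma bounded_clinear_comp_L:
  fixes \<phi> :: "('y::complex_normed_vector, 'x::complex_normed_vector) hl0"
  assumes "apply_hl0 \<phi> ` ball 0 1 \<subseteq> ball 0 1"
  shows "bounded_clinear (comp_L \<phi>)"
proof -
  have add: "comp_L \<phi> (f + g) = comp_L \<phi> f + comp_L \<phi> g" for f g
    by (rule hl0_eqI) (simp add: apply_comp_L[OF assms] apply_hl0_simps del: mem_ball)
  have scale: "comp_L \<phi> (c *\<^sub>C f) = c *\<^sub>C comp_L \<phi> f" for c f
    by (rule hl0_eqI) (simp add: apply_comp_L[OF assms] apply_hl0_simps del: mem_ball)
  have "norm (comp_L \<phi> f) \<le> norm f * norm \<phi>" for f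
  proof (rule norm_hl0_le)
    fix x y :: 'y assume xy: "x \<in> ball 0 1" "y \<in> ball 0 1"
    have "norm (apply_hl0 f (apply_hl0 \<phi> x) - apply_hl0 f (apply_hl0 \<phi> y)) \<le>
        norm f * norm (apply_hl0 \<phi> x - apply_hl0 \<phi> y)"
      using assms xy by (intro norm_hl0_bound) blast+
    also have "\<dots> \<le> norm f * (norm \<phi> * norm (x - y))"
      using xy by (intro mult_left_mono norm_hl0_bound) auto
    finally show "norm (apply_hl0 (comp_L \<phi> f) x - apply_hl0 (comp_L \<phi> f) y) \<le>
        norm f * norm \<phi> * norm (x - y)"
      using xy by (simp add: apply_comp_L[OF assms] mult.assoc del: mem_ball)
  qed simp
  then have "bounded_linear (comp_L \<phi>)"
    by (intro bounded_linear_intro[where K = "norm \<phi>"])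
      (simp_all add: add scale flip: scaleC_of_real)
  then show ?thesis by (simp add: bounded_clinear_def scale)
qed

lemma bounded_clinear_comp_inf:
  assumes "apply_hl0 \<phi> ` ball 0 1 \<subseteq> ball 0 1"
  shows "bounded_clinear (comp_inf \<phi>)"
proof -
  have add: "comp_inf \<phi> (f + g) = comp_inf \<phi> f + comp_inf \<phi> g" for f g
    by (rule hinf_eqI) (simp add: apply_comp_inf[OF assms] apply_hinf_simps del: mem_ball)
  have scale: "comp_inf \<phi> (c *\<^sub>C f) = c *\<^sub>C comp_inf \<phi> f" for c f
    by (rule hinf_eqI) (simp add: apply_comp_inf[OF assms] apply_hinf_simps del: mem_ball)
  have "norm (comp_inf \<phi> f) \<le> norm f" for f
    using assms
    by (intro norm_hinf_le)
      (auto simp: apply_comp_inf[OF assms] simp del: mem_ball intro!: norm_hinf_bound)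
  then have "bounded_linear (comp_inf \<phi>)"
    by (intro bounded_linear_intro[where K = 1])
      (simp_all add: add scale flip: scaleC_of_real)
  then show ?thesis by (simp add: bounded_clinear_def scale)
qed

end

theory Submission
  imports Defs "HOL-Complex_Analysis.Complex_Analysis"
begin

text \<open>
  Everything depends on whether \<open>\<phi>\<close> maps the unit ball into a smaller ball or comes arbitrarily close
  to the unit sphere of \<open>X\<close>.

  Suppose \<open>\<parallel>\<phi>\<parallel>\<^sub>\<infinity> < 1\<close>.  Since \<open>X\<close> has finite dimension its closed unit ball is compact, and Montel's
  theorem holds: a bounded sequence in either function space has a subsequence that converges
  uniformly on every smaller ball (\<open>Montel_unit_ball\<close>).  This is norm convergence of the composed
  functions in \<open>\<H>\<^sup>\<infinity>\<close>; by the Cauchy estimates on a slightly larger ball it is also convergence of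
  the Lipschitz constants.  So both operators map the closed unit ball to a compact set.

  Suppose \<open>\<parallel>\<phi>\<parallel>\<^sub>\<infinity> = 1\<close>.  By compactness and the Hahn-Banach theorem there is a functional \<open>u\<close> of norm
  one for which \<open>u \<circ> \<phi>\<close> takes values arbitrarily close to \<open>1\<close> (\<open>peaking_functional\<close>), and everything
  further happens in one complex variable.

  For \<open>\<H>\<^sup>\<infinity>\<close>, let \<open>u (\<phi> (y\<^sub>n)) \<longlonglongrightarrow> 1\<close> and look at the functions \<open>((1 + u \<circ> \<phi>) / 2) ^ k\<close>.  They tend to
  \<open>0\<close> at every point as \<open>k\<close> grows, while each of them tends to \<open>1\<close> along the points \<open>y\<^sub>n\<close>.  A weak
  cluster point would therefore be \<open>0\<close>, and yet be sent to \<open>1\<close> by a cluster point of the evaluations at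
  the \<open>y\<^sub>n\<close> (\<open>not_weakly_compact_comp_inf\<close>).

  For \<open>\<H>L\<^sub>0\<close>, the function \<open>u \<circ> \<phi>\<close> vanishes at \<open>0\<close>, so it obeys the Schwarz lemma: where its modulus is
  \<open>1 - \<delta>\<close>, it has risen by at least \<open>\<delta>\<close> over the last piece of a radius, of length less than \<open>2 * \<delta>\<close>.
  So there are points at which \<open>u \<circ> \<phi>\<close> is close to \<open>1\<close> and has a derivative of modulus at least \<open>1 / 2\<close>
  (\<open>points_with_large_derivative\<close>), and composition with \<open>\<phi>\<close> at most halves the derivatives there.
  Choosing such points with values \<open>w\<^sub>n\<close> that approach \<open>1\<close> fast enough, one can interpolate any bounded
  sequence \<open>a\<close> at the \<open>w\<^sub>n\<close>, up to small errors, by a bounded function \<open>g\<^sub>a\<close> that depends linearly on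
  \<open>a\<close> (\<open>peak_interpolation\<close>).  The antiderivatives of the \<open>g\<^sub>a\<close>, composed with \<open>u\<close>, form a copy of
  \<open>\<ell>\<^sub>\<infinity>\<close> that is fixed by the composition operator (\<open>comp_L_fixes_copy\<close>).

  The general implications complete the circle: a compact operator into \<open>\<H>\<^sup>\<infinity>\<close> is weakly compact, and a
  compact operator fixes no copy of \<open>\<ell>\<^sub>\<infinity>\<close>.
\<close>

section \<open>Complex lines through a holomorphic function\<close>

lemma cfrechet_holomorphic_on_subset:
  "f cfrechet_holomorphic_on U \<Longrightarrow> V \<subseteq> U \<Longrightarrow> f cfrechet_holomorphic_on V"
  unfolding cfrechet_holomorphic_on_def by (meson has_derivative_subset subsetD)

lemma bounded_clinear_scaleC_left:
  "bounded_clinear (\<lambda>\<zeta>. \<zeta> *\<^sub>C (h :: 'a::complex_normed_vector))"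
proof -
  have "bounded_linear (\<lambda>\<zeta>. \<zeta> *\<^sub>C h)"
  proof (rule bounded_linear_intro[where K = "norm h"])
    show "(r *\<^sub>R \<zeta>) *\<^sub>C h = r *\<^sub>R (\<zeta> *\<^sub>C h)" for r :: real and \<zeta> :: complex
      by (simp add: scaleR_conv_of_real scaleC_scaleC flip: scaleC_of_real)
  qed (simp_all add: scaleC_add_left norm_scaleC)
  then show ?thesis
    by (simp add: bounded_clinear_def scaleC_scaleC scaleC_complex_def)
qed

lemma bounded_clinear_imp_holomorphic:
  "bounded_clinear u \<Longrightarrow> u cfrechet_holomorphic_on U"
  unfolding cfrechet_holomorphic_on_def
  using bounded_linear_imp_has_derivative bounded_clinear_def by blast

lemma complex_line_has_derivative:
  "((\<lambda>\<zeta>. x + \<zeta> *\<^sub>C (h :: 'a::complex_normed_vector)) has_derivative (\<lambda>\<zeta>. \<zeta> *\<^sub>C h)) F"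
proof -
  have "bounded_linear (\<lambda>\<zeta>. \<zeta> *\<^sub>C h)"
    using bounded_clinear_scaleC_left bounded_clinear_def by blast
  from bounded_linear_imp_has_derivative[OF this] show ?thesis
    by (auto intro!: derivative_eq_intros)
qed

lemma complex_line_holomorphic:
  "(\<lambda>\<zeta>. x + \<zeta> *\<^sub>C (h :: 'a::complex_normed_vector)) cfrechet_holomorphic_on S"
  by (intro cfrechet_holomorphic_on_add cfrechet_holomorphic_on_const
      bounded_clinear_imp_holomorphic bounded_clinear_scaleC_left)

lemma holomorphic_on_complex_line:
  fixes f :: "'a::complex_normed_vector \<Rightarrow> complex"
  assumes "f cfrechet_holomorphic_on U" "\<And>\<zeta>. \<zeta> \<in> S \<Longrightarrow> x + \<zeta> *\<^sub>C h \<in> U"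
  shows "(\<lambda>\<zeta>. f (x + \<zeta> *\<^sub>C h)) holomorphic_on S"
  unfolding cfrechet_holomorphic_on_complex_iff[symmetric]
  by (rule cfrechet_holomorphic_on_compose[OF assms(1) complex_line_holomorphic])
    (use assms(2) in blast)

lemma complex_line_derivative:
  fixes f :: "'a::complex_normed_vector \<Rightarrow> complex"
  assumes "(f has_derivative D) (at x)" "bounded_clinear D"
  shows "((\<lambda>\<zeta>. f (x + \<zeta> *\<^sub>C h)) has_field_derivative D h) (at 0)"
proof -
  have "(f has_derivative D) (at (x + 0 *\<^sub>C h))" using assms(1) by simp
  from has_derivative_compose[OF complex_line_has_derivative this]
  have "((\<lambda>\<zeta>. f (x + \<zeta> *\<^sub>C h)) has_derivative (\<lambda>\<zeta>. D (\<zeta> *\<^sub>C h))) (at 0)" .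
  moreover have "D (\<zeta> *\<^sub>C h) = D h * \<zeta>" for \<zeta>
    using assms(2) by (simp add: bounded_clinear_def scaleC_complex_def)
  ultimately show ?thesis by (simp add: has_field_derivative_def)
qed

text \<open>
  Cauchy's inequalities for \<open>g'\<close> and \<open>g''\<close> on the unit disc, integrated by Taylor's formula from \<open>0\<close>
  to \<open>1\<close>.  Keeping the step \<open>1\<close> fixed and letting the radius vary makes the estimate apply to
  \<open>\<zeta> \<mapsto> f (x + \<zeta> h)\<close> with the large radius \<open>s / \<parallel>h\<parallel>\<close>.
\<close>

lemma Cauchy_increment_bounds:
  assumes g: "g holomorphic_on ball 0 \<rho>" and \<rho>: "\<rho> \<ge> 2"
    and M: "\<And>z. z \<in> ball 0 \<rho> \<Longrightarrow> cmod (g z) \<le> M"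
  shows "cmod (g 1 - g 0) \<le> 4 * M / \<rho>"
    and "cmod (g 1 - g 0 - deriv g 0) \<le> 32 * M / \<rho>\<^sup>2"
proof -
  \<comment> \<open>A disc of radius \<open>\<rho> / 4\<close> around a point of the unit disc stays inside the domain.\<close>
  have bound: "cmod ((deriv ^^ n) g \<xi>) \<le> fact n * M / (\<rho> / 4) ^ n" if \<xi>: "\<xi> \<in> cball 0 1" for n \<xi>
  proof (rule Cauchy_inequality)
    have sub: "cball \<xi> (\<rho> / 4) \<subseteq> ball 0 \<rho>"
    proof
      fix z assume "z \<in> cball \<xi> (\<rho> / 4)"
      then have "cmod (z - \<xi>) \<le> \<rho> / 4" by (simp add: dist_norm norm_minus_commute)
      with \<xi> \<rho> norm_triangle_ineq[of "z - \<xi>" \<xi>] show "z \<in> ball 0 \<rho>" by simp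
    qed
    show "g holomorphic_on ball \<xi> (\<rho> / 4)"
      using g sub by (meson ball_subset_cball holomorphic_on_subset order_trans)
    show "continuous_on (cball \<xi> (\<rho> / 4)) g"
      using g sub by (meson holomorphic_on_imp_continuous_on holomorphic_on_subset)
    show "cmod (g x) \<le> M" if "cmod (\<xi> - x) = \<rho> / 4" for x
      using that sub by (intro M) (auto simp: dist_norm)
  qed (use \<rho> in simp)
  have sub: "cball 0 1 \<subseteq> ball (0::complex) \<rho>" using \<rho> by auto
  have der: "((deriv ^^ n) g has_field_derivative (deriv ^^ Suc n) g z) (at z within cball 0 1)"
    if "z \<in> cball 0 1" for n z
    using holomorphic_derivI[OF holomorphic_higher_deriv[OF g open_ball, of n] open_ball,
        of z "cball 0 1"] that sub by auto
  have "cmod (g 1 - g 0) \<le> (4 * M / \<rho>) * cmod (1 - 0)"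
  proof (rule field_differentiable_bound[where S = "cball 0 1" and f' = "deriv g"])
    show "(g has_field_derivative deriv g z) (at z within cball 0 1)" if "z \<in> cball 0 1" for z
      using der[of z 0] that by simp
    show "cmod (deriv g z) \<le> 4 * M / \<rho>" if "z \<in> cball 0 1" for z
      using bound[OF that, of 1] by (simp add: mult.commute)
  qed auto
  then show "cmod (g 1 - g 0) \<le> 4 * M / \<rho>" by simp
  have "cmod ((deriv ^^ 0) g 1 - (\<Sum>i\<le>1. (deriv ^^ i) g 0 * (1 - 0) ^ i / fact i))
      \<le> (32 * M / \<rho>\<^sup>2) * cmod (1 - 0) ^ Suc 1 / fact 1"
  proof (rule complex_Taylor[where S = "cball 0 1" and n = 1])
    show "cmod ((deriv ^^ Suc 1) g z) \<le> 32 * M / \<rho>\<^sup>2" if "z \<in> cball 0 1" for z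
      using bound[OF that, of 2] by (simp add: power2_eq_square numeral_2_eq_2)
  qed (use der in auto)
  then show "cmod (g 1 - g 0 - deriv g 0) \<le> 32 * M / \<rho>\<^sup>2"
    by (simp add: algebra_simps)
qed

lemma line_in_ball:
  fixes h :: "'a::complex_normed_vector"
  assumes "h \<noteq> 0" "\<zeta> \<in> ball 0 (s / norm h)"
  shows "x + \<zeta> *\<^sub>C h \<in> ball x s"
  using assms by (simp add: dist_norm norm_scaleC pos_less_divide_eq)

text \<open>The Cauchy estimate for the first derivative, integrated along the complex line through the
  two points.\<close>

lemma holomorphic_increment_bound:
  fixes f :: "'a::complex_normed_vector \<Rightarrow> complex"
  assumes f: "f cfrechet_holomorphic_on U" and s: "ball x s \<subseteq> U" "s > 0" and y: "y \<in> U"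
    and M: "\<And>z. z \<in> U \<Longrightarrow> cmod (f z) \<le> M"
  shows "cmod (f y - f x) \<le> 4 * M / s * norm (y - x)"
proof -
  have "x \<in> U" using s by auto
  have M0: "0 \<le> M" using M[OF \<open>x \<in> U\<close>] norm_ge_zero order_trans by blast
  consider "y = x" | "y \<noteq> x" "norm (y - x) \<le> s / 2" | "norm (y - x) > s / 2" by force
  then show ?thesis
  proof cases
    case 2
    define h where "h = y - x"
    have h: "h \<noteq> 0" "norm h \<le> s / 2" using 2 by (auto simp: h_def)
    have line: "x + \<zeta> *\<^sub>C h \<in> U" if "\<zeta> \<in> ball 0 (s / norm h)" for \<zeta>
      using line_in_ball[OF h(1) that] s by blast
    have "2 \<le> s / norm h" using h by (simp add: field_simps)
    from Cauchy_increment_bounds(1)[OF holomorphic_on_complex_line[OF f line] this M[OF line]]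
    show ?thesis using h by (simp add: h_def scaleC_one)
  next
    case 3
    have "cmod (f y - f x) \<le> M + M"
      using M[OF y] M[OF \<open>x \<in> U\<close>] norm_triangle_ineq4[of "f y" "f x"] by linarith
    also have "\<dots> = 4 * M / s * (s / 2)" using s by simp
    also have "\<dots> \<le> 4 * M / s * norm (y - x)" using 3 M0 s by (intro mult_left_mono) auto
    finally show ?thesis .
  qed simp
qed

lemma holomorphic_remainder_bound:
  fixes f :: "'a::complex_normed_vector \<Rightarrow> complex"
  assumes f: "f cfrechet_holomorphic_on U" and s: "ball x s \<subseteq> U" "s > 0"
    and M: "\<And>z. z \<in> U \<Longrightarrow> cmod (f z) \<le> M"
    and D: "(f has_derivative D) (at x)" "bounded_clinear D" and h: "norm h \<le> s / 2"
  shows "cmod (f (x + h) - f x - D h) \<le> 32 * M / s\<^sup>2 * (norm h)\<^sup>2"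
proof (cases "h = 0")
  case True
  then show ?thesis using D(2) by (simp add: bounded_clinear_def linear_simps)
next
  case False
  have line: "x + \<zeta> *\<^sub>C h \<in> U" if "\<zeta> \<in> ball 0 (s / norm h)" for \<zeta>
    using line_in_ball[OF False that] s by blast
  have "2 \<le> s / norm h" using h False by (simp add: field_simps)
  from Cauchy_increment_bounds(2)[OF holomorphic_on_complex_line[OF f line] this M[OF line]]
  show ?thesis using DERIV_imp_deriv[OF complex_line_derivative[OF D, of h]]
    by (simp add: scaleC_one power_divide)
qed

text \<open>
  Boundedness takes the place of local uniform convergence: by
  \<open>holomorphic_remainder_bound\<close> the difference quotients of the \<open>f n\<close> approach the derivatives at a
  rate that does not depend on \<open>n\<close>.  So the derivatives at a point converge together with the
  values, and the remainder estimate passes to the limit.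
\<close>

lemma holomorphic_on_bounded_limit:
  fixes f :: "nat \<Rightarrow> 'a::complex_normed_vector \<Rightarrow> complex"
  assumes f: "\<And>n. f n cfrechet_holomorphic_on U" and U: "open U"
    and M: "\<And>n z. z \<in> U \<Longrightarrow> cmod (f n z) \<le> M"
    and lim: "\<And>z. z \<in> U \<Longrightarrow> (\<lambda>n. f n z) \<longlonglongrightarrow> l z"
  shows "l cfrechet_holomorphic_on U"
  unfolding cfrechet_holomorphic_on_def
proof
  fix x assume x: "x \<in> U"
  then obtain s where s: "s > 0" "ball x s \<subseteq> U" using U open_contains_ball by blast
  have "\<exists>D. bounded_clinear D \<and> (f n has_derivative D) (at x)" for n
    using f[of n] x U unfolding cfrechet_holomorphic_on_def by (metis at_within_open)
  then obtain D where D: "\<And>n. bounded_clinear (D n)" "\<And>n. (f n has_derivative D n) (at x)"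
    by metis
  have M0: "0 \<le> M" using M[OF x] norm_ge_zero order_trans by blast
  define C where "C = 32 * M / s\<^sup>2"
  have C0: "C \<ge> 0" using M0 by (simp add: C_def)
  have rem: "cmod (f n (x + h) - f n x - D n h) \<le> C * (norm h)\<^sup>2" if "norm h \<le> s / 2" for n h
    unfolding C_def by (rule holomorphic_remainder_bound[OF f s(2,1) M D(2) D(1) that])
  have Dadd: "D n (h + k) = D n h + D n k" for n h k
    using D(1)[of n] by (simp add: bounded_clinear_def linear_simps)
  have Dscale: "D n (c *\<^sub>C h) = c * D n h" for n h c
    using D(1)[of n] by (simp add: bounded_clinear_def scaleC_complex_def)
  \<comment> \<open>The difference quotients with a fixed small step converge, and they are uniformly close to
    the derivatives.\<close>
  have "convergent (\<lambda>n. D n h)" for h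
  proof (rule Cauchy_convergent, rule metric_CauchyI)
    fix e :: real assume e: "e > 0"
    \<comment> \<open>The first bound keeps \<open>t * h\<close> in the range of the remainder estimate, the second one makes the
      remainder, divided by \<open>t\<close>, at most \<open>e / 4\<close>.\<close>
    define t where "t = min (s / 2 / (norm h + 1)) (e / (4 * (C * (norm h)\<^sup>2 + 1)))"
    have Ch: "C * (norm h)\<^sup>2 + 1 > 0" using C0 by (simp add: add_nonneg_pos)
    have t: "t > 0" using s e Ch by (simp add: t_def add_nonneg_pos)
    have "t * norm h \<le> s / 2 / (norm h + 1) * (norm h + 1)"
      using t by (intro mult_mono) (auto simp: t_def)
    also have "\<dots> = s / 2"
      using add_nonneg_pos[OF norm_ge_zero[of h] zero_less_one] by (simp add: field_simps)
    finally have ts: "norm (complex_of_real t *\<^sub>C h) \<le> s / 2"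
      using t by (simp add: norm_scaleC)
    have "t * (C * (norm h)\<^sup>2) \<le> e / (4 * (C * (norm h)\<^sup>2 + 1)) * (C * (norm h)\<^sup>2 + 1)"
      using e Ch C0 by (intro mult_mono) (auto simp: t_def)
    moreover have "e / (4 * K) * K = e / 4" if "K > 0" for K using that by simp
    ultimately have te: "t * (C * (norm h)\<^sup>2) \<le> e / 4" using Ch by metis
    define d where "d n = (f n (x + of_real t *\<^sub>C h) - f n x) / of_real t" for n
    have near: "cmod (d n - D n h) \<le> e / 4" for n
    proof -
      have "d n - D n h
          = (f n (x + of_real t *\<^sub>C h) - f n x - D n (of_real t *\<^sub>C h)) / of_real t"
        using t by (simp add: d_def Dscale field_simps)
      also have "cmod \<dots> \<le> C * (t * norm h)\<^sup>2 / t"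
        using rem[OF ts, of n] t by (simp add: norm_divide norm_scaleC divide_right_mono)
      also have "\<dots> = t * (C * (norm h)\<^sup>2)" using t by (simp add: power2_eq_square)
      finally show ?thesis using te by linarith
    qed
    have "x + of_real t *\<^sub>C h \<in> U"
      using ts s by (intro subsetD[OF s(2)]) (simp add: dist_norm)
    then have "d \<longlonglongrightarrow> (l (x + of_real t *\<^sub>C h) - l x) / of_real t"
      unfolding d_def using t x by (intro tendsto_intros lim) auto
    then have "Cauchy d" using convergent_Cauchy convergentI by blast
    then obtain N where N: "\<And>m n. m \<ge> N \<Longrightarrow> n \<ge> N \<Longrightarrow> dist (d m) (d n) < e / 4"
      using metric_CauchyD[of d "e / 4"] e by auto
    have "dist (D m h) (D n h) < e" if "m \<ge> N" "n \<ge> N" for m n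
    proof -
      have "D m h - D n h = (d m - d n) - (d m - D m h) + (d n - D n h)" by simp
      also have "cmod \<dots> \<le> cmod (d m - d n) + cmod (d m - D m h) + cmod (d n - D n h)"
        by (intro norm_triangle_le norm_triangle_le_diff add_mono order_refl)
      finally show ?thesis using N[OF that] near[of m] near[of n] e by (simp add: dist_norm)
    qed
    then show "\<exists>N. \<forall>m\<ge>N. \<forall>n\<ge>N. dist (D m h) (D n h) < e" by blast
  qed
  then obtain E where E: "\<And>h. (\<lambda>n. D n h) \<longlonglongrightarrow> E h" unfolding convergent_def by metis
  have Eadd: "E (h + k) = E h + E k" for h k
    by (rule LIMSEQ_unique[OF E]) (use tendsto_add[OF E E] in \<open>simp add: Dadd\<close>)
  have Escale: "E (c *\<^sub>C h) = c * E h" for c h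
    by (rule LIMSEQ_unique[OF E]) (use tendsto_mult_left[OF E] in \<open>simp add: Dscale\<close>)
  have Erem: "cmod (l (x + h) - l x - E h) \<le> C * (norm h)\<^sup>2" if "norm h \<le> s / 2" for h
  proof -
    have "x + h \<in> U" using that s by (intro subsetD[OF s(2)]) (simp add: dist_norm)
    then have "(\<lambda>n. cmod (f n (x + h) - f n x - D n h)) \<longlonglongrightarrow> cmod (l (x + h) - l x - E h)"
      using x by (intro tendsto_intros lim E)
    then show ?thesis by (rule LIMSEQ_le_const2) (use rem[OF that] in blast)
  qed
  have lM: "cmod (l z) \<le> M" if "z \<in> U" for z
    using LIMSEQ_le_const2[OF tendsto_norm[OF lim[OF that]]] M[OF that] by blast
  have Ebound: "cmod (E h) \<le> norm h * ((2 * M + C * (s / 2)\<^sup>2) / (s / 2))" for h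
  proof (cases "h = 0")
    case True
    then show ?thesis using Escale[of 0 h] by simp
  next
    case False
    \<comment> \<open>A linear map is bounded by its size on the sphere of radius \<open>s / 2\<close>.\<close>
    define k where "k = complex_of_real (s / 2 / norm h) *\<^sub>C h"
    have k: "norm k = s / 2" using False s by (simp add: k_def norm_scaleC norm_divide)
    have "x + k \<in> U" using k s by (intro subsetD[OF s(2)]) (simp add: dist_norm)
    have "cmod (E k) \<le> cmod (l (x + k)) + cmod (l x) + cmod (l (x + k) - l x - E k)"
      by (smt (verit) norm_triangle_ineq4 norm_minus_commute norm_triangle_sub)
    also have "\<dots> \<le> 2 * M + C * (s / 2)\<^sup>2"
      using lM[OF \<open>x + k \<in> U\<close>] lM[OF x] Erem[of k] k by simp
    finally have "s / 2 / norm h * cmod (E h) \<le> 2 * M + C * (s / 2)\<^sup>2"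
      using s by (simp add: k_def Escale norm_mult norm_divide)
    then show ?thesis using False s by (simp add: field_simps)
  qed
  have "bounded_linear E"
    by (rule bounded_linear_intro[OF Eadd _ Ebound])
      (simp add: Escale scaleR_conv_of_real flip: scaleC_of_real)
  then have Ecl: "bounded_clinear E" by (simp add: bounded_clinear_def Escale scaleC_complex_def)
  have "(l has_derivative E) (at x)"
    unfolding has_derivative_at
  proof (intro conjI \<open>bounded_linear E\<close>)
    show "(\<lambda>h. norm (l (x + h) - l x - E h) / norm h) \<midarrow>0\<rightarrow> 0"
    proof (rule tendsto_0_le[where K = 1])
      show "(\<lambda>h. C * norm h) \<midarrow>(0::'a)\<rightarrow> 0" by (auto intro!: tendsto_eq_intros)
      have "eventually (\<lambda>h::'a. norm h < s / 2) (at 0)"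
        using s by (auto simp: eventually_at intro!: exI[of _ "s / 2"])
      then show "\<forall>\<^sub>F h in at 0. norm (norm (l (x + h) - l x - E h) / norm h)
          \<le> norm (C * norm h) * 1"
      proof (rule eventually_mono)
        fix h :: 'a assume "norm h < s / 2"
        then show "norm (norm (l (x + h) - l x - E h) / norm h) \<le> norm (C * norm h) * 1"
          using Erem[of h] C0 by (cases "h = 0") (auto simp: field_simps power2_eq_square)
      qed
    qed
  qed
  then show "\<exists>D. bounded_clinear D \<and> (l has_derivative D) (at x within U)"
    using Ecl has_derivative_at_withinI by blast
qed

section \<open>Complex spaces of finite dimension\<close>

text \<open>
  Norm equivalence in disguise: when a vector \<open>v\<close> is adjoined to \<open>S\<close>, the coefficient of \<open>v\<close> is a
  bounded function of the vector, so one extracts a convergent subsequence of the coefficients and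
  applies the induction hypothesis to what remains.
\<close>

lemma finite_span_sequentially_compact:
  fixes S :: "'a::complex_normed_vector set" and x :: "nat \<Rightarrow> 'a"
  assumes "finite S" "range x \<subseteq> complex_vector.span S" "bounded (range x)"
  shows "\<exists>l\<in>complex_vector.span S. \<exists>r. strict_mono (r :: nat \<Rightarrow> nat) \<and> (x \<circ> r) \<longlonglongrightarrow> l"
  using assms
proof (induction S arbitrary: x)
  case empty
  then have "x = (\<lambda>_. 0)" by (auto simp: image_subset_iff)
  then show ?case by (auto intro!: exI[of _ id] simp: strict_mono_id comp_def)
next
  case (insert v S)
  let ?V = "complex_vector.span S"
  show ?case
  proof (cases "v \<in> ?V")
    case True
    with insert show ?thesis by (simp add: complex_vector.span_redundant)
  next
    case False
    \<comment> \<open>By the induction hypothesis the hyperplane \<open>?V\<close> is closed, so \<open>v\<close> has a positive distance to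
      it, and this bounds the coefficients of \<open>v\<close>.\<close>
    have "closed ?V"
      unfolding closed_sequential_limits
    proof (intro allI impI, elim conjE)
      fix y l assume y: "\<forall>n. y n \<in> ?V" "y \<longlonglongrightarrow> l"
      then obtain m r where "m \<in> ?V" "strict_mono (r :: nat \<Rightarrow> nat)" "(y \<circ> r) \<longlonglongrightarrow> m"
        using insert.IH[of y] convergent_imp_bounded by blast
      then show "l \<in> ?V"
        using LIMSEQ_unique LIMSEQ_subseq_LIMSEQ[OF y(2)] by metis
    qed
    define d where "d = infdist v ?V"
    have "?V \<noteq> {}" using complex_vector.span_zero by blast
    then have d: "d > 0"
      using False \<open>closed ?V\<close> in_closed_iff_infdist_zero infdist_nonneg[of v ?V]
      by (metis d_def order_less_le)
    have "\<forall>n. \<exists>k. x n - k *\<^sub>C v \<in> ?V"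
      using insert.prems(1) by (auto simp: complex_vector.span_breakdown_eq image_subset_iff)
    then obtain a where a: "\<And>n. x n - a n *\<^sub>C v \<in> ?V" by metis
    obtain K where K: "\<And>n. norm (x n) \<le> K" using insert.prems(2) by (auto simp: bounded_iff)
    have "cmod (a n) \<le> K / d" for n
    proof (cases "a n = 0")
      case True
      then show ?thesis using d K[of n] norm_ge_zero[of "x n"] by (simp del: norm_ge_zero)
    next
      case False
      have "- inverse (a n) *\<^sub>C (x n - a n *\<^sub>C v) \<in> ?V"
        by (rule complex_vector.span_scale[OF a])
      then have "d \<le> dist v (- inverse (a n) *\<^sub>C (x n - a n *\<^sub>C v))"
        unfolding d_def by (rule infdist_le)
      also have "v - (- inverse (a n) *\<^sub>C (x n - a n *\<^sub>C v)) = inverse (a n) *\<^sub>C x n"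
        using False
        by (simp add: complex_vector.scale_right_diff_distrib scaleC_scaleC scaleC_one)
      then have "dist v (- inverse (a n) *\<^sub>C (x n - a n *\<^sub>C v)) = norm (x n) / cmod (a n)"
        by (simp only: dist_norm norm_scaleC norm_inverse divide_inverse mult.commute)
      finally show ?thesis using False d K[of n] by (simp add: field_simps)
    qed
    then have "bounded (range a)" by (auto simp: bounded_iff)
    then obtain b r where r: "strict_mono (r :: nat \<Rightarrow> nat)" "(a \<circ> r) \<longlonglongrightarrow> b"
      using bounded_imp_convergent_subsequence by blast
    have av: "(\<lambda>n. a (r n) *\<^sub>C v) \<longlonglongrightarrow> b *\<^sub>C v"
      using bounded_linear.tendsto[of "\<lambda>\<zeta>. \<zeta> *\<^sub>C v", OF _ r(2)] bounded_clinear_scaleC_left[of v]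
      unfolding bounded_clinear_def comp_def by blast
    define y where "y n = x (r n) - a (r n) *\<^sub>C v" for n
    have "bounded (range (\<lambda>n. x (r n)))"
      by (rule bounded_subset[OF insert.prems(2)]) auto
    then have "bounded (range y)"
      unfolding y_def using convergent_imp_bounded[OF av] by (intro bounded_minus_comp)
    then obtain m q where q: "m \<in> ?V" "strict_mono (q :: nat \<Rightarrow> nat)" "(y \<circ> q) \<longlonglongrightarrow> m"
      using insert.IH[of y] a unfolding y_def by blast
    have "(\<lambda>n. (y \<circ> q) n + a (r (q n)) *\<^sub>C v) \<longlonglongrightarrow> m + b *\<^sub>C v"
      using LIMSEQ_subseq_LIMSEQ[OF av q(2)] by (intro tendsto_add q) (simp add: comp_def)
    then have "(x \<circ> (r \<circ> q)) \<longlonglongrightarrow> m + b *\<^sub>C v" by (simp add: comp_def y_def)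
    moreover have "m + b *\<^sub>C v \<in> complex_vector.span (insert v S)"
      using q(1) by (auto simp: complex_vector.span_breakdown_eq intro!: exI[of _ b])
    ultimately show ?thesis using strict_mono_o[OF r(1) q(2)] by blast
  qed
qed

lemma finite_span_compact_cball:
  fixes S :: "'a::complex_normed_vector set"
  assumes "finite S" "complex_vector.span S = UNIV"
  shows "compact (cball (0::'a) 1)"
  unfolding compact_eq_seq_compact_metric seq_compact_def
proof (intro allI impI)
  fix x :: "nat \<Rightarrow> 'a" assume x: "\<forall>n. x n \<in> cball 0 1"
  then have "bounded (range x)" by (intro bounded_subset[OF bounded_cball]) blast
  then obtain l r where r: "strict_mono (r :: nat \<Rightarrow> nat)" "(x \<circ> r) \<longlonglongrightarrow> l"
    using finite_span_sequentially_compact[of S x] assms by auto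
  moreover have "l \<in> cball 0 1"
    by (rule closed_sequentially[OF closed_cball _ r(2)]) (use x in auto)
  ultimately show "\<exists>l\<in>cball 0 1. \<exists>r. strict_mono r \<and> (x \<circ> r) \<longlonglongrightarrow> l" by blast
qed

text \<open>
  The Hahn-Banach theorem in finite dimension is obtained by descent: starting from the norm, one
  makes a sublinear functional smaller and linear along one line after another.
\<close>

definition sublinear :: "('a::real_vector \<Rightarrow> real) \<Rightarrow> bool"
  where "sublinear p \<longleftrightarrow>
    (\<forall>x y. p (x + y) \<le> p x + p y) \<and> (\<forall>r\<ge>0. \<forall>x. p (r *\<^sub>R x) = r * p x)"

lemma sublinear_add: "sublinear p \<Longrightarrow> p (x + y) \<le> p x + p y"
  and sublinear_scale: "sublinear p \<Longrightarrow> 0 \<le> r \<Longrightarrow> p (r *\<^sub>R x) = r * p x"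
  by (simp_all add: sublinear_def)

lemma sublinear_zero: "sublinear p \<Longrightarrow> p 0 = 0"
  using sublinear_scale[of p 0 0] by simp

lemma sublinear_minus: "sublinear p \<Longrightarrow> - p x \<le> p (- x)"
  using sublinear_add[of p x "- x"] sublinear_zero[of p] by simp

text \<open>
  The functional \<open>q\<close> is the directional derivative of \<open>p\<close> at \<open>v\<close>, which by convexity is an infimum of
  difference quotients.  Together with \<open>q v \<le> p v\<close> and sublinearity, the bound at \<open>- v\<close> makes \<open>q\<close>
  linear on the line through \<open>v\<close>.
\<close>

lemma sublinear_straighten:
  fixes p :: "'a::real_vector \<Rightarrow> real"
  assumes p: "sublinear p"
  obtains q where "sublinear q" "\<And>x. q x \<le> p x" "q (- v) \<le> - p v"
proof
  define A where "A x t = p (x + t *\<^sub>R v) - t * p v" for x t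
  define q where "q x = (INF t\<in>{0..}. A x t)" for x
  have lower: "- p (- x) \<le> A x t" if "t \<ge> 0" for x t
    using sublinear_add[OF p, of "x + t *\<^sub>R v" "- x"] sublinear_scale[OF p that, of v]
    by (simp add: A_def)
  have q_le: "q x \<le> A x t" if "t \<ge> 0" for x t
    unfolding q_def using that lower by (intro cINF_lower bdd_belowI2) auto
  have q_ge: "K \<le> q x" if "\<And>t. t \<ge> 0 \<Longrightarrow> K \<le> A x t" for K x
    unfolding q_def using that by (intro cINF_greatest) auto
  show "q x \<le> p x" for x using q_le[of 0 x] by (simp add: A_def)
  show "q (- v) \<le> - p v" using q_le[of 1 "- v"] sublinear_zero[OF p] by (simp add: A_def)
  have add: "q (x + y) \<le> q x + q y" for x y
  proof -
    have "q (x + y) \<le> A x t + A y s" if "t \<ge> 0" "s \<ge> 0" for t s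
    proof -
      have "q (x + y) \<le> A (x + y) (t + s)" using that by (intro q_le) simp
      also have "\<dots> \<le> A x t + A y s"
        using sublinear_add[OF p, of "x + t *\<^sub>R v" "y + s *\<^sub>R v"]
        by (simp add: A_def algebra_simps)
      finally show ?thesis .
    qed
    then have "q (x + y) - A y s \<le> q x" if "s \<ge> 0" for s using that by (intro q_ge) (simp add: algebra_simps)
    then have "q (x + y) - q x \<le> q y" by (intro q_ge) (simp add: algebra_simps)
    then show ?thesis by simp
  qed
  have scale_le: "q (r *\<^sub>R x) \<le> r * q x" if r: "r > 0" for r x
  proof -
    have "q (r *\<^sub>R x) / r \<le> A x t" if "t \<ge> 0" for t
    proof -
      have "q (r *\<^sub>R x) \<le> A (r *\<^sub>R x) (r * t)" using that r by (intro q_le) simp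
      also have "\<dots> = r * A x t"
        using sublinear_scale[OF p, of r "x + t *\<^sub>R v"] r by (simp add: A_def algebra_simps)
      finally show ?thesis using r by (simp add: field_simps)
    qed
    then have "q (r *\<^sub>R x) / r \<le> q x" by (rule q_ge)
    then show ?thesis using r by (simp add: field_simps)
  qed
  have "q (r *\<^sub>R x) = r * q x" if "r \<ge> 0" for r x
  proof (cases "r = 0")
    case True
    have "A 0 t = 0" if "t \<ge> 0" for t using sublinear_scale[OF p that] by (simp add: A_def)
    then have "q 0 = 0" using q_le[of 0 0] q_ge[of 0 0] by force
    then show ?thesis using True by simp
  next
    case False
    with that have "r > 0" by simp
    from scale_le[of "inverse r" "r *\<^sub>R x"] this have "q x \<le> q (r *\<^sub>R x) / r"
      by (simp add: field_simps)
    then show ?thesis using scale_le[OF \<open>r > 0\<close>, of x] \<open>r > 0\<close> by (simp add: field_simps)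
  qed
  with add show "sublinear q" by (simp add: sublinear_def)
qed

text \<open>
  Straightening along a new vector keeps the linearity along the earlier ones: if
  \<open>q (- s) = - q s\<close>, then any sublinear functional below \<open>q\<close> is squeezed at \<open>\<plusminus> s\<close>.
\<close>

lemma sublinear_straighten_finite:
  fixes p :: "'a::real_vector \<Rightarrow> real"
  assumes "finite S" "sublinear p"
  shows "\<exists>q. sublinear q \<and> (\<forall>x. q x \<le> p x) \<and> (\<forall>s\<in>S. q (- s) = - q s)"
  using assms
proof (induction S)
  case (insert v S)
  then obtain q where q: "sublinear q" "\<And>x. q x \<le> p x" "\<And>s. s \<in> S \<Longrightarrow> q (- s) = - q s"
    by blast
  obtain q' where q': "sublinear q'" "\<And>x. q' x \<le> q x" "q' (- v) \<le> - q v"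
    by (rule sublinear_straighten[OF q(1), where v = v]) auto
  have "q' (- s) = - q' s" if "s \<in> insert v S" for s
  proof -
    have "q' (- s) \<le> - q s" using that q'(2)[of "- s"] q'(3) q(3) by auto
    then show ?thesis using q'(2)[of s] sublinear_minus[OF q'(1), of s] by linarith
  qed
  then show ?case using q q' order_trans by blast
qed auto

text \<open>
  It therefore suffices to make a functional odd on a spanning set, which makes it linear.
\<close>

lemma sublinear_lineality_subspace:
  assumes "sublinear q"
  shows "subspace {x. q (- x) = - q x}"
proof (rule subspaceI; simp)
  show "q 0 = 0" using assms by (rule sublinear_zero)
  show "q (- x - y) = - q (x + y)" if "q (- x) = - q x" "q (- y) = - q y" for x y
    using that sublinear_add[OF assms, of "- x" "- y"] sublinear_add[OF assms, of x y]
      sublinear_minus[OF assms, of "x + y"] by simp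
  show "q (- (c *\<^sub>R x)) = - q (c *\<^sub>R x)" if "q (- x) = - q x" for c x
  proof (cases "c \<ge> 0")
    case True
    then show ?thesis
      using that sublinear_scale[OF assms True, of x] sublinear_scale[OF assms True, of "- x"] by simp
  next
    case False
    then show ?thesis
      using that sublinear_scale[OF assms, of "- c" x] sublinear_scale[OF assms, of "- c" "- x"]
      by simp
  qed
qed

text \<open>
  Straightening the norm first along \<open>v\<close> forces the value \<open>\<parallel>v\<parallel>\<close> at \<open>v\<close>; straightening it along a
  real spanning set then produces a real linear functional \<open>q\<close>.  As usual,
  \<open>q x - \<i> q (\<i> x)\<close> is the complex linear functional with real part \<open>q\<close>, and has the same norm.
\<close>

lemma finite_span_norming_functional:
  fixes S :: "'a::complex_normed_vector set"
  assumes S: "finite S" "complex_vector.span S = UNIV" and v: "norm v = 1"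
  obtains u :: "'a \<Rightarrow> complex"
    where "bounded_clinear u" "\<And>x. cmod (u x) \<le> norm x" "u v = 1"
proof -
  have "sublinear (norm :: 'a \<Rightarrow> real)" by (simp add: sublinear_def norm_triangle_ineq)
  then obtain p where p: "sublinear p" "\<And>x. p x \<le> norm x" "p (- v) \<le> - norm v"
    by (rule sublinear_straighten[where v = v]) blast
  have "finite (S \<union> (\<lambda>b. \<i> *\<^sub>C b) ` S)" using S by simp
  from sublinear_straighten_finite[OF this p(1)] obtain q
    where q: "sublinear q" "\<And>x. q x \<le> p x"
      "\<And>b. b \<in> S \<Longrightarrow> q (- b) = - q b" "\<And>b. b \<in> S \<Longrightarrow> q (- (\<i> *\<^sub>C b)) = - q (\<i> *\<^sub>C b)"
    by blast
  let ?L = "{x. q (- x) = - q x}"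
  have split: "c *\<^sub>C x = Re c *\<^sub>R x + Im c *\<^sub>R (\<i> *\<^sub>C x)" for c and x :: 'a
    unfolding scaleC_of_real[symmetric]
    by (simp only: scaleC_scaleC scaleC_add_left[symmetric]) (simp add: complex_eq mult.commute)
  note L = sublinear_lineality_subspace[OF q(1)]
  have "x \<in> ?L" for x
  proof (rule complex_vector.span_induct_alt[of x S])
    show "c *\<^sub>C b + y \<in> ?L" if "b \<in> S" "y \<in> ?L" for c b y
      unfolding split[of c b]
      by (intro subspace_add[OF L] subspace_mul[OF L] that(2)) (use that q in auto)
  qed (use S subspace_0[OF L] in auto)
  then have minus: "q (- x) = - q x" for x by blast
  have add: "q (x + y) = q x + q y" for x y
    using sublinear_add[OF q(1), of x y] sublinear_add[OF q(1), of "- x" "- y"]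
      minus[of x] minus[of y] minus[of "x + y"] by simp
  have scale: "q (r *\<^sub>R x) = r * q x" for r x
    using sublinear_scale[OF q(1), of r x] sublinear_scale[OF q(1), of "- r" x] minus[of "r *\<^sub>R x"]
    by (cases "r \<ge> 0") auto
  define u where "u x = Complex (q x) (- q (\<i> *\<^sub>C x))" for x
  have uadd: "u (x + y) = u x + u y" for x y
    by (simp add: u_def complex_eq_iff scaleC_add_right add)
  have uscaleR: "u (r *\<^sub>R x) = r *\<^sub>R u x" for r x
  proof -
    have "\<i> *\<^sub>C (r *\<^sub>R x) = r *\<^sub>R (\<i> *\<^sub>C x)"
      by (metis scaleC_of_real scaleC_scaleC mult.commute)
    then show ?thesis by (simp add: u_def complex_eq_iff scale)
  qed
  have ui: "u (\<i> *\<^sub>C x) = \<i> * u x" for x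
    using minus[of x] by (simp add: u_def complex_eq_iff scaleC_scaleC scaleC_one)
  have uscale: "u (c *\<^sub>C x) = c * u x" for c x
    unfolding split[of c x] by (simp add: uadd uscaleR ui complex_eq_iff)
  have bound: "cmod (u x) \<le> norm x" for x
  proof (cases "u x = 0")
    case False
    \<comment> \<open>The rotation that makes \<open>u x\<close> real, so that \<open>q\<close> alone determines its modulus.\<close>
    define c where "c = cnj (u x) / cmod (u x)"
    have c1: "cmod c = 1" using False by (simp add: c_def norm_divide)
    have "c * u x = (complex_of_real (cmod (u x)))\<^sup>2 / cmod (u x)"
      using complex_norm_square[of "u x"] by (simp add: c_def mult.commute)
    then have c: "c * u x = cmod (u x)" by (simp add: power2_eq_square)
    have "cmod (u x) = Re (u (c *\<^sub>C x))" by (simp add: uscale c)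
    also have "\<dots> = q (c *\<^sub>C x)" by (simp add: u_def)
    also have "\<dots> \<le> norm (c *\<^sub>C x)" using p q order_trans by blast
    finally show ?thesis by (simp add: norm_scaleC c1)
  qed simp
  have "bounded_linear u"
    by (rule bounded_linear_intro[where K = 1]) (simp_all add: uadd uscaleR bound)
  then have "bounded_clinear u" by (simp add: bounded_clinear_def uscale scaleC_complex_def)
  moreover have "u v = 1"
  proof -
    have "1 \<le> Re (u v)" using q(2)[of "- v"] p(3) minus[of v] v by (simp add: u_def)
    moreover have "Re (u v) \<le> 1"
      using bound[of v] v complex_Re_le_cmod[of "u v"] by simp
    ultimately have "Re (u v) = 1" by simp
    moreover have "(cmod (u v))\<^sup>2 \<le> 1" using bound[of v] v by (simp add: power_le_one)
    ultimately show ?thesis by (simp add: cmod_power2 complex_eq_iff)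
  qed
  ultimately show thesis using that bound by blast
qed

section \<open>Montel's theorem and compactness of the composition operators\<close>

text \<open>
  One point stays at distance \<open>R - r\<close> from the sphere; the other one may be anywhere in the ball.
\<close>

lemma unit_ball_increment_bound:
  fixes f :: "'a::complex_normed_vector \<Rightarrow> complex"
  assumes f: "f cfrechet_holomorphic_on ball 0 R" and M: "\<And>z. z \<in> ball 0 R \<Longrightarrow> cmod (f z) \<le> M"
    and x: "norm x \<le> r" "r < R" and y: "y \<in> ball 0 R"
  shows "cmod (f y - f x) \<le> 4 * M / (R - r) * norm (y - x)"
proof (rule holomorphic_increment_bound[OF f _ _ y M])
  show "ball x (R - r) \<subseteq> ball 0 R"
  proof
    fix z assume "z \<in> ball x (R - r)"
    then show "z \<in> ball 0 R"
      using x norm_triangle_ineq[of "z - x" x] by (simp add: dist_norm norm_minus_commute)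
  qed
qed (use x in auto)

text \<open>
  The Cauchy estimates make the sequence equicontinuous on smaller balls.  So it is enough that a
  subsequence converges on a countable dense set, which the diagonal argument provides; finite nets
  then give uniform convergence.
\<close>

lemma Montel_unit_ball:
  fixes f :: "nat \<Rightarrow> 'a::complex_normed_vector \<Rightarrow> complex"
  assumes K: "compact (cball (0::'a) 1)"
    and f: "\<And>n. f n cfrechet_holomorphic_on ball 0 1"
    and M: "\<And>n x. x \<in> ball 0 1 \<Longrightarrow> cmod (f n x) \<le> M"
  obtains k l where "strict_mono (k :: nat \<Rightarrow> nat)" "l cfrechet_holomorphic_on ball 0 1"
    "\<And>x. x \<in> ball 0 1 \<Longrightarrow> (\<lambda>n. f (k n) x) \<longlonglongrightarrow> l x"
    "\<And>r. r < 1 \<Longrightarrow> uniform_limit (cball 0 r) (\<lambda>n. f (k n)) l sequentially"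
proof -
  have M0: "0 \<le> M" using M[of 0 0] norm_ge_zero[of "f 0 0"] by (simp del: norm_ge_zero)
  have "\<exists>F. finite F \<and> cball (0::'a) 1 \<subseteq> (\<Union>x\<in>F. ball x (inverse (Suc n)))" for n
    using seq_compact_imp_totally_bounded[of "cball (0::'a) 1"] K
    unfolding compact_eq_seq_compact_metric
    by (meson inverse_positive_iff_positive of_nat_0_less_iff zero_less_Suc)
  then obtain F :: "nat \<Rightarrow> 'a set" where F: "\<And>n. finite (F n)"
    "\<And>n. cball 0 1 \<subseteq> (\<Union>x\<in>F n. ball x (inverse (Suc n)))"
    by metis
  define S where "S n = F n \<inter> ball 0 1" for n
  \<comment> \<open>The functions are bounded only on the open ball.  A centre that is close to a point of a smaller
    ball lies in the open ball, so dropping the centres on the sphere does no harm.\<close>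
  have net: "\<exists>n. \<forall>x\<in>cball (0::'a) r. \<exists>d\<in>S n. dist d x < e" if "r < 1" "e > 0" for r e
  proof -
    obtain n where n: "inverse (Suc n) < min e (1 - r)"
      using reals_Archimedean[of "min e (1 - r)"] \<open>r < 1\<close> \<open>e > 0\<close> by (auto simp del: of_nat_Suc)
    have "\<exists>d\<in>S n. dist d x < e" if x: "x \<in> cball 0 r" for x
    proof -
      have "x \<in> cball 0 1" using x \<open>r < 1\<close> by simp
      then obtain d where d: "d \<in> F n" "dist d x < inverse (Suc n)" using F(2)[of n] by auto
      moreover have "norm d < 1"
        using d(2) n x norm_triangle_ineq[of "d - x" x] by (simp add: dist_norm)
      moreover have "dist d x < e" using d(2) n by linarith
      ultimately show ?thesis by (auto simp: S_def)
    qed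
    then show ?thesis by blast
  qed
  have "countable (\<Union>n. S n)" using F(1) by (auto simp: S_def countable_finite)
  moreover have "cmod (f n x) \<le> M" if "x \<in> (\<Union>n. S n)" for n x
    using that by (intro M) (auto simp: S_def)
  ultimately obtain k where k: "strict_mono (k :: nat \<Rightarrow> nat)"
    "\<And>x. x \<in> (\<Union>n. S n) \<Longrightarrow> \<exists>l. (\<lambda>n. f (k n) x) \<longlonglongrightarrow> l"
    by (rule function_convergent_subsequence[of "\<Union>n. S n" f M]) auto
  define C where "C r = 4 * M / (1 - r)" for r
  have C0: "C r \<ge> 0" if "r < 1" for r using that M0 by (simp add: C_def)
  have lip: "cmod (f n y - f n x) \<le> C r * norm (y - x)"
    if "norm x \<le> r" "r < 1" "y \<in> ball 0 1" for n r x y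
    unfolding C_def by (rule unit_ball_increment_bound[OF f M that])
  have "convergent (\<lambda>n. f (k n) x)" if x: "x \<in> ball 0 1" for x
  proof (rule Cauchy_convergent, rule metric_CauchyI)
    fix e :: real assume e: "e > 0"
    define r where "r = norm x"
    have r: "r < 1" "norm x \<le> r" using x by (auto simp: r_def)
    have Cp: "C r + 1 > 0" using C0[OF r(1)] by simp
    have "e / (3 * (C r + 1)) > 0" using e Cp by simp
    from net[OF r(1) this] r(2) obtain N d where d: "d \<in> S N" "dist d x < e / (3 * (C r + 1))"
      by (metis mem_cball dist_0_norm)
    have "C r * norm (d - x) \<le> (C r + 1) * (e / (3 * (C r + 1)))"
      using d(2) C0[OF r(1)] by (intro mult_mono) (auto simp: dist_norm)
    also have "K * (e / (3 * K)) = e / 3" if "K > 0" for K using that by simp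
    note this[OF Cp]
    finally have near: "cmod (f n d - f n x) \<le> e / 3" for n
      using lip[OF r(2,1), of d n] d(1) by (auto simp: S_def)
    have "Cauchy (\<lambda>n. f (k n) d)"
      using k(2)[of d] d(1) by (auto intro: convergent_Cauchy convergentI)
    then obtain N where N: "\<And>m n. m \<ge> N \<Longrightarrow> n \<ge> N \<Longrightarrow> dist (f (k m) d) (f (k n) d) < e / 3"
      using metric_CauchyD[of "\<lambda>n. f (k n) d" "e / 3"] e by auto
    have "dist (f (k m) x) (f (k n) x) < e" if "m \<ge> N" "n \<ge> N" for m n
    proof -
      have "f (k m) x - f (k n) x = (f (k m) d - f (k n) d) - (f (k m) d - f (k m) x)
          + (f (k n) d - f (k n) x)" by simp
      also have "cmod \<dots> \<le> cmod (f (k m) d - f (k n) d) + e / 3 + e / 3"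
        by (intro norm_triangle_le norm_triangle_le_diff add_mono order_refl near)
      finally show ?thesis using N[OF that] by (simp add: dist_norm)
    qed
    then show "\<exists>N. \<forall>m\<ge>N. \<forall>n\<ge>N. dist (f (k m) x) (f (k n) x) < e" by blast
  qed
  then obtain l where l: "\<And>x. x \<in> ball 0 1 \<Longrightarrow> (\<lambda>n. f (k n) x) \<longlonglongrightarrow> l x"
    unfolding convergent_def by metis
  have llip: "cmod (l y - l x) \<le> C r * norm (y - x)"
    if "norm x \<le> r" "r < 1" "y \<in> ball 0 1" for r x y
  proof -
    have "x \<in> ball 0 1" using that by simp
    then have "(\<lambda>n. cmod (f (k n) y - f (k n) x)) \<longlonglongrightarrow> cmod (l y - l x)"
      by (intro tendsto_intros l that)
    then show ?thesis by (rule LIMSEQ_le_const2) (use lip[OF that] in blast)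
  qed
  have "uniform_limit (cball 0 r) (\<lambda>n. f (k n)) l sequentially" if r: "r < 1" for r
  proof (rule uniform_limitI)
    fix e :: real assume e: "e > 0"
    have Cp: "C r + 1 > 0" using C0[OF r] by simp
    have "e / (4 * (C r + 1)) > 0" using e Cp by simp
    from net[OF r this]
    obtain N where N: "\<And>x :: 'a. x \<in> cball 0 r \<Longrightarrow> \<exists>d\<in>S N. dist d x < e / (4 * (C r + 1))"
      by blast
    have "eventually (\<lambda>n. \<forall>d\<in>S N. dist (f (k n) d) (l d) < e / 4) sequentially"
    proof (rule eventually_ball_finite)
      show "\<forall>d\<in>S N. \<forall>\<^sub>F n in sequentially. dist (f (k n) d) (l d) < e / 4"
        by (intro ballI tendstoD l) (use e in \<open>auto simp: S_def\<close>)
    qed (use F(1) in \<open>simp add: S_def\<close>)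
    then show "\<forall>\<^sub>F n in sequentially. \<forall>x\<in>cball 0 r. dist (f (k n) x) (l x) < e"
    proof (rule eventually_mono, intro ballI)
      fix n and x :: 'a
      assume n: "\<forall>d\<in>S N. dist (f (k n) d) (l d) < e / 4" and x: "x \<in> cball 0 r"
      obtain d where d: "d \<in> S N" "dist d x < e / (4 * (C r + 1))" using N[OF x] by blast
      have xr: "norm x \<le> r" and d1: "d \<in> ball 0 1" using x d by (auto simp: S_def)
      have "C r * norm (d - x) \<le> (C r + 1) * (e / (4 * (C r + 1)))"
        using d(2) C0[OF r] by (intro mult_mono) (auto simp: dist_norm)
      also have "K * (e / (4 * K)) = e / 4" if "K > 0" for K using that by simp
      note this[OF Cp]
      finally have near: "C r * norm (d - x) \<le> e / 4" .
      have "cmod (f (k n) x - l x) \<le> cmod (f (k n) d - f (k n) x) + cmod (f (k n) d - l d)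
          + cmod (l d - l x)"
        using norm_triangle_ineq4[of "f (k n) d - l d" "f (k n) d - f (k n) x"]
          norm_triangle_ineq[of "(f (k n) d - l d) - (f (k n) d - f (k n) x)" "l d - l x"]
        by (simp add: algebra_simps)
      then have "cmod (f (k n) x - l x) \<le> cmod (f (k n) d - l d) + e / 4 + e / 4"
        using lip[OF xr r d1, of "k n"] llip[OF xr r d1] near by linarith
      then show "dist (f (k n) x) (l x) < e"  using n d(1) e by (force simp: dist_norm)
    qed
  qed
  moreover have "l cfrechet_holomorphic_on ball 0 1"
    by (rule holomorphic_on_bounded_limit[of "\<lambda>n. f (k n)", OF f open_ball M l])
  ultimately show thesis using that k(1) l by blast
qed

lemma norm_apply_le_sup_norm:
  assumes "apply_hl0 \<phi> ` ball 0 1 \<subseteq> ball 0 1" "y \<in> ball 0 1"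
  shows "norm (apply_hl0 \<phi> y) \<le> sup_norm \<phi>"
  unfolding sup_norm_def
  by (rule cSUP_upper[OF assms(2)], rule bdd_aboveI2[where M = 1])
    (use assms(1) in force)

text \<open>
  The extension by \<open>0\<close> that the representation of the space requires is hidden here, once and for
  all.
\<close>

lemma ex_hinf:
  assumes "f cfrechet_holomorphic_on ball 0 1" "\<And>x. x \<in> ball 0 1 \<Longrightarrow> cmod (f x) \<le> M"
  obtains F where "\<And>x. x \<in> ball 0 1 \<Longrightarrow> apply_hinf F x = f x" "norm F \<le> M"
proof
  let ?f = "\<lambda>x. if x \<in> ball 0 1 then f x else 0"
  have "?f cfrechet_holomorphic_on ball 0 1"
    using assms(1) by (rule cfrechet_holomorphic_on_cong) simp
  moreover have "bounded (?f ` ball 0 1)" using assms(2) by (auto simp: bounded_iff intro!: exI[of _ M])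
  ultimately have "apply_hinf (Abs_hinf ?f) = ?f" by (intro Abs_hinf_inverse) auto
  then show *: "\<And>x. x \<in> ball 0 1 \<Longrightarrow> apply_hinf (Abs_hinf ?f) x = f x" by simp
  show "norm (Abs_hinf ?f) \<le> M" by (rule norm_hinf_le) (simp only: * assms(2))
qed

lemma ex_hl0:
  assumes "f cfrechet_holomorphic_on ball 0 1" "f 0 = 0" "M \<ge> 0"
    "\<And>x y. x \<in> ball 0 1 \<Longrightarrow> y \<in> ball 0 1 \<Longrightarrow> norm (f x - f y) \<le> M * norm (x - y)"
  obtains F where "\<And>x. x \<in> ball 0 1 \<Longrightarrow> apply_hl0 F x = f x" "norm F \<le> M"
proof
  let ?f = "\<lambda>x. if x \<in> ball 0 1 then f x else 0"
  have "?f cfrechet_holomorphic_on ball 0 1"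
    using assms(1) by (rule cfrechet_holomorphic_on_cong) simp
  moreover have "M-lipschitz_on (ball 0 1) ?f"
    using assms(3,4) by (intro lipschitz_onI) (simp_all add: dist_norm)
  ultimately have "apply_hl0 (Abs_hl0 ?f) = ?f" using assms(2) by (intro Abs_hl0_inverse) auto
  then show *: "\<And>x. x \<in> ball 0 1 \<Longrightarrow> apply_hl0 (Abs_hl0 ?f) x = f x" by simp
  show "norm (Abs_hl0 ?f) \<le> M"
    by (rule norm_hl0_le[OF assms(3)]) (simp only: * assms(4))
qed

lemma compact_comp_inf_image:
  fixes \<phi> :: "('y::complex_normed_vector, 'x::complex_normed_vector) hl0"
  assumes K: "compact (cball (0::'x) 1)" and \<phi>: "apply_hl0 \<phi> ` ball 0 1 \<subseteq> ball 0 1"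
    and r: "sup_norm \<phi> < 1"
  shows "compact (comp_inf \<phi> ` cball 0 1)"
  unfolding compact_eq_seq_compact_metric seq_compact_def
proof (intro allI impI)
  fix g assume "\<forall>n :: nat. g n \<in> comp_inf \<phi> ` cball 0 1"
  then have "\<forall>n. \<exists>f. norm f \<le> 1 \<and> g n = comp_inf \<phi> f" by (force simp: image_iff)
  then obtain f where f: "\<And>n. norm (f n) \<le> 1" "\<And>n. g n = comp_inf \<phi> (f n)" by metis
  have f1: "cmod (apply_hinf (f n) x) \<le> 1" if "x \<in> ball 0 1" for n x
    using norm_hinf_bound[OF that, of "f n"] f(1)[of n] by simp
  obtain k l where k: "strict_mono (k :: nat \<Rightarrow> nat)" and l: "l cfrechet_holomorphic_on ball 0 1"
    "\<And>x. x \<in> ball 0 1 \<Longrightarrow> (\<lambda>n. apply_hinf (f (k n)) x) \<longlonglongrightarrow> l x"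
    "\<And>r. r < 1 \<Longrightarrow> uniform_limit (cball 0 r) (\<lambda>n. apply_hinf (f (k n))) l sequentially"
    using Montel_unit_ball[OF K, of "\<lambda>n. apply_hinf (f n)" 1] apply_hinf_holomorphic f1 by metis
  have "cmod (l x) \<le> 1" if "x \<in> ball 0 1" for x
    by (rule LIMSEQ_le_const2[OF tendsto_norm[OF l(2)[OF that]]]) (use f1[OF that] in blast)
  then obtain F where F: "\<And>x. x \<in> ball 0 1 \<Longrightarrow> apply_hinf F x = l x" "norm F \<le> 1"
    using ex_hinf[OF l(1)] by blast
  have "(g \<circ> k) \<longlonglongrightarrow> comp_inf \<phi> F"
  proof (rule metric_LIMSEQ_I)
    fix e :: real assume "e > 0"
    then have "\<forall>\<^sub>F n in sequentially. \<forall>x\<in>cball 0 (sup_norm \<phi>). dist (apply_hinf (f (k n)) x) (l x) < e / 2"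
      by (intro uniform_limitD l(3) r) simp
    then obtain N where N: "\<And>n x. n \<ge> N \<Longrightarrow> x \<in> cball 0 (sup_norm \<phi>) \<Longrightarrow>
        dist (apply_hinf (f (k n)) x) (l x) < e / 2"
      unfolding eventually_sequentially by blast
    have "norm (g (k n) - comp_inf \<phi> F) \<le> e / 2" if "n \<ge> N" for n
    proof (rule norm_hinf_le)
      fix y :: 'y assume y: "y \<in> ball 0 1"
      then have "apply_hl0 \<phi> y \<in> ball 0 1" using \<phi> by blast
      then show "cmod (apply_hinf (g (k n) - comp_inf \<phi> F) y) \<le> e / 2"
        using N[OF that, of "apply_hl0 \<phi> y"] norm_apply_le_sup_norm[OF \<phi> y]
        by (simp add: f(2) apply_hinf_minus apply_comp_inf[OF \<phi> y] F(1) dist_norm del: mem_ball)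
    qed
    then show "\<exists>N. \<forall>n\<ge>N. dist ((g \<circ> k) n) (comp_inf \<phi> F) < e"
      using \<open>e > 0\<close> by (force simp: dist_norm)
  qed
  then show "\<exists>l\<in>comp_inf \<phi> ` cball 0 1. \<exists>r. strict_mono r \<and> (g \<circ> r) \<longlonglongrightarrow> l"
    using k F(2) by auto
qed

text \<open>
  With \<open>\<parallel>\<phi>\<parallel>\<^sub>\<infinity> < \<rho> < 1\<close>, uniform smallness of a function on the ball of radius \<open>\<rho>\<close> bounds its
  Lipschitz constant on the ball of radius \<open>\<parallel>\<phi>\<parallel>\<^sub>\<infinity>\<close>, and \<open>\<phi>\<close> multiplies this constant by at most
  its own Lipschitz constant \<open>\<parallel>\<phi>\<parallel>\<close>.
\<close>

lemma compact_comp_L_image: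
  fixes \<phi> :: "('y::complex_normed_vector, 'x::complex_normed_vector) hl0"
  assumes K: "compact (cball (0::'x) 1)" and \<phi>: "apply_hl0 \<phi> ` ball 0 1 \<subseteq> ball 0 1"
    and r: "sup_norm \<phi> < 1"
  shows "compact (comp_L \<phi> ` cball 0 1)"
  unfolding compact_eq_seq_compact_metric seq_compact_def
proof (intro allI impI)
  fix g assume "\<forall>n :: nat. g n \<in> comp_L \<phi> ` cball 0 1"
  then have "\<forall>n. \<exists>f. norm f \<le> 1 \<and> g n = comp_L \<phi> f" by (force simp: image_iff)
  then obtain f where f: "\<And>n. norm (f n) \<le> 1" "\<And>n. g n = comp_L \<phi> (f n)" by metis
  have flip: "cmod (apply_hl0 (f n) x - apply_hl0 (f n) y) \<le> norm (x - y)"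
    if "x \<in> ball 0 1" "y \<in> ball 0 1" for n x y
    using norm_hl0_bound[OF that, of "f n"] mult_right_mono[OF f(1)[of n] norm_ge_zero[of "x - y"]]
    by simp
  have f1: "cmod (apply_hl0 (f n) x) \<le> 1" if "x \<in> ball 0 1" for n x
    using flip[OF that, of 0 n] that by (simp add: apply_hl0_0)
  obtain k l where k: "strict_mono (k :: nat \<Rightarrow> nat)" and l: "l cfrechet_holomorphic_on ball 0 1"
    "\<And>x. x \<in> ball 0 1 \<Longrightarrow> (\<lambda>n. apply_hl0 (f (k n)) x) \<longlonglongrightarrow> l x"
    "\<And>r. r < 1 \<Longrightarrow> uniform_limit (cball 0 r) (\<lambda>n. apply_hl0 (f (k n))) l sequentially"
    using Montel_unit_ball[OF K, of "\<lambda>n. apply_hl0 (f n)" 1] apply_hl0_holomorphic f1 by metis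
  have "norm (l x - l y) \<le> 1 * norm (x - y)" if "x \<in> ball 0 1" "y \<in> ball 0 1" for x y
  proof -
    have "(\<lambda>n. cmod (apply_hl0 (f (k n)) x - apply_hl0 (f (k n)) y)) \<longlonglongrightarrow> cmod (l x - l y)"
      by (intro tendsto_intros l(2) that)
    then show ?thesis by (rule LIMSEQ_le_const2) (use flip[OF that] in simp)
  qed
  moreover have "l 0 = 0"
    using l(2)[of 0] LIMSEQ_unique[OF tendsto_const, of 0 "l 0"] by (simp add: apply_hl0_0)
  ultimately obtain F where F: "\<And>x. x \<in> ball 0 1 \<Longrightarrow> apply_hl0 F x = l x" "norm F \<le> 1"
    using ex_hl0[OF l(1), of 1] by auto
  define \<rho> where "\<rho> = (1 + sup_norm \<phi>) / 2"
  have \<rho>: "sup_norm \<phi> < \<rho>" "\<rho> < 1" using r by (auto simp: \<rho>_def)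
  define C where "C = norm \<phi> / (\<rho> - sup_norm \<phi>)"
  have C0: "C \<ge> 0" using \<rho> by (simp add: C_def)
  have "(g \<circ> k) \<longlonglongrightarrow> comp_L \<phi> F"
  proof (rule metric_LIMSEQ_I)
    fix e :: real assume "e > 0"
    \<comment> \<open>The Cauchy estimate turns \<open>\<epsilon>\<close> into \<open>4 * C * \<epsilon>\<close>; the summand \<open>1\<close> avoids a division by zero.\<close>
    define \<epsilon> where "\<epsilon> = e / (8 * (C + 1))"
    have \<epsilon>: "\<epsilon> > 0" using \<open>e > 0\<close> C0 by (simp add: \<epsilon>_def)
    then have "\<forall>\<^sub>F n in sequentially. \<forall>x\<in>cball 0 \<rho>. dist (apply_hl0 (f (k n)) x) (l x) < \<epsilon>"
      by (intro uniform_limitD l(3) \<rho>)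
    then obtain N where N: "\<And>n x. n \<ge> N \<Longrightarrow> x \<in> cball 0 \<rho> \<Longrightarrow>
        dist (apply_hl0 (f (k n)) x) (l x) < \<epsilon>"
      unfolding eventually_sequentially by blast
    have "norm (g (k n) - comp_L \<phi> F) \<le> 4 * C * \<epsilon>" if "n \<ge> N" for n
    proof (rule norm_hl0_le)
      fix y z :: 'y assume yz: "y \<in> ball 0 1" "z \<in> ball 0 1"
      define H where "H = f (k n) - F"
      have eq: "apply_hl0 (g (k n) - comp_L \<phi> F) y = apply_hl0 H (apply_hl0 \<phi> y)"
        if "y \<in> ball 0 1" for y
        by (simp add: H_def f(2) apply_hl0_minus apply_comp_L[OF \<phi> that] del: mem_ball)
      have sub: "ball 0 \<rho> \<subseteq> ball (0::'x) 1" using \<rho> by auto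
      have "cmod (apply_hl0 H (apply_hl0 \<phi> y) - apply_hl0 H (apply_hl0 \<phi> z))
          \<le> 4 * \<epsilon> / (\<rho> - sup_norm \<phi>) * norm (apply_hl0 \<phi> y - apply_hl0 \<phi> z)"
      proof (rule unit_ball_increment_bound)
        show "apply_hl0 H cfrechet_holomorphic_on ball 0 \<rho>"
          by (rule cfrechet_holomorphic_on_subset[OF apply_hl0_holomorphic sub])
        show "cmod (apply_hl0 H x) \<le> \<epsilon>" if "x \<in> ball 0 \<rho>" for x
        proof -
          have "x \<in> ball 0 1" using that sub by blast
          then show ?thesis
            using N[OF \<open>n \<ge> N\<close>, of x] that F(1)[of x] by (simp add: H_def apply_hl0_minus dist_norm)
        qed
        show "norm (apply_hl0 \<phi> z) \<le> sup_norm \<phi>" by (rule norm_apply_le_sup_norm[OF \<phi> yz(2)])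
        show "apply_hl0 \<phi> y \<in> ball 0 \<rho>" using norm_apply_le_sup_norm[OF \<phi> yz(1)] \<rho> by simp
      qed (rule \<rho>)
      also have "\<dots> \<le> 4 * \<epsilon> / (\<rho> - sup_norm \<phi>) * (norm \<phi> * norm (y - z))"
        using \<rho> \<epsilon> by (intro mult_left_mono norm_hl0_bound yz) auto
      finally show "norm (apply_hl0 (g (k n) - comp_L \<phi> F) y - apply_hl0 (g (k n) - comp_L \<phi> F) z)
          \<le> 4 * C * \<epsilon> * norm (y - z)"
        by (simp add: eq[OF yz(1)] eq[OF yz(2)] C_def mult_ac)
    qed (use C0 \<epsilon> in simp)
    moreover have "4 * C * \<epsilon> < e"
    proof -
      have "4 * C * \<epsilon> \<le> 4 * (C + 1) * \<epsilon>" using \<epsilon> by (intro mult_right_mono) auto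
      also have *: "4 * K * (e / (8 * K)) = e / 2" if "K > 0" for K using that by simp
      have "4 * (C + 1) * \<epsilon> = e / 2" unfolding \<epsilon>_def by (rule *) (use C0 in simp)
      finally show ?thesis using \<open>e > 0\<close> by simp
    qed
    ultimately show "\<exists>N. \<forall>n\<ge>N. dist ((g \<circ> k) n) (comp_L \<phi> F) < e"
      by (force simp: dist_norm)
  qed
  then show "\<exists>l\<in>comp_L \<phi> ` cball 0 1. \<exists>r. strict_mono r \<and> (g \<circ> r) \<longlonglongrightarrow> l"
    using k F(2) by auto
qed

section \<open>Weak compactness\<close>

lemma openin_weak_topology_vimage:
  fixes u :: "'a::complex_normed_vector \<Rightarrow> complex"
  shows "bounded_clinear u \<Longrightarrow> open U \<Longrightarrow> openin weak_topology (u -` U)"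
  unfolding weak_topology_def
  by (rule topology_generated_by_Basis, rule CollectI, intro exI conjI, rule refl)

lemma topspace_weak_topology: "topspace weak_topology = UNIV"
proof -
  have "bounded_clinear (\<lambda>_ :: 'a. 0 :: complex)" by (simp add: bounded_clinear_def)
  from openin_subset[OF openin_weak_topology_vimage[OF this open_UNIV]] show ?thesis by auto
qed

lemma openin_weak_topology_imp_open:
  fixes S :: "'a::complex_normed_vector set"
  assumes "openin weak_topology S"
  shows "open S"
proof -
  have "generate_topology_on {u -` U | (u :: 'a \<Rightarrow> complex) U. bounded_clinear u \<and> open U} S"
    using assms by (simp add: weak_topology_def openin_topology_generated_by_iff)
  then show ?thesis
  proof induction
    case (Basis V)
    then obtain u :: "'a \<Rightarrow> complex" and U where "V = u -` U" "bounded_clinear u" "open U" by blast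
    then show ?case
      by (auto intro!: open_vimage linear_continuous_on simp: bounded_clinear_def)
  qed auto
qed

lemma compact_imp_compactin_weak_topology:
  assumes "compact S"
  shows "compactin weak_topology S"
  unfolding compactin_def topspace_weak_topology
proof (intro conjI allI impI subset_UNIV)
  fix \<U> assume \<U>: "(\<forall>U\<in>\<U>. openin weak_topology U) \<and> S \<subseteq> \<Union> \<U>"
  show "\<exists>\<F>. finite \<F> \<and> \<F> \<subseteq> \<U> \<and> S \<subseteq> \<Union> \<F>"
    by (rule compactE[OF assms, of \<U>]) (use \<U> openin_weak_topology_imp_open in auto)
qed

lemma bounded_clinear_evaluation:
  assumes "x \<in> ball 0 1"
  shows "bounded_clinear (\<lambda>f. apply_hinf f x)"
proof -
  have "bounded_linear (\<lambda>f. apply_hinf f x)"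
    by (rule bounded_linear_intro[where K = 1])
      (simp_all add: apply_hinf_simps norm_hinf_bound[OF assms])
  then show ?thesis by (simp add: bounded_clinear_def apply_hinf_simps)
qed

text \<open>
  The point evaluations are weakly continuous and separate the functions.
\<close>

lemma Hausdorff_weak_topology_hinf:
  "Hausdorff_space (weak_topology :: 'a::complex_normed_vector hinf topology)"
  unfolding Hausdorff_space_def
proof (intro allI impI)
  fix f g :: "'a hinf" assume "f \<in> topspace weak_topology \<and> g \<in> topspace weak_topology \<and> f \<noteq> g"
  then obtain x where x: "x \<in> ball 0 1" "apply_hinf f x \<noteq> apply_hinf g x"
    using hinf_eqI by blast
  then obtain U V where UV: "open U" "open V" "apply_hinf f x \<in> U" "apply_hinf g x \<in> V"
    "U \<inter> V = {}" using hausdorff by metis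
  show "\<exists>U V. openin weak_topology U \<and> openin weak_topology V \<and> f \<in> U \<and> g \<in> V \<and> disjnt U V"
    using UV
    by (intro exI[of _ "(\<lambda>f. apply_hinf f x) -` U"] exI[of _ "(\<lambda>f. apply_hinf f x) -` V"] conjI
        openin_weak_topology_vimage bounded_clinear_evaluation[OF x(1)]) (auto simp: disjnt_def)
qed

text \<open>
  A norm compact set is weakly compact, hence weakly closed because the weak topology is Hausdorff.
  So the weak closure of the image of the ball lies in the norm closure.
\<close>

lemma compact_imp_weakly_compact_operator:
  fixes T :: "'a::complex_normed_vector \<Rightarrow> 'b::complex_normed_vector hinf"
  assumes "compact_operator T"
  shows "weakly_compact_operator T"
proof -
  let ?C = "closure (T ` cball 0 1)"
  have C: "compactin weak_topology ?C"
    using assms by (intro compact_imp_compactin_weak_topology) (simp add: compact_operator_def)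
  then have "closedin weak_topology ?C"
    by (rule compactin_imp_closedin[OF Hausdorff_weak_topology_hinf])
  then have "weak_topology closure_of (T ` cball 0 1) \<subseteq> ?C"
    by (rule closure_of_minimal[OF closure_subset])
  then have "compactin weak_topology (weak_topology closure_of (T ` cball 0 1))"
    by (rule closed_compactin[OF C]) simp
  with assms show ?thesis by (simp add: weakly_compact_operator_def compact_operator_def)
qed

lemma compactin_sequence_cluster_point:
  fixes a :: "nat \<Rightarrow> 'a"
  assumes "compactin X K" "\<And>n. a n \<in> K"
  obtains h where "h \<in> K" "\<And>U. openin X U \<Longrightarrow> h \<in> U \<Longrightarrow> infinite {n. a n \<in> U}"
proof (rule ccontr)
  assume "\<not> thesis"
  then have "\<forall>h\<in>K. \<exists>U. openin X U \<and> h \<in> U \<and> finite {n. a n \<in> U}" using that by blast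
  then obtain U where U: "\<And>h. h \<in> K \<Longrightarrow> openin X (U h)" "\<And>h. h \<in> K \<Longrightarrow> h \<in> U h"
    "\<And>h. h \<in> K \<Longrightarrow> finite {n. a n \<in> U h}"
    by metis
  have "\<exists>\<F>. finite \<F> \<and> \<F> \<subseteq> U ` K \<and> K \<subseteq> \<Union> \<F>"
    using U(1,2) by (intro compactinD[OF assms(1)]) auto
  then obtain H where H: "finite H" "H \<subseteq> K" "K \<subseteq> (\<Union>h\<in>H. U h)"
    by (metis finite_subset_image)
  then have "(UNIV :: nat set) \<subseteq> (\<Union>h\<in>H. {n. a n \<in> U h})" using assms(2) by blast
  moreover have "finite (\<Union>h\<in>H. {n. a n \<in> U h})" using H U(3) by blast
  ultimately show False using infinite_UNIV_nat finite_subset by blast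
qed

text \<open>
  The functional is a cluster point of the evaluations in the product of the discs of radius
  \<open>\<parallel>h\<parallel>\<close>, which is compact by Tychonoff's theorem.  Linearity and the limit property involve at most
  three coordinates at a time, and infinitely many evaluations are close to the cluster point in
  these.
\<close>

lemma evaluation_limit_functional:
  fixes y :: "nat \<Rightarrow> 'y::complex_normed_vector"
  assumes y: "\<And>n. y n \<in> ball 0 1"
  obtains L :: "'y hinf \<Rightarrow> complex" where "bounded_clinear L"
    "\<forall>h c. (\<lambda>n. apply_hinf h (y n)) \<longlonglongrightarrow> c \<longrightarrow> L h = c"
proof -
  let ?P = "product_topology (\<lambda>_ :: 'y hinf. euclidean :: complex topology) UNIV"
  let ?K = "PiE UNIV (\<lambda>h :: 'y hinf. cball (0 :: complex) (norm h))"
  have "compactin ?P ?K" by (simp add: compactin_PiE)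
  moreover have "(\<lambda>h. apply_hinf h (y n)) \<in> ?K" for n
    by (simp add: PiE_UNIV_domain Pi_iff norm_hinf_bound[OF y])
  ultimately obtain L where L: "L \<in> ?K"
    "\<And>U. openin ?P U \<Longrightarrow> L \<in> U \<Longrightarrow> infinite {n. (\<lambda>h. apply_hinf h (y n)) \<in> U}"
    by (rule compactin_sequence_cluster_point[where a = "\<lambda>n h. apply_hinf h (y n)"]) auto
  have coord: "openin ?P {f. f h \<in> V}" if "open V" for h V
  proof -
    have "openin ?P {f \<in> topspace ?P. f h \<in> V}"
      using that by (intro openin_continuous_map_preimage[of _ euclidean]
          continuous_map_product_projection) auto
    then show ?thesis by simp
  qed
  have near: "\<exists>n\<ge>N. dist (apply_hinf f (y n)) (L f) < e \<and> dist (apply_hinf g (y n)) (L g) < e \<and>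
      dist (apply_hinf h (y n)) (L h) < e" if "e > 0" for f g h e N
  proof -
    let ?B = "\<lambda>f. {F. F f \<in> ball (L f) e}"
    have "openin ?P (?B f \<inter> ?B g \<inter> ?B h)" by (intro openin_Int coord open_ball)
    moreover have "L \<in> ?B f \<inter> ?B g \<inter> ?B h" using that by simp
    ultimately have "infinite {n. (\<lambda>h. apply_hinf h (y n)) \<in> ?B f \<inter> ?B g \<inter> ?B h}" by (rule L(2))
    then obtain n where "n \<ge> N" "(\<lambda>h. apply_hinf h (y n)) \<in> ?B f \<inter> ?B g \<inter> ?B h"
      unfolding infinite_nat_iff_unbounded_le by blast
    then show ?thesis by (auto simp: dist_commute)
  qed
  have zeroI: "z = 0" if "\<And>e. e > 0 \<Longrightarrow> cmod z \<le> C * e" "C > 0" for z C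
  proof (rule ccontr)
    assume "z \<noteq> 0"
    then have "cmod z \<le> C * (cmod z / (2 * C))" using that(2) by (intro that(1)) simp
    then show False using that(2) \<open>z \<noteq> 0\<close> by simp
  qed
  have add: "L (f + g) = L f + L g" for f g
  proof -
    have "L (f + g) - L f - L g = 0"
    proof (rule zeroI[of _ 3])
      fix e :: real assume "e > 0"
      from near[OF this, of 0 "f + g" f g] obtain n where
        n: "cmod (apply_hinf (f + g) (y n) - L (f + g)) < e" "cmod (apply_hinf f (y n) - L f) < e"
          "cmod (apply_hinf g (y n) - L g) < e"
        by (auto simp: dist_norm)
      have "L (f + g) - L f - L g = (apply_hinf f (y n) - L f) + (apply_hinf g (y n) - L g)
          - (apply_hinf (f + g) (y n) - L (f + g))"
        by (simp add: apply_hinf_simps)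
      also have "cmod \<dots> \<le> e + e + e"
        by (rule norm_triangle_le_diff, rule add_mono, rule norm_triangle_le, rule add_mono)
          (use n in auto)
      finally show "cmod (L (f + g) - L f - L g) \<le> 3 * e" by simp
    qed simp
    then show ?thesis by (simp add: algebra_simps)
  qed
  have scale: "L (c *\<^sub>C f) = c * L f" for c f
  proof -
    have "L (c *\<^sub>C f) - c * L f = 0"
    proof (rule zeroI[of _ "cmod c + 1"])
      fix e :: real assume "e > 0"
      from near[OF this, of 0 "c *\<^sub>C f" f f] obtain n where
        n: "cmod (apply_hinf (c *\<^sub>C f) (y n) - L (c *\<^sub>C f)) < e" "cmod (apply_hinf f (y n) - L f) < e"
        by (auto simp: dist_norm)
      have "L (c *\<^sub>C f) - c * L f = c * (apply_hinf f (y n) - L f)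
          - (apply_hinf (c *\<^sub>C f) (y n) - L (c *\<^sub>C f))"
        by (simp add: apply_hinf_simps scaleC_complex_def algebra_simps)
      also have "cmod \<dots> \<le> cmod c * e + e"
        by (rule norm_triangle_le_diff, rule add_mono)
          (use n in \<open>auto simp: norm_mult intro!: mult_left_mono\<close>)
      finally show "cmod (L (c *\<^sub>C f) - c * L f) \<le> (cmod c + 1) * e" by (simp add: algebra_simps)
    qed (simp add: add_nonneg_pos)
    then show ?thesis by simp
  qed
  have "cmod (L h) \<le> norm h" for h using L(1) by (auto simp: PiE_def)
  then have "bounded_linear L"
    by (intro bounded_linear_intro[where K = 1])
      (simp_all add: add scale scaleR_conv_of_real flip: scaleC_of_real)
  then have "bounded_clinear L" by (simp add: bounded_clinear_def scale scaleC_complex_def)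
  moreover have "L h = c" if lim: "(\<lambda>n. apply_hinf h (y n)) \<longlonglongrightarrow> c" for h c
  proof -
    have "L h - c = 0"
    proof (rule zeroI[of _ 2])
      fix e :: real assume e: "e > 0"
      then obtain N where N: "\<And>n. n \<ge> N \<Longrightarrow> cmod (apply_hinf h (y n) - c) < e"
        using LIMSEQ_D[OF lim] by blast
      from near[OF e, of N h h h] obtain n where n: "n \<ge> N" "cmod (apply_hinf h (y n) - L h) < e"
        by (auto simp: dist_norm)
      have "L h - c = (apply_hinf h (y n) - c) - (apply_hinf h (y n) - L h)" by simp
      also have "cmod \<dots> \<le> e + e"
        by (rule norm_triangle_le_diff, rule add_mono) (use n N[OF n(1)] in auto)
      finally show "cmod (L h - c) \<le> 2 * e" by simp
    qed simp
    then show ?thesis by simp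
  qed
  ultimately show thesis using that by blast
qed

text \<open>
  A failure of Grothendieck's double limit criterion: for \<open>((1 + u (\<phi> (y\<^sub>n))) / 2) ^ k\<close> the limit
  over \<open>k\<close> first is \<open>0\<close>, the limit over \<open>n\<close> first is \<open>1\<close>.
\<close>

lemma not_weakly_compact_comp_inf:
  fixes \<phi> :: "('y::complex_normed_vector, 'x::complex_normed_vector) hl0"
    and u :: "'x \<Rightarrow> complex"
  assumes \<phi>: "apply_hl0 \<phi> ` ball 0 1 \<subseteq> ball 0 1"
    and u: "bounded_clinear u" "\<And>x. cmod (u x) \<le> norm x"
    and peak: "\<And>\<eta>. \<eta> > 0 \<Longrightarrow> \<exists>y\<in>ball 0 1. cmod (1 - u (apply_hl0 \<phi> y)) < \<eta>"
  shows "\<not> weakly_compact_operator (comp_inf \<phi>)"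
proof
  assume "weakly_compact_operator (comp_inf \<phi>)"
  let ?K = "weak_topology closure_of (comp_inf \<phi> ` cball 0 1)"
  have K: "compactin weak_topology ?K"
    using \<open>weakly_compact_operator (comp_inf \<phi>)\<close> by (simp add: weakly_compact_operator_def)
  have "\<forall>n. \<exists>y\<in>ball 0 1. cmod (1 - u (apply_hl0 \<phi> y)) < inverse (Suc n)"
    by (intro allI peak) simp
  then obtain y where y: "\<And>n. y n \<in> ball 0 1"
    "\<And>n. cmod (1 - u (apply_hl0 \<phi> (y n))) < inverse (Suc n)"
    by metis
  have ulim: "(\<lambda>n. u (apply_hl0 \<phi> (y n))) \<longlonglongrightarrow> 1"
  proof (rule LIM_zero_cancel, rule LIMSEQ_norm_0)
    show "cmod (u (apply_hl0 \<phi> (y n)) - 1) < 1 / real (Suc n)" for n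
      using y(2)[of n] by (simp add: norm_minus_commute inverse_eq_divide)
  qed
  have half: "cmod ((1 + u x) / 2) < 1" if "x \<in> ball 0 1" for x
    using u(2)[of x] that norm_triangle_ineq[of 1 "u x"] by (simp add: norm_divide)
  have "\<exists>F. norm F \<le> 1 \<and> (\<forall>x\<in>ball 0 1. apply_hinf F x = ((1 + u x) / 2) ^ k)" for k
  proof -
    have "(\<lambda>z :: complex. ((1 + z) / 2) ^ k) cfrechet_holomorphic_on UNIV"
      unfolding cfrechet_holomorphic_on_complex_iff by (intro holomorphic_intros) auto
    then have hol: "(\<lambda>x. ((1 + u x) / 2) ^ k) cfrechet_holomorphic_on ball 0 1"
      by (rule cfrechet_holomorphic_on_compose[OF _ bounded_clinear_imp_holomorphic[OF u(1)]]) simp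
    have "cmod (((1 + u x) / 2) ^ k) \<le> 1" if "x \<in> ball 0 1" for x
      using half[OF that] by (simp only: norm_power) (intro power_le_one, auto)
    from ex_hinf[OF hol this] show ?thesis by metis
  qed
  then obtain F where F: "\<And>k. norm (F k) \<le> 1"
    "\<And>k x. x \<in> ball 0 1 \<Longrightarrow> apply_hinf (F k) x = ((1 + u x) / 2) ^ k"
    by metis
  define a where "a k = comp_inf \<phi> (F k)" for k
  have a: "apply_hinf (a k) z = ((1 + u (apply_hl0 \<phi> z)) / 2) ^ k" if "z \<in> ball 0 1" for k z
    unfolding a_def apply_comp_inf[OF \<phi> that] by (rule F(2)) (use \<phi> that in blast)
  have "a k \<in> ?K" for k
  proof (rule subsetD[OF closure_of_subset])
    show "a k \<in> comp_inf \<phi> ` cball 0 1" using F(1) by (auto simp: a_def)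
  qed (simp add: topspace_weak_topology)
  with K obtain h where h: "\<And>U. openin weak_topology U \<Longrightarrow> h \<in> U \<Longrightarrow> infinite {k. a k \<in> U}"
    by (rule compactin_sequence_cluster_point[where a = a]) auto
  obtain L :: "'y hinf \<Rightarrow> complex" where L: "bounded_clinear L"
    "\<And>h c. (\<lambda>n. apply_hinf h (y n)) \<longlonglongrightarrow> c \<Longrightarrow> L h = c"
    by (rule evaluation_limit_functional[of y, OF y(1)]) blast
  have "L (a k) = 1" for k
  proof (rule L(2))
    have "(\<lambda>n. ((1 + u (apply_hl0 \<phi> (y n))) / 2) ^ k) \<longlonglongrightarrow> ((1 + 1) / 2) ^ k"
      by (intro tendsto_intros ulim) simp
    then show "(\<lambda>n. apply_hinf (a k) (y n)) \<longlonglongrightarrow> 1" by (simp add: a[OF y(1)])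
  qed
  moreover have "L h = 0"
  proof -
    have "apply_hinf h z = 0" if z: "z \<in> ball 0 1" for z
    proof (rule ccontr)
      assume "apply_hinf h z \<noteq> 0"
      define r where "r = cmod (apply_hinf h z) / 2"
      have r: "r > 0" using \<open>apply_hinf h z \<noteq> 0\<close> by (simp add: r_def)
      have "apply_hl0 \<phi> z \<in> ball 0 1" using \<phi> z by blast
      then have "(\<lambda>k. apply_hinf (a k) z) \<longlonglongrightarrow> 0"
        unfolding a[OF z] by (intro LIMSEQ_power_zero half)
      then obtain N where N: "\<And>k. k \<ge> N \<Longrightarrow> cmod (apply_hinf (a k) z) < r"
        using LIMSEQ_D[OF _ r] by force
      have "infinite {k. a k \<in> (\<lambda>f. apply_hinf f z) -` ball (apply_hinf h z) r}"
        using r by (intro h openin_weak_topology_vimage bounded_clinear_evaluation[OF z]) auto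
      then obtain k where "k \<ge> N" "dist (apply_hinf h z) (apply_hinf (a k) z) < r"
        unfolding infinite_nat_iff_unbounded_le by auto
      then show False
        using N[of k] norm_triangle_ineq[of "apply_hinf h z - apply_hinf (a k) z" "apply_hinf (a k) z"]
        by (simp add: dist_norm r_def)
    qed
    then have "(\<lambda>n. apply_hinf h (y n)) = (\<lambda>_. 0)" using y(1) by blast
    then show ?thesis by (intro L(2)) simp
  qed
  ultimately have "{k. a k \<in> L -` (- {1})} = {}" "h \<in> L -` (- {1})" by auto
  then show False
    using h[OF openin_weak_topology_vimage[OF L(1), of "- {1}"]] by auto
qed

section \<open>Copies of \<open>\<ell>\<^sub>\<infinity>\<close>\<close>

definition unit_sequence :: "nat \<Rightarrow> ell_infinity"
  where "unit_sequence n = Bcontfun (\<lambda>k. if k = n then 1 else 0)"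

lemma apply_unit_sequence: "apply_bcontfun (unit_sequence n) k = (if k = n then 1 else 0)"
proof -
  have "(\<lambda>k. if k = n then 1 else 0 :: complex) \<in> bcontfun"
    by (rule bcontfun_normI[where b = 1]) auto
  then show ?thesis by (simp add: unit_sequence_def Bcontfun_inverse)
qed

lemma norm_unit_sequence: "norm (unit_sequence n) \<le> 1"
  by (rule norm_bound) (simp add: apply_unit_sequence)

lemma norm_unit_sequence_diff:
  assumes "m \<noteq> n"
  shows "1 \<le> norm (unit_sequence m - unit_sequence n)"
  using norm_bounded[of "unit_sequence m - unit_sequence n" m] assms
  by (simp add: minus_bcontfun.rep_eq apply_unit_sequence)

text \<open>
  The unit sequences are uniformly separated, and so are their images under an isomorphism; by
  compactness, however, some subsequence of the images is Cauchy.
\<close>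

lemma compact_operator_not_fixes_copy:
  assumes "compact_operator T"
  shows "\<not> fixes_copy_of_ell_infinity T"
proof
  assume "fixes_copy_of_ell_infinity T"
  then obtain G J where J: "isomorphism_on (UNIV :: ell_infinity set) G J"
    and T: "isomorphism_on G (T ` G) T"
    unfolding fixes_copy_of_ell_infinity_def by blast
  obtain j where j: "homeomorphism UNIV G J j" using J unfolding isomorphism_on_def by blast
  obtain t where t: "homeomorphism G (T ` G) T t" using T unfolding isomorphism_on_def by blast
  have Jadd: "J (x + y) = J x + J y" for x y
    using J unfolding isomorphism_on_def by blast
  have JG: "J x \<in> G" for x using j unfolding homeomorphism_def by blast
  have Tadd: "T (J x + J y) = T (J x) + T (J y)" for x y
    using T JG unfolding isomorphism_on_def by blast
  define S where "S x = T (J x)" for x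
  have Sdiff: "S (x - y) = S x - S y" for x y
    using Jadd[of "x - y" y] Tadd[of "x - y" y] by (simp add: S_def)
  have J0: "J 0 = 0" using Jadd[of 0 0] by simp
  have S0: "S 0 = 0" using Sdiff[of 0 0] by simp
  \<comment> \<open>The inverse of \<open>S\<close>; its continuity at \<open>0\<close> bounds \<open>S\<close> from below.\<close>
  define s where "s = j \<circ> t"
  have s: "continuous_on (range S) s"
    unfolding s_def
    by (rule continuous_on_compose)
      (use j t JG in \<open>auto simp: homeomorphism_def S_def elim!: continuous_on_subset\<close>)
  have sS: "s (S x) = x" for x
    using j t JG[of x] by (simp add: s_def S_def homeomorphism_def)
  have "continuous_on UNIV J" using j by (simp add: homeomorphism_def)
  then obtain \<eta> where \<eta>: "\<eta> > 0" "\<And>x. norm x < \<eta> \<Longrightarrow> norm (J x) < 1"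
    unfolding continuous_on_iff
    using J0 by (metis UNIV_I dist_norm diff_zero zero_less_one)
  define \<zeta> where "\<zeta> = \<eta> / 2"
  have \<zeta>: "\<zeta> > 0" "\<zeta> < \<eta>" using \<eta> by (auto simp: \<zeta>_def)
  have "0 \<in> range S" using S0 by (metis rangeI)
  with s obtain \<delta> where \<delta>: "\<delta> > 0" "\<And>x. norm (S x) < \<delta> \<Longrightarrow> norm x < \<zeta>"
    unfolding continuous_on_iff
    using \<zeta>(1) sS S0 by (metis dist_norm diff_zero rangeI)
  define z where "z n = complex_of_real \<zeta> *\<^sub>C unit_sequence n" for n
  have "norm (z n) < \<eta>" for n
  proof -
    have "norm (z n) = \<zeta> * norm (unit_sequence n)" using \<zeta> by (simp add: z_def norm_scaleC)
    also have "\<dots> \<le> \<zeta> * 1" using \<zeta> by (intro mult_left_mono norm_unit_sequence) simp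
    finally show ?thesis using \<zeta> by linarith
  qed
  then have "J (z n) \<in> cball 0 1" for n using \<eta>(2)[of "z n"] by simp
  then have "\<forall>n. S (z n) \<in> closure (T ` cball 0 1)"
    unfolding S_def by (intro allI subsetD[OF closure_subset] imageI)
  then obtain l r where r: "strict_mono (r :: nat \<Rightarrow> nat)" "((\<lambda>n. S (z n)) \<circ> r) \<longlonglongrightarrow> l"
    using assms
    unfolding compact_operator_def compact_eq_seq_compact_metric seq_compact_def by metis
  have "Cauchy ((\<lambda>n. S (z n)) \<circ> r)" using r(2) convergent_Cauchy convergentI by blast
  then obtain N where N: "\<And>m n. m \<ge> N \<Longrightarrow> n \<ge> N \<Longrightarrow> dist (S (z (r m))) (S (z (r n))) < \<delta>"
    using metric_CauchyD[OF _ \<delta>(1), of "(\<lambda>n. S (z n)) \<circ> r"] unfolding comp_def by blast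
  have "norm (S (z (r N) - z (r (Suc N)))) < \<delta>"
    using N[of N "Suc N"] by (simp add: Sdiff dist_norm)
  then have "norm (z (r N) - z (r (Suc N))) < \<zeta>" by (rule \<delta>(2))
  moreover have "z m - z n = complex_of_real \<zeta> *\<^sub>C (unit_sequence m - unit_sequence n)" for m n
    by (simp add: z_def complex_vector.scale_right_diff_distrib)
  moreover have "r N \<noteq> r (Suc N)" using r(1) by (metis lessI order_less_irrefl strict_monoD)
  ultimately show False
    using norm_unit_sequence_diff[of "r N" "r (Suc N)"] \<zeta>
    by (simp add: norm_scaleC)
qed

lemma isomorphism_onI:
  fixes f :: "'a::complex_normed_vector \<Rightarrow> 'b::complex_normed_vector"
  assumes G: "complex_vector.subspace G"
    and add: "\<And>x y. x \<in> G \<Longrightarrow> y \<in> G \<Longrightarrow> f (x + y) = f x + f y"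
    and scale: "\<And>c x. x \<in> G \<Longrightarrow> f (c *\<^sub>C x) = c *\<^sub>C f x"
    and upper: "\<And>x. x \<in> G \<Longrightarrow> norm (f x) \<le> K * norm x"
    and lower: "\<And>x. x \<in> G \<Longrightarrow> norm x \<le> C * norm (f x)" and pos: "K \<ge> 0" "C \<ge> 0"
  shows "isomorphism_on G (f ` G) f"
proof -
  have diff: "f (x - y) = f x - f y" if "x \<in> G" "y \<in> G" for x y
    using add[of "x - y" y] complex_vector.subspace_diff[OF G that] that by simp
  have inj: "inj_on f G"
  proof (rule inj_onI)
    fix x y assume "x \<in> G" "y \<in> G" "f x = f y"
    then show "x = y"
      using lower[of "x - y"] complex_vector.subspace_diff[OF G] by (simp add: diff)
  qed
  have "K-lipschitz_on G f"
    using upper complex_vector.subspace_diff[OF G] pos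
    by (intro lipschitz_onI) (simp_all add: dist_norm flip: diff)
  moreover have "C-lipschitz_on (f ` G) (inv_into G f)"
    using lower complex_vector.subspace_diff[OF G] pos inj
    by (intro lipschitz_onI) (auto simp: dist_norm inv_into_f_f simp flip: diff)
  ultimately have "homeomorphism G (f ` G) f (inv_into G f)"
    using inj by (auto simp: homeomorphism_def inv_into_f_f intro: lipschitz_on_continuous_on)
  moreover have "complex_vector.subspace (f ` G)"
    unfolding complex_vector.subspace_def
  proof (intro conjI ballI allI)
    show "0 \<in> f ` G"
      using diff[of 0 0] complex_vector.subspace_0[OF G] by (metis diff_self imageI)
    show "x + y \<in> f ` G" if "x \<in> f ` G" "y \<in> f ` G" for x y
      using that complex_vector.subspace_add[OF G] by (auto simp flip: add)
    show "c *\<^sub>C x \<in> f ` G" if "x \<in> f ` G" for c x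
      using that complex_vector.subspace_scale[OF G] by (auto simp flip: scale)
  qed
  ultimately show ?thesis using G add scale unfolding isomorphism_on_def by blast
qed

text \<open>
  If \<open>T \<circ> J\<close> is bounded below then so are \<open>J\<close> and the restriction of \<open>T\<close> to the range of \<open>J\<close>.
\<close>

lemma fixes_copyI:
  fixes J :: "ell_infinity \<Rightarrow> 'a::complex_normed_vector"
    and T :: "'a \<Rightarrow> 'b::complex_normed_vector"
  assumes T: "bounded_clinear T"
    and J: "\<And>a b. J (a + b) = J a + J b" "\<And>c a. J (c *\<^sub>C a) = c *\<^sub>C J a"
    and upper: "\<And>a. norm (J a) \<le> K * norm a" and lower: "\<And>a. norm a \<le> C * norm (T (J a))"
    and pos: "K \<ge> 0" "C \<ge> 0"
  shows "fixes_copy_of_ell_infinity T"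
proof -
  have Tlin: "T (x + y) = T x + T y" "T (c *\<^sub>C x) = c *\<^sub>C T x" for x y c
    using T by (simp_all add: bounded_clinear_def linear_simps)
  obtain B where B: "B \<ge> 0" "\<And>x. norm (T x) \<le> B * norm x"
    using T bounded_linear.nonneg_bounded unfolding bounded_clinear_def
    by (metis mult.commute)
  have "norm a \<le> C * B * norm (J a)" for a
    using order_trans[OF lower mult_left_mono[OF B(2) pos(2)], of a] by (simp add: mult.assoc)
  then have J': "isomorphism_on UNIV (range J) J"
    using J upper pos B by (intro isomorphism_onI[where K = K and C = "C * B"]) auto
  have "norm x \<le> K * C * norm (T x)" if "x \<in> range J" for x
    using that order_trans[OF upper mult_left_mono[OF lower pos(1)]] by (auto simp: mult.assoc)
  then have "isomorphism_on (range J) (T ` range J) T"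
    using J' B pos Tlin
    by (intro isomorphism_onI[where K = B and C = "K * C"]) (auto simp: isomorphism_on_def)
  with J' show ?thesis unfolding fixes_copy_of_ell_infinity_def by blast
qed

section \<open>Interpolation by bumps at widely separated scales\<close>

text \<open>
  On the right half plane this function has modulus comparable to \<open>1\<close> where \<open>\<bar>v\<bar>\<close> is about \<open>\<epsilon>\<close> and
  decays linearly in \<open>\<bar>v\<bar> / \<epsilon>\<close> and \<open>\<epsilon> / \<bar>v\<bar>\<close> on the two sides.  With \<open>v = 1 - z\<close> it is a bounded function
  on the unit disc that is concentrated at distance \<open>\<epsilon>\<close> from \<open>1\<close>, in all directions; so the approach
  of \<open>z\<close> to \<open>1\<close> may be tangential.
\<close>

definition bump :: "real \<Rightarrow> complex \<Rightarrow> complex"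
  where "bump \<epsilon> v = \<epsilon> * v / (\<epsilon> + v)\<^sup>2"

lemma bump_denominator:
  fixes \<epsilon> :: real and v :: complex
  assumes "\<epsilon> > 0" "Re v > 0"
  shows "\<epsilon> \<le> cmod (\<epsilon> + v)" "cmod v \<le> cmod (\<epsilon> + v)"
proof -
  show "\<epsilon> \<le> cmod (\<epsilon> + v)" using assms complex_Re_le_cmod[of "\<epsilon> + v"] by simp
  have "(Re v)\<^sup>2 \<le> (\<epsilon> + Re v)\<^sup>2" using assms by (intro power_mono) auto
  then show "cmod v \<le> cmod (\<epsilon> + v)" by (simp add: cmod_def)
qed

lemma bump_bounds:
  assumes "\<epsilon> > 0" "Re v > 0"
  shows "cmod (bump \<epsilon> v) \<le> cmod v / \<epsilon>" "cmod (bump \<epsilon> v) \<le> \<epsilon> / cmod v" "cmod (bump \<epsilon> v) \<le> 1"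
proof -
  note d = bump_denominator[OF assms]
  have v: "cmod v > 0" using assms(2) by auto
  have eq: "cmod (bump \<epsilon> v) = \<epsilon> * cmod v / (cmod (\<epsilon> + v))\<^sup>2"
    using assms(1) by (simp add: bump_def norm_mult norm_divide norm_power)
  have "\<epsilon> * cmod v / (cmod (\<epsilon> + v))\<^sup>2 \<le> \<epsilon> * cmod v / \<epsilon>\<^sup>2"
    using d assms v by (intro divide_left_mono power_mono mult_pos_pos zero_less_power) auto
  then show "cmod (bump \<epsilon> v) \<le> cmod v / \<epsilon>" using assms(1) by (simp add: eq power2_eq_square)
  have "\<epsilon> * cmod v / (cmod (\<epsilon> + v))\<^sup>2 \<le> \<epsilon> * cmod v / (cmod v)\<^sup>2"
    using d assms v by (intro divide_left_mono power_mono mult_pos_pos zero_less_power) auto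
  then show "cmod (bump \<epsilon> v) \<le> \<epsilon> / cmod v" using v by (simp add: eq power2_eq_square)
  have "\<epsilon> * cmod v \<le> (cmod (\<epsilon> + v))\<^sup>2"
    unfolding power2_eq_square using d assms by (intro mult_mono) auto
  moreover have "(cmod (\<epsilon> + v))\<^sup>2 > 0" using d assms by (intro zero_less_power) linarith
  ultimately show "cmod (bump \<epsilon> v) \<le> 1" by (simp add: eq)
qed

lemma bump_peak:
  assumes "Re v > 0"
  shows "1 / 4 \<le> cmod (bump (cmod v) v)"
proof -
  have v: "cmod v > 0" using assms by auto
  have "cmod (cmod v + v) \<le> 2 * cmod v"
    using norm_triangle_ineq[of "complex_of_real (cmod v)" v] by simp
  then have le: "(cmod (cmod v + v))\<^sup>2 \<le> (2 * cmod v)\<^sup>2" by (intro power_mono) auto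
  have "0 < cmod (cmod v + v)" using bump_denominator(1)[OF v assms] v by linarith
  then have "(cmod v * cmod v) / (2 * cmod v)\<^sup>2 \<le> (cmod v * cmod v) / (cmod (cmod v + v))\<^sup>2"
    using le v by (intro divide_left_mono mult_pos_pos zero_less_power) auto
  then show ?thesis using v by (simp add: bump_def norm_mult norm_divide norm_power power2_eq_square)
qed

text \<open>
  The last term dominates the geometric sum; \<open>1 / 99 = 1 / 100 + 1 / 100\<^sup>2 + \<dots>\<close>.
\<close>

lemma lacunary_sum_before:
  fixes \<epsilon> :: "nat \<Rightarrow> real"
  assumes "\<And>n. \<epsilon> n > 0" "\<And>n. \<epsilon> (Suc n) \<le> \<epsilon> n / 100"
  shows "(\<Sum>k<n. 1 / \<epsilon> k) \<le> 1 / (99 * \<epsilon> n)"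
proof (induction n)
  case (Suc n)
  have "(\<Sum>k<Suc n. 1 / \<epsilon> k) \<le> 1 / (99 * \<epsilon> n) + 1 / \<epsilon> n" using Suc by simp
  also have "\<dots> = 1 / (99 * (\<epsilon> n / 100))" using assms(1)[of n] by (simp add: field_simps)
  also have "\<dots> \<le> 1 / (99 * \<epsilon> (Suc n))"
    using assms(1)[of "Suc n"] assms(1)[of n] assms(2)[of n] by (intro divide_left_mono) auto
  finally show ?case .
qed (use assms(1)[of 0] in simp)

text \<open>
  The first term dominates, again with \<open>1 / 99\<close> as the value of the geometric series.
\<close>

lemma lacunary_sum_after:
  fixes \<epsilon> :: "nat \<Rightarrow> real"
  assumes "\<And>n. \<epsilon> n > 0" "\<And>n. \<epsilon> (Suc n) \<le> \<epsilon> n / 100"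
  shows "(\<Sum>k\<in>{n<..<m}. \<epsilon> k) \<le> \<epsilon> n / 99"
proof -
  have "(\<Sum>k\<in>{n<..n + i}. \<epsilon> k) + \<epsilon> (n + i) / 99 \<le> \<epsilon> n / 99" for i
  proof (induction i)
    case (Suc i)
    have "{n<..n + Suc i} = insert (n + Suc i) {n<..n + i}" by auto
    then show ?case using Suc assms(2)[of "n + i"] by simp
  qed simp
  from this[of m] have "(\<Sum>k\<in>{n<..n + m}. \<epsilon> k) \<le> \<epsilon> n / 99"
    using assms(1)[of "n + m"] by linarith
  moreover have "(\<Sum>k\<in>{n<..<m}. \<epsilon> k) \<le> (\<Sum>k\<in>{n<..n + m}. \<epsilon> k)"
    using assms(1) by (intro sum_mono2) (auto intro: less_imp_le)
  ultimately show ?thesis by linarith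
qed

text \<open>
  Here \<open>n\<close> is the index at which the scales pass below \<open>\<bar>v\<bar>\<close>, and the corresponding bump is left out:
  all the others are small at \<open>v\<close> because their scales are far from \<open>\<bar>v\<bar>\<close>.
\<close>

lemma bump_sum_bound:
  fixes \<epsilon> :: "nat \<Rightarrow> real"
  assumes \<epsilon>: "\<And>n. \<epsilon> n > 0" "\<And>n. \<epsilon> (Suc n) \<le> \<epsilon> n / 100" and v: "Re v > 0"
    and n: "\<And>k. k < n \<Longrightarrow> cmod v \<le> \<epsilon> k" "\<epsilon> n \<le> cmod v"
  shows "(\<Sum>k\<in>{..<n} \<union> {n<..<N}. cmod (bump (\<epsilon> k) v)) \<le> (\<Sum>k<n. cmod v / \<epsilon> k) + 1 / 99"
proof -
  have v0: "cmod v > 0" using v by auto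
  have "(\<Sum>k\<in>{n<..<N}. cmod (bump (\<epsilon> k) v)) \<le> (\<Sum>k\<in>{n<..<N}. \<epsilon> k / cmod v)"
    by (intro sum_mono bump_bounds \<epsilon> v)
  also have "\<dots> = (\<Sum>k\<in>{n<..<N}. \<epsilon> k) / cmod v" by (simp add: sum_divide_distrib)
  also have "\<dots> \<le> \<epsilon> n / 99 / cmod v"
    using v0 lacunary_sum_after[of \<epsilon> n N, OF \<epsilon>] by (intro divide_right_mono) auto
  also have "\<dots> \<le> 1 / 99" using n(2) v0 by (simp add: field_simps)
  finally have "(\<Sum>k\<in>{n<..<N}. cmod (bump (\<epsilon> k) v)) \<le> 1 / 99" .
  moreover have "(\<Sum>k<n. cmod (bump (\<epsilon> k) v)) \<le> (\<Sum>k<n. cmod v / \<epsilon> k)"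
    by (intro sum_mono bump_bounds \<epsilon> v)
  moreover have "(\<Sum>k\<in>{..<n} \<union> {n<..<N}. cmod (bump (\<epsilon> k) v))
      = (\<Sum>k<n. cmod (bump (\<epsilon> k) v)) + (\<Sum>k\<in>{n<..<N}. cmod (bump (\<epsilon> k) v))"
    by (intro sum.union_disjoint) auto
  ultimately show ?thesis by linarith
qed

lemma bump_holomorphic:
  assumes "\<epsilon> > 0"
  shows "(\<lambda>z. bump \<epsilon> (1 - z)) holomorphic_on ball 0 1"
proof -
  have "complex_of_real \<epsilon> + (1 - z) \<noteq> 0" if "z \<in> ball 0 1" for z
  proof -
    have "Re (1 - z) > 0" using that complex_Re_le_cmod[of z] by simp
    from bump_denominator(1)[OF assms this] assms show ?thesis by auto
  qed
  then show ?thesis unfolding bump_def by (intro holomorphic_intros) auto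
qed

text \<open>
  Take \<open>g a = (\<Sum>k. a k * q k)\<close>, where \<open>q k\<close> is the bump of scale \<open>\<bar>1 - w k\<bar>\<close>.  At any point at most two
  bumps are not small, which gives the bound \<open>3 * \<parallel>a\<parallel>\<close>.  At \<open>w n\<close> the \<open>n\<close>-th bump has modulus at least
  \<open>1 / 4\<close> and the others together contribute at most \<open>2 / 99 \<le> 1 / 40\<close>.
\<close>

lemma peak_interpolation:
  fixes w :: "nat \<Rightarrow> complex"
  assumes w: "\<And>n. w n \<in> ball 0 1" and sep: "\<And>n. cmod (1 - w (Suc n)) \<le> cmod (1 - w n) / 100"
  obtains g :: "ell_infinity \<Rightarrow> complex \<Rightarrow> complex"
  where "\<And>a. g a holomorphic_on ball 0 1"
    "\<And>a b z. z \<in> ball 0 1 \<Longrightarrow> g (a + b) z = g a z + g b z"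
    "\<And>c a z. z \<in> ball 0 1 \<Longrightarrow> g (c *\<^sub>C a) z = c * g a z"
    "\<And>a z. z \<in> ball 0 1 \<Longrightarrow> cmod (g a z) \<le> 3 * norm a"
    "\<And>a n. cmod (apply_bcontfun a n) / 4 - norm a / 40 \<le> cmod (g a (w n))"
proof
  define \<epsilon> where "\<epsilon> n = cmod (1 - w n)" for n
  have Re: "Re (1 - z) > 0" if "z \<in> ball 0 1" for z
    using that complex_Re_le_cmod[of z] by simp
  have \<epsilon>: "\<epsilon> n > 0" "\<epsilon> (Suc n) \<le> \<epsilon> n / 100" for n
    using Re[OF w[of n]] sep[of n] by (auto simp: \<epsilon>_def)
  let ?q = "\<lambda>k z. bump (\<epsilon> k) (1 - z)"
  let ?t = "\<lambda>a k z. apply_bcontfun a k * ?q k z"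
  define g where "g a z = (\<Sum>k. ?t a k z)" for a :: ell_infinity and z
  have \<epsilon>_lim: "\<epsilon> n \<le> \<epsilon> 0 * (1 / 100) ^ n" for n
  proof (induction n)
    case (Suc n)
    then show ?case using \<epsilon>(2)[of n] by simp
  qed simp
  have qsum: "(\<Sum>k<N. cmod (?q k z)) \<le> 3" if z: "z \<in> ball 0 1" for N z
  proof -
    let ?v = "1 - z"
    have v: "Re ?v > 0" "cmod ?v > 0" using Re[OF z] by auto
    have "(\<lambda>n. \<epsilon> 0 * (1 / 100) ^ n) \<longlonglongrightarrow> \<epsilon> 0 * 0"
      by (intro tendsto_intros LIMSEQ_realpow_zero) auto
    then have "eventually (\<lambda>n. \<epsilon> 0 * (1 / 100) ^ n < cmod ?v) sequentially"
      using v(2) by (intro order_tendstoD) auto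
    then have ex: "\<exists>n. \<epsilon> n < cmod ?v"
      using \<epsilon>_lim by (meson eventually_sequentially order_le_less_trans order_refl)
    \<comment> \<open>The bumps \<open>n - 1\<close> and \<open>n\<close>, whose scales surround \<open>\<bar>1 - z\<bar>\<close>, contribute at most \<open>1\<close> each.\<close>
    define n where "n = (LEAST n. \<epsilon> n < cmod ?v)"
    have n: "\<epsilon> n < cmod ?v" using ex unfolding n_def by (rule LeastI_ex)
    have n': "cmod ?v \<le> \<epsilon> k" if "k < n" for k
      using not_less_Least[of k "\<lambda>n. \<epsilon> n < cmod ?v"] that by (auto simp: n_def not_less)
    have "(\<Sum>k<n. cmod ?v / \<epsilon> k) \<le> 100 / 99"
    proof (cases n)
      case (Suc m)
      have le: "cmod ?v \<le> \<epsilon> m" using n' Suc by simp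
      have "(\<Sum>k<n. cmod ?v / \<epsilon> k) = cmod ?v * (\<Sum>k<m. 1 / \<epsilon> k) + cmod ?v / \<epsilon> m"
        by (simp add: Suc sum_distrib_left)
      also have "\<dots> \<le> \<epsilon> m * (1 / (99 * \<epsilon> m)) + 1"
        using le \<epsilon>(1)[of m] \<epsilon>(1)
        by (intro add_mono mult_mono lacunary_sum_before[of \<epsilon> m, OF \<epsilon>] sum_nonneg) (auto intro: less_imp_le)
      also have "\<dots> = 100 / 99" using \<epsilon>(1)[of m] by simp
      finally show ?thesis .
    qed simp
    then have 1: "(\<Sum>k\<in>{..<n} \<union> {n<..<N}. cmod (?q k z)) \<le> 100 / 99 + 1 / 99"
      using bump_sum_bound[of \<epsilon> ?v n N, OF \<epsilon> v(1) n'] n by simp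
    have "(\<Sum>k<N. cmod (?q k z)) \<le> (\<Sum>k\<in>insert n ({..<n} \<union> {n<..<N}). cmod (?q k z))"
      by (intro sum_mono2) auto
    also have "\<dots> = cmod (?q n z) + (\<Sum>k\<in>{..<n} \<union> {n<..<N}. cmod (?q k z))"
      by (intro sum.insert) auto
    also have "\<dots> \<le> 1 + (100 / 99 + 1 / 99)"
      by (intro add_mono 1 bump_bounds(3) \<epsilon> v)
    finally show ?thesis by simp
  qed
  have tq: "(\<Sum>k\<in>A. cmod (?t a k z)) \<le> norm a * (\<Sum>k\<in>A. cmod (?q k z))" for A a z
    unfolding sum_distrib_left norm_mult by (intro sum_mono mult_right_mono norm_bounded) auto
  have tsum: "(\<Sum>k<N. cmod (?t a k z)) \<le> 3 * norm a" if "z \<in> ball 0 1" for N a z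
    using order_trans[OF tq mult_left_mono[OF qsum[OF that] norm_ge_zero]] by (simp add: mult.commute)
  have summable: "summable (\<lambda>k. ?t a k z)" if "z \<in> ball 0 1" for a z
    by (rule summable_norm_cancel, rule summableI_nonneg_bounded[OF _ tsum[OF that]]) simp
  have lim: "(\<lambda>N. \<Sum>k<N. ?t a k z) \<longlonglongrightarrow> g a z" if "z \<in> ball 0 1" for a z
    unfolding g_def by (rule summable_LIMSEQ[OF summable[OF that]])
  show bound: "cmod (g a z) \<le> 3 * norm a" if "z \<in> ball 0 1" for a z
    by (rule LIMSEQ_le_const2[OF tendsto_norm[OF lim[OF that]]])
      (use order_trans[OF norm_sum tsum[OF that]] in blast)
  show "g (a + b) z = g a z + g b z" if "z \<in> ball 0 1" for a b z
    unfolding g_def suminf_add[OF summable[OF that] summable[OF that]]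
    by (simp add: plus_bcontfun.rep_eq algebra_simps)
  show "g (c *\<^sub>C a) z = c * g a z" if "z \<in> ball 0 1" for c a z
    unfolding g_def suminf_mult[OF summable[OF that], symmetric]
    by (simp add: apply_bcontfun_scaleC scaleC_complex_def mult.assoc)
  show "g a holomorphic_on ball 0 1" for a
    unfolding cfrechet_holomorphic_on_complex_iff[symmetric]
  proof (rule holomorphic_on_bounded_limit[OF _ open_ball _ lim])
    show "(\<lambda>z. \<Sum>k<N. ?t a k z) cfrechet_holomorphic_on ball 0 1" for N
      unfolding cfrechet_holomorphic_on_complex_iff
      by (intro holomorphic_intros bump_holomorphic \<epsilon>)
    show "cmod (\<Sum>k<N. ?t a k z) \<le> 3 * norm a" if "z \<in> ball 0 1" for N z
      using order_trans[OF norm_sum tsum[OF that]] .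
  qed
  show "cmod (apply_bcontfun a n) / 4 - norm a / 40 \<le> cmod (g a (w n))" for a n
  proof -
    let ?z = "w n"
    have v: "Re (1 - ?z) > 0" using Re[OF w] .
    have dec: "\<epsilon> n \<le> \<epsilon> k" if "k < n" for k
    proof -
      have "\<epsilon> (Suc i) \<le> \<epsilon> i" for i using \<epsilon>(1)[of i] \<epsilon>(2)[of i] by linarith
      from lift_Suc_antimono_le[of \<epsilon>, OF this less_imp_le[OF that]] show ?thesis .
    qed
    have rest: "(\<Sum>k\<in>{..<n} \<union> {n<..<N}. cmod (?q k ?z)) \<le> 1 / 40" for N
    proof -
      have "(\<Sum>k<n. cmod (1 - ?z) / \<epsilon> k) = \<epsilon> n * (\<Sum>k<n. 1 / \<epsilon> k)"
        by (simp add: sum_distrib_left \<epsilon>_def)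
      also have "\<dots> \<le> \<epsilon> n * (1 / (99 * \<epsilon> n))"
        using \<epsilon>(1)[of n] by (intro mult_left_mono lacunary_sum_before \<epsilon>) auto
      also have "\<dots> = 1 / 99" using \<epsilon>(1)[of n] by simp
      finally show ?thesis
        using bump_sum_bound[of \<epsilon> "1 - ?z" n N, OF \<epsilon> v] dec by (simp add: \<epsilon>_def)
    qed
    have "cmod (apply_bcontfun a n) / 4 - norm a / 40 \<le> cmod (\<Sum>k<N. ?t a k ?z)" if "N > n" for N
    proof -
      have "{..<N} = insert n ({..<n} \<union> {n<..<N})" using that by auto
      then have eq: "(\<Sum>k<N. ?t a k ?z) = ?t a n ?z + (\<Sum>k\<in>{..<n} \<union> {n<..<N}. ?t a k ?z)"
        by (simp only:) (intro sum.insert, auto)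
      have "cmod (?t a n ?z) - cmod (\<Sum>k\<in>{..<n} \<union> {n<..<N}. ?t a k ?z)
          \<le> cmod (\<Sum>k<N. ?t a k ?z)"
        unfolding eq by (rule norm_diff_ineq)
      moreover have "cmod (\<Sum>k\<in>{..<n} \<union> {n<..<N}. ?t a k ?z) \<le> norm a * (1 / 40)"
        using order_trans[OF norm_sum order_trans[OF tq mult_left_mono[OF rest norm_ge_zero]]] .
      moreover have "cmod (apply_bcontfun a n) * (1 / 4) \<le> cmod (?t a n ?z)"
        unfolding norm_mult using bump_peak[OF v] by (intro mult_left_mono) (auto simp: \<epsilon>_def)
      ultimately show ?thesis by simp
    qed
    then show ?thesis
      by (intro LIMSEQ_le_const[OF tendsto_norm[OF lim[OF w]]] exI[of _ "Suc n"]) auto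
  qed
qed

text \<open>
  An antiderivative of a bounded function on the disc is Lipschitz, and normalised to vanish at \<open>0\<close> it
  depends linearly on the function because it is unique.
\<close>

lemma antiderivative_operator:
  fixes g :: "ell_infinity \<Rightarrow> complex \<Rightarrow> complex"
    and u :: "'x::complex_normed_vector \<Rightarrow> complex"
  assumes hol: "\<And>a. g a holomorphic_on ball 0 1"
    and add: "\<And>a b z. z \<in> ball 0 1 \<Longrightarrow> g (a + b) z = g a z + g b z"
    and scale: "\<And>c a z. z \<in> ball 0 1 \<Longrightarrow> g (c *\<^sub>C a) z = c * g a z"
    and bound: "\<And>a z. z \<in> ball 0 1 \<Longrightarrow> cmod (g a z) \<le> K * norm a" and K: "K \<ge> 0"
    and u: "bounded_clinear u" "\<And>x. cmod (u x) \<le> norm x"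
  obtains G :: "ell_infinity \<Rightarrow> complex \<Rightarrow> complex" and J :: "ell_infinity \<Rightarrow> ('x, complex) hl0"
  where "\<forall>a. \<forall>z\<in>ball 0 1. (G a has_field_derivative g a z) (at z)"
    "\<forall>a. \<forall>x\<in>ball 0 1. apply_hl0 (J a) x = G a (u x)"
    "\<forall>a b. J (a + b) = J a + J b" "\<forall>c a. J (c *\<^sub>C a) = c *\<^sub>C J a"
    "\<forall>a. norm (J a) \<le> K * norm a"
proof -
  have "\<exists>G. G 0 = 0 \<and> (\<forall>z\<in>ball 0 1. (G has_field_derivative g a z) (at z))" for a
  proof -
    obtain H where H: "\<And>z. z \<in> ball 0 1 \<Longrightarrow> (H has_field_derivative g a z) (at z within ball 0 1)"
      by (rule holomorphic_convex_primitive'[OF convex_ball open_ball hol[of a]]) blast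
    have "((\<lambda>z. H z - H 0) has_field_derivative g a z) (at z)" if "z \<in> ball 0 1" for z
      using H[OF that] that at_within_open[OF that open_ball]
      by (auto intro!: derivative_eq_intros)
    then show ?thesis by (intro exI[of _ "\<lambda>z. H z - H 0"]) simp
  qed
  then obtain G where G: "\<And>a. G a 0 = 0"
    "\<And>a z. z \<in> ball 0 1 \<Longrightarrow> (G a has_field_derivative g a z) (at z)" by metis
  have unique: "F z = 0" if "F 0 = 0" "\<And>z. z \<in> ball 0 1 \<Longrightarrow> (F has_field_derivative 0) (at z)"
    "z \<in> ball 0 1" for F :: "complex \<Rightarrow> complex" and z
  proof -
    have "\<exists>c. \<forall>z\<in>ball 0 1. F z = c"
      using that(2)
      by (intro has_field_derivative_zero_constant convex_ball) (auto intro: has_field_derivative_at_within)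
    then show ?thesis using that(1,3) by (metis centre_in_ball zero_less_one)
  qed
  have uball: "u x \<in> ball 0 1" if "x \<in> ball 0 1" for x using that u(2)[of x] by simp
  have "\<exists>F. (\<forall>x\<in>ball 0 1. apply_hl0 F x = G a (u x)) \<and> norm F \<le> K * norm a" for a
  proof -
    have "G a cfrechet_holomorphic_on ball 0 1"
      unfolding cfrechet_holomorphic_on_complex_iff
      using G(2)[of _ a] unfolding holomorphic_on_def field_differentiable_def
      by (blast intro: has_field_derivative_at_within)
    then have 1: "(\<lambda>x. G a (u x)) cfrechet_holomorphic_on ball 0 1"
      by (rule cfrechet_holomorphic_on_compose[OF _ bounded_clinear_imp_holomorphic[OF u(1)]])
        (use uball in blast)
    have 2: "cmod (G a (u x) - G a (u y)) \<le> K * norm a * norm (x - y)"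
      if "x \<in> ball 0 1" "y \<in> ball 0 1" for x y
    proof -
      have "cmod (G a (u x) - G a (u y)) \<le> K * norm a * cmod (u x - u y)"
        using G(2) bound uball that
        by (intro field_differentiable_bound[where S = "ball 0 1" and f' = "g a"])
          (auto intro: has_field_derivative_at_within)
      also have "u x - u y = u (x - y)" using u(1) by (simp add: bounded_clinear_def linear_simps)
      also have "K * norm a * cmod (u (x - y)) \<le> K * norm a * norm (x - y)"
        using K by (intro mult_left_mono u(2)) auto
      finally show ?thesis .
    qed
    have 0: "G a (u 0) = 0" using u(2)[of 0] by (simp add: G(1))
    show ?thesis using ex_hl0[OF 1 0 _ 2] K by (metis mult_nonneg_nonneg norm_ge_zero)
  qed
  then obtain J where J: "\<And>a x. x \<in> ball 0 1 \<Longrightarrow> apply_hl0 (J a) x = G a (u x)"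
    "\<And>a. norm (J a) \<le> K * norm a" by metis
  have Gadd: "G (a + b) z = G a z + G b z" if "z \<in> ball 0 1" for a b z
  proof -
    have "((\<lambda>z. G (a + b) z - (G a z + G b z)) has_field_derivative 0) (at z)"
      if "z \<in> ball 0 1" for z
      using G(2)[OF that] by (auto intro!: derivative_eq_intros simp: add[OF that])
    from unique[OF _ this that] show ?thesis by (simp add: G(1))
  qed
  have Gscale: "G (c *\<^sub>C a) z = c * G a z" if "z \<in> ball 0 1" for c a z
  proof -
    have "((\<lambda>z. G (c *\<^sub>C a) z - c * G a z) has_field_derivative 0) (at z)"
      if "z \<in> ball 0 1" for z
      using G(2)[OF that] by (auto intro!: derivative_eq_intros simp: scale[OF that])
    from unique[OF _ this that] show ?thesis by (simp add: G(1))
  qed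
  have "J (a + b) = J a + J b" for a b
    by (rule hl0_eqI) (simp only: J(1) plus_hl0.rep_eq Gadd uball)
  moreover have "J (c *\<^sub>C a) = c *\<^sub>C J a" for c a
    by (rule hl0_eqI) (simp only: J(1) scaleC_hl0.rep_eq scaleC_complex_def Gscale uball)
  ultimately show thesis using that[of G J] G(2) J by blast
qed

section \<open>Points at which the composition operator preserves derivatives\<close>

text \<open>
  By the Schwarz lemma, \<open>\<bar>\<psi> (1 - 2 * \<delta>)\<bar> \<le> 1 - 2 * \<delta>\<close> and \<open>t \<ge> 1 - \<delta>\<close>.  So \<open>\<bar>\<psi>\<bar>\<close> increases by at least
  \<open>\<delta>\<close> on the interval from \<open>1 - 2 * \<delta>\<close> to \<open>t\<close>, whose length is less than \<open>2 * \<delta>\<close>.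
\<close>

lemma radial_derivative_near_boundary:
  fixes \<psi> :: "complex \<Rightarrow> complex"
  assumes \<psi>: "\<psi> holomorphic_on ball 0 1" "\<psi> 0 = 0" "\<And>z. z \<in> ball 0 1 \<Longrightarrow> cmod (\<psi> z) < 1"
    and t: "0 \<le> t" "t < 1" and \<delta>: "cmod (\<psi> (of_real t)) = 1 - \<delta>" "\<delta> \<le> 1 / 2"
  obtains r where "1 - 2 * \<delta> \<le> r" "0 \<le> r" "r \<le> t" "1 / 2 \<le> cmod (deriv \<psi> (of_real r))"
proof (rule ccontr)
  assume "\<not> thesis"
  note witness = that
  have small: "cmod (deriv \<psi> (of_real r)) \<le> 1 / 2" if "1 - 2 * \<delta> \<le> r" "0 \<le> r" "r \<le> t" for r
    using witness[OF that] \<open>\<not> thesis\<close> by linarith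
  have Schwarz: "cmod (\<psi> z) \<le> cmod z" if "cmod z < 1" for z
    using Schwarz_Lemma(1)[OF \<psi>(1,2) _ that] \<psi>(3) by simp
  let ?s = "1 - 2 * \<delta>"
  have \<delta>t: "1 - \<delta> \<le> t" using Schwarz[of "of_real t"] t \<delta>(1) by simp
  have \<delta>0: "\<delta> > 0" using \<psi>(3)[of "of_real t"] t \<delta>(1) by simp
  have "cmod (\<psi> (of_real t) - \<psi> (of_real ?s)) \<le> 1 / 2 * cmod (of_real t - of_real ?s)"
  proof (rule field_differentiable_bound[where f' = "deriv \<psi>"])
    let ?S = "closed_segment (complex_of_real ?s) (of_real t)"
    have S: "\<exists>r. z = of_real r \<and> ?s \<le> r \<and> r \<le> t" if "z \<in> ?S" for z
      using that \<delta>t \<delta>0 unfolding closed_segment_of_real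
      by (auto simp: closed_segment_eq_real_ivl)
    show "convex ?S" by simp
    show "(\<psi> has_field_derivative deriv \<psi> z) (at z within ?S)" if z: "z \<in> ?S" for z
    proof -
      obtain r where r: "z = of_real r" "?s \<le> r" "r \<le> t" using S[OF z] by blast
      then have "z \<in> ball 0 1" using t \<delta>(2) by simp
      then show ?thesis
        by (rule has_field_derivative_at_within[OF holomorphic_derivI[OF \<psi>(1) open_ball]])
    qed
    show "cmod (deriv \<psi> z) \<le> 1 / 2" if z: "z \<in> ?S" for z
    proof -
      obtain r where r: "z = of_real r" "?s \<le> r" "r \<le> t" using S[OF z] by blast
      then show ?thesis using small[of r] \<delta>(2) by simp
    qed
  qed auto
  also have "cmod (of_real t - of_real ?s) = t - ?s"
    using \<delta>t \<delta>0 by (simp only: of_real_diff[symmetric] norm_of_real)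
  finally have "cmod (\<psi> (of_real t)) - cmod (\<psi> (of_real ?s)) \<le> (t - ?s) / 2"
    using norm_triangle_ineq2[of "\<psi> (of_real t)" "\<psi> (of_real ?s)"] by linarith
  moreover have "cmod (\<psi> (of_real ?s)) \<le> ?s"
    using Schwarz[of "of_real ?s"] \<delta>(2) \<delta>0 by (simp del: of_real_diff)
  ultimately show False using t \<delta>(1) by simp
qed

lemma derivative_bounded_by_norm_hl0:
  fixes F :: "('y::complex_normed_vector, complex) hl0"
  assumes y: "y \<in> ball 0 1" and e: "norm e = 1"
    and D: "((\<lambda>\<zeta>. apply_hl0 F (y + \<zeta> *\<^sub>C e)) has_field_derivative D) (at 0)"
  shows "cmod D \<le> norm F"
proof -
  have "((\<lambda>\<zeta>. cmod ((apply_hl0 F (y + \<zeta> *\<^sub>C e) - apply_hl0 F y) / \<zeta>)) \<longlongrightarrow> cmod D) (at 0)"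
    using tendsto_norm[OF D[unfolded has_field_derivative_iff]] by simp
  moreover have "\<forall>\<^sub>F \<zeta> in at 0. cmod ((apply_hl0 F (y + \<zeta> *\<^sub>C e) - apply_hl0 F y) / \<zeta>) \<le> norm F"
  proof -
    have "\<forall>\<^sub>F \<zeta> in at (0::complex). cmod \<zeta> < 1 - norm y"
      using y by (auto simp: eventually_at intro!: exI[of _ "1 - norm y"])
    then show ?thesis
      unfolding eventually_at_filter
    proof (rule eventually_mono)
      fix \<zeta> :: complex assume *: "\<zeta> \<noteq> 0 \<longrightarrow> \<zeta> \<in> UNIV \<longrightarrow> cmod \<zeta> < 1 - norm y"
      show "\<zeta> \<noteq> 0 \<longrightarrow> \<zeta> \<in> UNIV \<longrightarrow>
          cmod ((apply_hl0 F (y + \<zeta> *\<^sub>C e) - apply_hl0 F y) / \<zeta>) \<le> norm F"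
      proof (intro impI)
        assume \<zeta>: "\<zeta> \<noteq> 0"
        have "norm (y + \<zeta> *\<^sub>C e) \<le> norm y + norm (\<zeta> *\<^sub>C e)" by (rule norm_triangle_ineq)
        then have "y + \<zeta> *\<^sub>C e \<in> ball 0 1" using * \<zeta> e by (simp add: norm_scaleC)
        from norm_hl0_bound[OF this y, of F] show
          "cmod ((apply_hl0 F (y + \<zeta> *\<^sub>C e) - apply_hl0 F y) / \<zeta>) \<le> norm F"
          using \<zeta> e by (simp add: norm_divide norm_scaleC field_simps)
      qed
    qed
  qed
  ultimately show ?thesis by (intro tendsto_upperbound) auto
qed

text \<open>
  Apply the preceding estimate to \<open>u \<circ> \<phi>\<close> on the complex line through a point where this function is
  close to \<open>1\<close>.  The new point has distance at most \<open>2 * \<delta>\<close> from the old one, so the Lipschitz condition on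
  \<open>\<phi>\<close> keeps the value close to \<open>1\<close>.
\<close>

lemma points_with_large_derivative:
  fixes \<phi> :: "('y::complex_normed_vector, 'x::complex_normed_vector) hl0"
    and u :: "'x \<Rightarrow> complex"
  assumes \<phi>: "apply_hl0 \<phi> ` ball 0 1 \<subseteq> ball 0 1"
    and u: "bounded_clinear u" "\<And>x. cmod (u x) \<le> norm x"
    and peak: "\<And>\<eta>. \<eta> > 0 \<Longrightarrow> \<exists>y\<in>ball 0 1. cmod (1 - u (apply_hl0 \<phi> y)) < \<eta>"
    and \<eta>: "\<eta> > 0"
  shows "\<exists>y\<in>ball 0 1. \<exists>e d. norm e = 1 \<and> cmod (1 - u (apply_hl0 \<phi> y)) < \<eta> \<and>
    ((\<lambda>\<zeta>. u (apply_hl0 \<phi> (y + \<zeta> *\<^sub>C e))) has_field_derivative d) (at 0) \<and> 1 / 2 \<le> cmod d"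
proof -
  define f where "f y = u (apply_hl0 \<phi> y)" for y
  \<comment> \<open>The value moves by at most \<open>2 * \<parallel>\<phi>\<parallel> * \<kappa>\<close> and is already within \<open>\<kappa>\<close> of \<open>1\<close>.\<close>
  define \<kappa> where "\<kappa> = min (1 / 2) (\<eta> / (2 * norm \<phi> + 1))"
  have den: "2 * norm \<phi> + 1 > 0" using norm_ge_zero[of \<phi>] by linarith
  have \<kappa>: "\<kappa> > 0" using \<eta> den by (simp add: \<kappa>_def)
  obtain y where y: "y \<in> ball 0 1" "cmod (1 - f y) < \<kappa>"
    using peak[OF \<kappa>] by (auto simp: f_def)
  have f0: "f 0 = 0" using u(2)[of 0] by (simp add: f_def apply_hl0_0)
  have f1: "cmod (f z) < 1" if "z \<in> ball 0 1" for z
  proof -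
    have "apply_hl0 \<phi> z \<in> ball 0 1" using \<phi> that by blast
    then show ?thesis using u(2)[of "apply_hl0 \<phi> z"] by (simp add: f_def)
  qed
  have fhol: "f cfrechet_holomorphic_on ball 0 1"
    unfolding f_def
    by (rule cfrechet_holomorphic_on_compose[OF bounded_clinear_imp_holomorphic[OF u(1), of UNIV]
          apply_hl0_holomorphic]) simp
  have flip: "cmod (f x - f z) \<le> norm \<phi> * norm (x - z)" if "x \<in> ball 0 1" "z \<in> ball 0 1" for x z
  proof -
    have "f x - f z = u (apply_hl0 \<phi> x - apply_hl0 \<phi> z)"
      using u(1) by (simp add: f_def bounded_clinear_def linear_simps)
    then show ?thesis using order_trans[OF u(2) norm_hl0_bound[OF that]] by simp
  qed
  have "y \<noteq> 0" using y(2) f0 by (auto simp: \<kappa>_def)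
  define t where "t = norm y"
  define e where "e = complex_of_real (inverse t) *\<^sub>C y"
  have t: "0 < t" "t < 1" using y(1) \<open>y \<noteq> 0\<close> by (auto simp: t_def)
  have e: "norm e = 1" using t by (simp add: e_def norm_scaleC t_def norm_inverse)
  have te: "of_real t *\<^sub>C e = y"
    using t by (simp add: e_def scaleC_scaleC scaleC_one flip: of_real_mult)
  define \<psi> where "\<psi> \<zeta> = f (0 + \<zeta> *\<^sub>C e)" for \<zeta>
  have line: "0 + \<zeta> *\<^sub>C e \<in> ball 0 1" if "\<zeta> \<in> ball 0 1" for \<zeta>
    using that e by (simp add: norm_scaleC)
  have \<psi>hol: "\<psi> holomorphic_on ball 0 1"
    unfolding \<psi>_def by (rule holomorphic_on_complex_line[OF fhol line])
  define \<delta> where "\<delta> = 1 - cmod (f y)"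
  have \<delta>\<kappa>: "\<delta> < \<kappa>" using y(2) norm_triangle_ineq2[of 1 "f y"] by (simp add: \<delta>_def)
  obtain r where r: "1 - 2 * \<delta> \<le> r" "0 \<le> r" "r \<le> t" "1 / 2 \<le> cmod (deriv \<psi> (of_real r))"
  proof (rule radial_derivative_near_boundary[OF \<psi>hol])
    show "\<psi> 0 = 0" by (simp add: \<psi>_def f0)
    show "cmod (\<psi> z) < 1" if "z \<in> ball 0 1" for z unfolding \<psi>_def by (rule f1[OF line[OF that]])
    show "cmod (\<psi> (of_real t)) = 1 - \<delta>" by (simp add: \<psi>_def \<delta>_def te)
    show "\<delta> \<le> 1 / 2" using \<delta>\<kappa> by (simp add: \<kappa>_def)
  qed (use t in auto)
  define p where "p = complex_of_real r *\<^sub>C e"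
  have r1: "complex_of_real r \<in> ball 0 1" using r t by simp
  have p: "p \<in> ball 0 1" using line[OF r1] by (simp add: p_def)
  have "(\<psi> has_field_derivative deriv \<psi> (of_real r)) (at (0 + of_real r))"
    using holomorphic_derivI[OF \<psi>hol open_ball r1] by simp
  then have "((\<lambda>\<zeta>. \<psi> (\<zeta> + of_real r)) has_field_derivative deriv \<psi> (of_real r)) (at 0)"
    by (simp only: DERIV_shift)
  moreover have "\<psi> (\<zeta> + of_real r) = f (p + \<zeta> *\<^sub>C e)" for \<zeta>
    by (simp add: \<psi>_def p_def scaleC_add_left add.commute)
  ultimately have der: "((\<lambda>\<zeta>. f (p + \<zeta> *\<^sub>C e)) has_field_derivative deriv \<psi> (of_real r)) (at 0)"
    by simp
  have "y - p = of_real (t - r) *\<^sub>C e"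
    by (simp add: p_def te[symmetric] complex_vector.scale_left_diff_distrib)
  then have "norm (y - p) = t - r" using r e by (simp only: norm_scaleC norm_of_real) simp
  then have "cmod (f y - f p) \<le> norm \<phi> * (2 * \<delta>)"
    using flip[OF y(1) p] r t mult_left_mono[of "t - r" "2 * \<delta>" "norm \<phi>"] by simp
  also have "\<dots> \<le> norm \<phi> * (2 * \<kappa>)" using \<delta>\<kappa> by (intro mult_left_mono) auto
  finally have "cmod (1 - f p) < (2 * norm \<phi> + 1) * \<kappa>"
    using y(2) norm_triangle_ineq[of "1 - f y" "f y - f p"] by (simp add: algebra_simps)
  also have "\<dots> \<le> (2 * norm \<phi> + 1) * (\<eta> / (2 * norm \<phi> + 1))"
    using den by (intro mult_left_mono) (auto simp: \<kappa>_def)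
  also have "\<dots> = \<eta>" using den by simp
  finally show ?thesis using p e r(4) der unfolding f_def by blast
qed

text \<open>
  In the direction \<open>e\<close> belonging to \<open>y n\<close>, the derivative of the composed function at \<open>y n\<close> is
  \<open>g a (w n) * d\<close> with \<open>\<bar>d\<bar> \<ge> 1 / 2\<close>.  Hence \<open>\<parallel>comp_L \<phi> (J a)\<parallel>\<close> is at least
  \<open>\<bar>a n\<bar> / 8 - \<parallel>a\<parallel> / 80\<close> for every \<open>n\<close>, and the supremum over \<open>n\<close> bounds \<open>J\<close> followed by the operator
  from below.
\<close>

lemma comp_L_fixes_copy:
  fixes \<phi> :: "('y::complex_normed_vector, 'x::complex_normed_vector) hl0"
    and u :: "'x \<Rightarrow> complex"
  assumes \<phi>: "apply_hl0 \<phi> ` ball 0 1 \<subseteq> ball 0 1"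
    and u: "bounded_clinear u" "\<And>x. cmod (u x) \<le> norm x"
    and peak: "\<And>\<eta>. \<eta> > 0 \<Longrightarrow> \<exists>y\<in>ball 0 1. cmod (1 - u (apply_hl0 \<phi> y)) < \<eta>"
  shows "fixes_copy_of_ell_infinity (comp_L \<phi>)"
proof -
  define P where "P y \<longleftrightarrow> y \<in> ball 0 1 \<and> (\<exists>e d. norm e = 1 \<and>
    ((\<lambda>\<zeta>. u (apply_hl0 \<phi> (y + \<zeta> *\<^sub>C e))) has_field_derivative d) (at 0) \<and> 1 / 2 \<le> cmod d)" for y
  have ex: "\<exists>y. P y \<and> cmod (1 - u (apply_hl0 \<phi> y)) < \<eta>" if "\<eta> > 0" for \<eta>
    using points_with_large_derivative[OF \<phi> u peak that] unfolding P_def by blast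
  have in_ball: "u (apply_hl0 \<phi> y) \<in> ball 0 1" if "y \<in> ball 0 1" for y
  proof -
    have "apply_hl0 \<phi> y \<in> ball 0 1" using \<phi> that by blast
    then show ?thesis using u(2)[of "apply_hl0 \<phi> y"] by simp
  qed
  have "\<exists>y. \<forall>n. P (y n) \<and>
      cmod (1 - u (apply_hl0 \<phi> (y (Suc n)))) \<le> cmod (1 - u (apply_hl0 \<phi> (y n))) / 100"
  proof (rule dependent_nat_choice)
    show "\<exists>y. P y" using ex[of 1] by auto
    fix y and n :: nat assume "P y"
    then have "u (apply_hl0 \<phi> y) \<noteq> 1" using in_ball[of y] by (auto simp: P_def)
    then have "cmod (1 - u (apply_hl0 \<phi> y)) / 100 > 0" by simp
    from ex[OF this] show "\<exists>z. P z \<and>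
      cmod (1 - u (apply_hl0 \<phi> z)) \<le> cmod (1 - u (apply_hl0 \<phi> y)) / 100"
      by (auto intro: less_imp_le)
  qed
  then obtain y where y: "\<And>n. P (y n)"
    "\<And>n. cmod (1 - u (apply_hl0 \<phi> (y (Suc n)))) \<le> cmod (1 - u (apply_hl0 \<phi> (y n))) / 100" by blast
  define w where "w n = u (apply_hl0 \<phi> (y n))" for n
  have yb: "y n \<in> ball 0 1" for n using y(1) by (simp add: P_def)
  have w: "w n \<in> ball 0 1" for n unfolding w_def by (rule in_ball[OF yb])
  obtain g :: "ell_infinity \<Rightarrow> complex \<Rightarrow> complex"
    where g: "\<And>a. g a holomorphic_on ball 0 1"
      "\<And>a b z. z \<in> ball 0 1 \<Longrightarrow> g (a + b) z = g a z + g b z"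
      "\<And>c a z. z \<in> ball 0 1 \<Longrightarrow> g (c *\<^sub>C a) z = c * g a z"
      "\<And>a z. z \<in> ball 0 1 \<Longrightarrow> cmod (g a z) \<le> 3 * norm a"
      "\<And>a n. cmod (apply_bcontfun a n) / 4 - norm a / 40 \<le> cmod (g a (w n))"
    using peak_interpolation[of w] w y(2) unfolding w_def by metis
  obtain G and J :: "ell_infinity \<Rightarrow> ('x, complex) hl0"
    where GJ: "\<forall>a. \<forall>z\<in>ball 0 1. (G a has_field_derivative g a z) (at z)"
      "\<forall>a. \<forall>x\<in>ball 0 1. apply_hl0 (J a) x = G a (u x)"
      "\<forall>a b. J (a + b) = J a + J b" "\<forall>c a. J (c *\<^sub>C a) = c *\<^sub>C J a"
      "\<forall>a. norm (J a) \<le> 3 * norm a"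
    by (rule antiderivative_operator[of g 3 u, OF g(1-4) _ u]) auto
  have G: "(G a has_field_derivative g a z) (at z)" if "z \<in> ball 0 1" for a z
    using GJ(1) that by blast
  have JG: "apply_hl0 (J a) x = G a (u x)" if "x \<in> ball 0 1" for a x
    using GJ(2) that by blast
  have J: "J (a + b) = J a + J b" "J (c *\<^sub>C a) = c *\<^sub>C J a" "norm (J a) \<le> 3 * norm a" for a b c
    using GJ(3-5) by blast+
  have lower: "norm a \<le> 10 * norm (comp_L \<phi> (J a))" for a
  proof -
    let ?F = "comp_L \<phi> (J a)"
    have "cmod (apply_bcontfun a n) \<le> 8 * norm ?F + norm a / 10" for n
    proof -
      obtain e d where e: "norm e = 1" and d: "1 / 2 \<le> cmod d"
        "((\<lambda>\<zeta>. u (apply_hl0 \<phi> (y n + \<zeta> *\<^sub>C e))) has_field_derivative d) (at 0)"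
        using y(1)[of n] unfolding P_def by blast
      let ?S = "(\<lambda>\<zeta>. y n + \<zeta> *\<^sub>C e) -` ball 0 1"
      have "continuous_on UNIV (\<lambda>\<zeta>. y n + \<zeta> *\<^sub>C e)"
        by (rule has_derivative_continuous_on[OF complex_line_has_derivative])
      then have S: "open ?S" "0 \<in> ?S" using yb[of n] by (auto intro: open_vimage)
      have "((\<lambda>\<zeta>. G a (u (apply_hl0 \<phi> (y n + \<zeta> *\<^sub>C e)))) has_field_derivative g a (w n) * d) (at 0)"
        using G[OF w[of n], of a] by (intro DERIV_chain2[OF _ d(2)]) (simp add: w_def)
      then have "((\<lambda>\<zeta>. apply_hl0 ?F (y n + \<zeta> *\<^sub>C e)) has_field_derivative g a (w n) * d) (at 0)"
      proof (rule has_field_derivative_transform_within_open[OF _ S])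
        fix \<zeta> assume "\<zeta> \<in> ?S"
        then have b: "y n + \<zeta> *\<^sub>C e \<in> ball 0 1" by blast
        then have "apply_hl0 \<phi> (y n + \<zeta> *\<^sub>C e) \<in> ball 0 1" using \<phi> by blast
        then show "G a (u (apply_hl0 \<phi> (y n + \<zeta> *\<^sub>C e))) = apply_hl0 ?F (y n + \<zeta> *\<^sub>C e)"
          unfolding apply_comp_L[OF \<phi> b] by (rule JG[symmetric])
      qed
      from derivative_bounded_by_norm_hl0[OF yb e this]
      have "cmod (g a (w n)) * cmod d \<le> norm ?F" by (simp add: norm_mult)
      moreover have "cmod (g a (w n)) * (1 / 2) \<le> cmod (g a (w n)) * cmod d"
        using d(1) by (intro mult_left_mono) auto
      ultimately show ?thesis using g(5)[of a n] by linarith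
    qed
    then have "norm a \<le> 8 * norm ?F + norm a / 10" by (rule norm_bound)
    then show ?thesis using norm_ge_zero[of ?F] by linarith
  qed
  show ?thesis
    by (rule fixes_copyI[OF bounded_clinear_comp_L[OF \<phi>] J lower]) auto
qed

text \<open>
  Choose \<open>u\<close> to norm a limit point of the values \<open>\<phi> (y\<^sub>n)\<close> as \<open>\<parallel>\<phi> (y\<^sub>n)\<parallel> \<longlonglongrightarrow> 1\<close>.
\<close>

lemma peaking_functional:
  fixes \<phi> :: "('y::complex_normed_vector, 'x::complex_normed_vector) hl0" and B :: "'x set"
  assumes B: "finite B" "complex_vector.span B = UNIV"
    and \<phi>: "apply_hl0 \<phi> ` ball 0 1 \<subseteq> ball 0 1" and sup: "\<not> sup_norm \<phi> < 1"
  obtains u :: "'x \<Rightarrow> complex" where "bounded_clinear u" "\<And>x. cmod (u x) \<le> norm x"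
    "\<And>\<eta>. \<eta> > 0 \<Longrightarrow> \<exists>y\<in>ball 0 1. cmod (1 - u (apply_hl0 \<phi> y)) < \<eta>"
proof -
  have "\<exists>y\<in>ball 0 1. 1 - inverse (Suc n) < norm (apply_hl0 \<phi> y)" for n
  proof (rule ccontr)
    assume "\<not> ?thesis"
    then have "sup_norm \<phi> \<le> 1 - inverse (Suc n)"
      unfolding sup_norm_def by (intro cSUP_least) (auto simp: not_less)
    moreover have "inverse (real (Suc n)) > 0" by simp
    ultimately show False using sup by linarith
  qed
  then obtain y where y: "\<And>n. y n \<in> ball 0 1"
    "\<And>n. 1 - inverse (Suc n) < norm (apply_hl0 \<phi> (y n))" by metis
  let ?x = "\<lambda>n. apply_hl0 \<phi> (y n)"
  have x: "?x n \<in> ball 0 1" for n using \<phi> y(1) by blast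
  then have "?x n \<in> cball 0 1" for n using ball_subset_cball by blast
  then obtain v r where r: "strict_mono (r :: nat \<Rightarrow> nat)" "(?x \<circ> r) \<longlonglongrightarrow> v"
    using finite_span_compact_cball[OF B]
    unfolding compact_eq_seq_compact_metric seq_compact_def by metis
  have "(\<lambda>n. norm (?x n)) \<longlonglongrightarrow> 1"
  proof (rule tendsto_sandwich)
    show "(\<lambda>n. 1 - inverse (real (Suc n))) \<longlonglongrightarrow> 1"
      using tendsto_diff[OF tendsto_const LIMSEQ_inverse_real_of_nat, of 1] by simp
    show "\<forall>\<^sub>F n in sequentially. 1 - inverse (real (Suc n)) \<le> norm (?x n)"
      using y(2) by (intro always_eventually allI less_imp_le)
    show "\<forall>\<^sub>F n in sequentially. norm (?x n) \<le> 1"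
      using x by (intro always_eventually allI less_imp_le) simp
  qed auto
  then have "(\<lambda>n. norm ((?x \<circ> r) n)) \<longlonglongrightarrow> 1"
    using LIMSEQ_subseq_LIMSEQ[OF _ r(1)] by (fastforce simp: comp_def)
  then have "norm v = 1" using LIMSEQ_unique tendsto_norm[OF r(2)] by blast
  then obtain u where u: "bounded_clinear u" "\<And>x. cmod (u x) \<le> norm x" "u v = 1"
    by (rule finite_span_norming_functional[OF B]) blast
  have "(\<lambda>n. u ((?x \<circ> r) n)) \<longlonglongrightarrow> 1"
    using bounded_linear.tendsto[OF _ r(2), of u] u by (simp add: bounded_clinear_def)
  then have "\<exists>y\<in>ball 0 1. cmod (1 - u (apply_hl0 \<phi> y)) < \<eta>" if \<eta>: "\<eta> > 0" for \<eta>
  proof -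
    obtain n where "cmod (u ((?x \<circ> r) n) - 1) < \<eta>"
      using LIMSEQ_D[OF \<open>(\<lambda>n. u ((?x \<circ> r) n)) \<longlonglongrightarrow> 1\<close> \<eta>] by blast
    then show ?thesis
      using y(1)[of "r n"] by (intro bexI[of _ "y (r n)"]) (simp_all add: norm_minus_commute)
  qed
  with u show thesis using that by blast
qed

section \<open>The equivalences\<close>

theorem corollary4p15:
  fixes \<phi> :: "('y::complex_banach, 'x::complex_banach) hl0"
  assumes "\<exists>B :: 'x set. finite_dimensional_vector_space (scaleC :: complex \<Rightarrow> 'x \<Rightarrow> 'x) B"
    and "\<exists>B :: 'y set. finite_dimensional_vector_space (scaleC :: complex \<Rightarrow> 'y \<Rightarrow> 'y) B"
    and "apply_hl0 \<phi> ` ball 0 1 \<subseteq> ball 0 1"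
  shows "(compact_operator (comp_L \<phi>) \<longleftrightarrow> \<not> fixes_copy_of_ell_infinity (comp_L \<phi>)) \<and>
    (\<not> fixes_copy_of_ell_infinity (comp_L \<phi>) \<longleftrightarrow> weakly_compact_operator (comp_inf \<phi>)) \<and>
    (weakly_compact_operator (comp_inf \<phi>) \<longleftrightarrow> compact_operator (comp_inf \<phi>)) \<and>
    (compact_operator (comp_inf \<phi>) \<longleftrightarrow> sup_norm \<phi> < 1)"
proof -
  obtain B :: "'x set" where "finite_dimensional_vector_space (scaleC :: complex \<Rightarrow> 'x \<Rightarrow> 'x) B"
    using assms(1) by blast
  then have B: "finite B" "complex_vector.span B = UNIV"
    using finite_dimensional_vector_space.finite_Basis finite_dimensional_vector_space.span_Basis
    by blast+
  note \<phi> = assms(3)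
  have 5: "compact_operator (comp_L \<phi>) \<and> compact_operator (comp_inf \<phi>)" if "sup_norm \<phi> < 1"
    using compact_comp_L_image[OF finite_span_compact_cball[OF B] \<phi> that]
      compact_comp_inf_image[OF finite_span_compact_cball[OF B] \<phi> that]
      bounded_clinear_comp_L[OF \<phi>] bounded_clinear_comp_inf[OF \<phi>]
    by (simp add: compact_operator_def closure_closed compact_imp_closed)
  have 0: "fixes_copy_of_ell_infinity (comp_L \<phi>) \<and> \<not> weakly_compact_operator (comp_inf \<phi>)"
    if "\<not> sup_norm \<phi> < 1"
    by (rule peaking_functional[OF B \<phi> that])
      (use comp_L_fixes_copy[OF \<phi>] not_weakly_compact_comp_inf[OF \<phi>] in blast)
  show ?thesis
    using 5 0 compact_operator_not_fixes_copy[of "comp_L \<phi>"]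
      compact_imp_weakly_compact_operator[of "comp_inf \<phi>"] by blast
qed

end
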